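(* Let $X$ be a quandle, $(D_X,\rho_{+\leftrightarrow -})$ its symmetric double, and $Y$ an $X$-set, regarded also as a $(D_X,\rho_{+\leftrightarrow -})$-set. Let $A$ be an abelian group, and let $\theta^{\rm Q}:C_2^{\rm Q}(X)_Y\to A$ and $\theta^{\rm SQ}:C_2^{\rm SQ}(D_X,\rho_{+\leftrightarrow -})_Y\to A$ be a quandle $2$-cocycle and a symmetric quandle $2$-cocycle, respectively, such that $\theta^{\rm Q}\circ T_2^{D_X\to X}=\theta^{\rm SQ}$. Let $(D,o)$ be a diagram of an oriented link and take $[C]_{\rm ori}\in{\rm Col}_{(D_X,\rho_{+\leftrightarrow -})_Y}(D)/\!\sim_{\rm ori}$ such that $o$ is the orientation induced by the canonical form of $(D,C)$. Then, as multi-sets, \[\Phi_{\theta^{\rm Q}}^{X_Y}(D,o)=\Phi_{\theta^{\rm SQ}}^{(D_X,\rho_{+\leftrightarrow -})_Y}(D,[C]_{\rm ori}).\]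
   Context: Quandles. A quandle $(X,* )$ is a set $X$ with a binary operation $*$ such that (Q1) $x*x=x$; (Q2) for all $x,y\in X$ there is a unique $z\in X$ with $z*y=x$, denoted $z=x*y^{-1}$; (Q3) $(x*y)*z=(x*z)*(y*z)$. Write $x*y^{+1}=x*y$. A good involution of $X$ is an involution $\rho:X\to X$ with $\rho(x*y)=\rho(x)*y$ and $x*\rho(y)=x*y^{-1}$; the pair $(X,\rho)$ is then a symmetric quandle. The symmetric double of $(X,* )$ is the symmetric quandle $(D_X,\rho_{+\leftrightarrow -})$ with $D_X=X^{+1}\sqcup X^{-1}$, where $X^{\varepsilon}=\{x^{\varepsilon}\mid x\in X\}$ are two copies of $X$, operation $x^{\varepsilon}\star y^{\delta}=(x*y^{\delta})^{\varepsilon}$ and $\rho_{+\leftrightarrow -}(x^{\varepsilon})=x^{-\varepsilon}$. Sets with action. $G_X=\langle x\in X\mid x*y=y^{-1}xy\ (x,y\in X)\rangle$; an $X$-set is a set $Y$ with a right action of $G_X$, written $r*g$. For a symmetric quandle, $G_{(X,\rho)}=\langle x\in X\mid x*y=y^{-1}xy,\ \rho(x)=x^{-1}\ (x,y\in X)\rangle$; an $(X,\rho)$-set is a set with a right action of $G_{(X,\rho)}$. An $X$-set $Y$ is a $(D_X,\rho_{+\leftrightarrow -})$-set via $r\star g=r*\pi(g)$, where $\pi:G_{(D_X,\rho_{+\leftrightarrow -})}\to G_X$ is the homomorphism sending the generator $x^{\varepsilon}$ to $x^{\varepsilon}\in G_X$ (i.e. $x$ or its inverse). Chain complexes and cocycles.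 For a quandle $X$ and an $X$-set $Y$, $C_n(X)_Y$ is the free abelian group on $Y\times X^n$ if $n\ge1$ and $0$ otherwise, with boundary $\partial_n(r,x_1,\ldots,x_n)=\sum_{i=1}^n(-1)^i\{(r,x_1,\ldots,\hat{x_i},\ldots,x_n)-(r*x_i,x_1*x_i,\ldots,x_{i-1}*x_i,\hat{x_i},x_{i+1},\ldots,x_n)\}$ for $n>1$ and $\partial_n=0$ otherwise. $D_n(X)_Y$ is generated by the tuples with $x_i=x_{i+1}$ for some $i$. $C_n^{\rm Q}(X)_Y=C_n(X)_Y/D_n(X)_Y$ with induced boundary $\partial_n^{\rm Q}$. For a symmetric quandle $(X,\rho)$ and an $(X,\rho)$-set $Y$, $D_n(X,\rho)_Y$ is generated by all $(r,x_1,\ldots,x_n)+(r*x_i,x_1*x_i,\ldots,x_{i-1}*x_i,\rho(x_i),x_{i+1},\ldots,x_n)$, and $C_n^{\rm SQ}(X,\rho)_Y=C_n(X)_Y/(D_n(X)_Y+D_n(X,\rho)_Y)$ with induced boundary $\partial_n^{\rm SQ}$. A quandle (resp. symmetric quandle) $2$-cocycle is a homomorphism $\theta$ from $C_2^{\rm Q}(X)_Y$ (resp. $C_2^{\rm SQ}(X,\rho)_Y$) to $A$ with $\theta\circ\partial_3^{\rm Q}=0$ (resp. $\theta\circ\partial_3^{\rm SQ}=0$). $C_n^{\rm SQ}(D_X,\rho_{+\leftrightarrow -})_Y$ is generated by tuples in $Y\times(X^{+1})^n$, and $T_n^{D_X\to X}:C_n^{\rm SQ}(D_X,\rho_{+\leftrightarrow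 -})_Y\to C_n^{\rm Q}(X)_Y$ is the (well-defined) chain isomorphism with $T_n^{D_X\to X}(r,x_1^{+1},\ldots,x_n^{+1})=(r,x_1,\ldots,x_n)$. Diagrams. A link is a disjoint union of circles embedded in $\mathbb R^3$; a diagram $D$ is its image under a generic projection to $\mathbb R^2$ with over/under information at crossings, shown by removing neighborhoods of the lower crossing points. Arcs of $D$ are the connected components of the resulting figure; semi-arcs are the connected components left after removing neighborhoods of all crossings; complementary regions are the connected regions into which the diagram separates $\mathbb R^2$. If $D$ has orientation $o$, each arc gets the normal orientation $n$ such that $(o,n)$ is the right-handed orientation of $\mathbb R^2$. A crossing is positive if the pair (normal orientation of the over-arc, normal orientation of an under-arc) is right-handed, negative otherwise. $X_Y$-colorings. An $X_Y$-coloring of $(D,o)$ assigns an element of $X$ to each arc and an element of $Y$ to each complementary region so that: at each crossing, if the under-arcs $\alpha_1,\alpha_2$ have labels $x_1,x_2$, the over-arc has label $x_3$, and the normal orientation of the over-arc points from $\alpha_1$ to $\alpha_2$, then $x_1*x_3=x_2$; and if regions $\gamma_1,\gamma_2$ labeled $r_1,r_2$ are adjacent over an arc labeled $x$ whose normal orientation points from $\gamma_1$ to $\gamma_2$, then $r_1*x=r_2$. ${\rm Col}_{X_Y}(D,o)$ is the set of these. $(X,\rho)_Y$-colorings. For a symmetric quandle $(X,\rho)$ and an $(X,\rho)$-set $Y$, an $(X,\rho)_Y$-coloring of an unoriented diagram $D$ is an equivalence class of assignments of a normal orientation and an element of $X$ to each semi-arc, and an element of $Y$ to each complementary region, such that: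 (i) if the two over-semi-arcs at a crossing have labels $x_1,x_2$, then $x_1=x_2$ if their normal orientations are coherent and $x_1=\rho(x_2)$ otherwise; (ii) if the under-semi-arcs $\alpha_1,\alpha_2$ at a crossing have labels $x_1,x_2$, and an over-semi-arc has label $x_3$ and normal orientation pointing from $\alpha_1$ to $\alpha_2$, then $x_1*x_3=x_2$ if the normal orientations of $\alpha_1,\alpha_2$ are coherent, and $x_1*x_3=\rho(x_2)$ otherwise; (iii) if regions $\gamma_1,\gamma_2$ labeled $r_1,r_2$ are adjacent over a semi-arc labeled $x$ whose normal orientation points from $\gamma_1$ to $\gamma_2$, then $r_1*x=r_2$. The equivalence is generated by basic inversions: reversing the normal orientation of a semi-arc and replacing its label $x$ by $\rho(x)$. ${\rm Col}_{(X,\rho)_Y}(D)$ is the set of these. Canonical form. Every $(D_X,\rho_{+\leftrightarrow -})_Y$-coloring $C$ of $D$ is represented by a unique assignment in which all semi-arc labels lie in $X^{+1}$, the canonical form of $C$ (or of $(D,C)$). Its normal orientations are coherent along each component; giving each semi-arc the orientation $o_\alpha$ such that $(o_\alpha,n_\alpha)$ is right-handed, with $n_\alpha$ the normal orientation in the canonical form, yields the orientation of $D$ induced by the canonical form of $(D,C)$. $C\sim_{\rm ori}C'$ if their canonical forms induce the same orientation; $[C]_{\rm ori}$ is the equivalence class. Weights. For $C\in{\rm Col}_{X_Y}(D,o)$ and a crossing $\chi$, let $\alpha_2$ be the over-arc, $\alpha_1$ the under-arc from which the normal orientation of $\alpha_2$ points, and $\gamma$ the region around $\chi$ from which the normal orientations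 of $\alpha_1$ and $\alpha_2$ both point; with labels $x_2,x_1,r$ respectively, the weight of $\chi$ is $\varepsilon(r,x_1,x_2)$, $\varepsilon=+$ if $\chi$ is positive and $-$ if negative. $W^{X_Y}((D,o),C)\in C_2^{\rm Q}(X)_Y$ is the sum of the weights over all crossings, and $\Phi_{\theta^{\rm Q}}^{X_Y}(D,o)=\{\theta^{\rm Q}(W^{X_Y}((D,o),C))\in A\mid C\in{\rm Col}_{X_Y}(D,o)\}$ as a multi-set. For $C\in{\rm Col}_{(X,\rho)_Y}(D)$ and a crossing $\chi$, choose one of the four regions $\gamma$ around $\chi$; let $\alpha_1,\alpha_2$ be the under- and over-semi-arcs at $\chi$ facing $\gamma$; by basic inversions assume their normal orientations $n_1,n_2$ point from $\gamma$; with labels $x_1,x_2,r$ of $\alpha_1,\alpha_2,\gamma$, the weight is $\varepsilon(r,x_1,x_2)$, where $\varepsilon=+$ if $(n_2,n_1)$ is right-handed and $-$ otherwise (its class in $C_2^{\rm SQ}(X,\rho)_Y$ does not depend on the choice of $\gamma$). $W^{(X,\rho)_Y}(D,C)\in C_2^{\rm SQ}(X,\rho)_Y$ is the sum of the weights over all crossings. Finally $\Phi_{\theta^{\rm SQ}}^{(D_X,\rho_{+\leftrightarrow -})_Y}(D,[C]_{\rm ori})=\{\theta^{\rm SQ}(W^{(D_X,\rho_{+\leftrightarrow -})_Y}(D,C'))\in A\mid C'\in[C]_{\rm ori}\}$ as a multi-set. *)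

theory Defs
  imports
    "HOL-Algebra.Free_Abelian_Groups"
    "HOL-Analysis.Analysis"
    "HOL-Library.Equipollence"
begin

section \<open>Quandles and symmetric quandles\<close>

text \<open>
  The same type of signs is used for the exponents in \<open>x\<^sup>+\<^sup>1, x\<^sup>-\<^sup>1\<close>, for the two
  directions of a strand and for the signs of crossings.
\<close>

datatype sign = Pos | Neg

fun opp :: "sign \<Rightarrow> sign" where
  "opp Pos = Neg"
| "opp Neg = Pos"

fun sval :: "sign \<Rightarrow> 'a::ring_1" where
  "sval Pos = 1"
| "sval Neg = - 1"

record 'x quandle =
  qcarrier :: "'x set"
  qop :: "'x \<Rightarrow> 'x \<Rightarrow> 'x"  (infixl \<open>\<star>\<index>\<close> 70)

record 'x sym_quandle = "'x quandle" +
  qinv :: "'x \<Rightarrow> 'x"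

definition quandle :: "('x, 'm) quandle_scheme \<Rightarrow> bool" where
  "quandle Q \<longleftrightarrow>
     (\<forall>x\<in>qcarrier Q. \<forall>y\<in>qcarrier Q. x \<star>\<^bsub>Q\<^esub> y \<in> qcarrier Q) \<and>
     (\<forall>x\<in>qcarrier Q. x \<star>\<^bsub>Q\<^esub> x = x) \<and>
     (\<forall>x\<in>qcarrier Q. \<forall>y\<in>qcarrier Q. \<exists>!z. z \<in> qcarrier Q \<and> z \<star>\<^bsub>Q\<^esub> y = x) \<and>
     (\<forall>x\<in>qcarrier Q. \<forall>y\<in>qcarrier Q. \<forall>z\<in>qcarrier Q.
        (x \<star>\<^bsub>Q\<^esub> y) \<star>\<^bsub>Q\<^esub> z = (x \<star>\<^bsub>Q\<^esub> z) \<star>\<^bsub>Q\<^esub> (y \<star>\<^bsub>Q\<^esub> z))"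

text \<open>\<open>qpow Q x y \<epsilon>\<close> is \<open>x * y\<^sup>\<epsilon>\<close>.\<close>

definition qpow :: "('x, 'm) quandle_scheme \<Rightarrow> 'x \<Rightarrow> 'x \<Rightarrow> sign \<Rightarrow> 'x" where
  "qpow Q x y e =
     (case e of Pos \<Rightarrow> x \<star>\<^bsub>Q\<^esub> y | Neg \<Rightarrow> (THE z. z \<in> qcarrier Q \<and> z \<star>\<^bsub>Q\<^esub> y = x))"

definition symmetric_quandle :: "('x, 'm) sym_quandle_scheme \<Rightarrow> bool" where
  "symmetric_quandle Q \<longleftrightarrow> quandle Q \<and>
     (\<forall>x\<in>qcarrier Q. qinv Q x \<in> qcarrier Q \<and> qinv Q (qinv Q x) = x) \<and>
     (\<forall>x\<in>qcarrier Q. \<forall>y\<in>qcarrier Q. qinv Q (x \<star>\<^bsub>Q\<^esub> y) = qinv Q x \<star>\<^bsub>Q\<^esub> y) \<and>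
     (\<forall>x\<in>qcarrier Q. \<forall>y\<in>qcarrier Q. x \<star>\<^bsub>Q\<^esub> qinv Q y = qpow Q x y Neg)"

text \<open>The symmetric double; \<open>(x, \<epsilon>)\<close> stands for \<open>x\<^sup>\<epsilon>\<close>.\<close>

definition double :: "('x, 'm) quandle_scheme \<Rightarrow> ('x \<times> sign) sym_quandle" where
  "double Q =
     \<lparr>qcarrier = qcarrier Q \<times> UNIV,
      qop = (\<lambda>(x, e) (y, d). (qpow Q x y d, e)),
      qinv = (\<lambda>(x, e). (x, opp e))\<rparr>"


lemma opp_opp [simp]: "opp (opp e) = e"
  by (cases e) auto

lemma qpow_in:
  assumes "quandle Q" "x \<in> qcarrier Q" "y \<in> qcarrier Q"
  shows "qpow Q x y e \<in> qcarrier Q"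
    and "qpow Q (qpow Q x y e) y (opp e) = x"
proof -
  have ex: "\<exists>!z. z \<in> qcarrier Q \<and> z \<star>\<^bsub>Q\<^esub> y = x" and cl: "x \<star>\<^bsub>Q\<^esub> y \<in> qcarrier Q"
    using assms by (auto simp: quandle_def)
  have ex': "\<exists>!z. z \<in> qcarrier Q \<and> z \<star>\<^bsub>Q\<^esub> y = x \<star>\<^bsub>Q\<^esub> y"
    using assms cl by (auto simp: quandle_def)
  have "(THE z. z \<in> qcarrier Q \<and> z \<star>\<^bsub>Q\<^esub> y = x \<star>\<^bsub>Q\<^esub> y) = x"
    using ex' assms by (intro the1_equality) auto
  then have P: "qpow Q (qpow Q x y Pos) y Neg = x" "qpow Q x y Pos \<in> qcarrier Q"
    using cl by (simp_all add: qpow_def)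
  have N: "qpow Q (qpow Q x y Neg) y Pos = x" "qpow Q x y Neg \<in> qcarrier Q"
    using theI'[OF ex] by (simp_all only: qpow_def sign.case)
  show "qpow Q x y e \<in> qcarrier Q" "qpow Q (qpow Q x y e) y (opp e) = x"
    using P N by (cases e; simp only: opp.simps)+
qed

lemma qpow_unique:
  assumes "quandle Q" "x \<in> qcarrier Q" "y \<in> qcarrier Q" "z \<in> qcarrier Q" "qpow Q z y (opp e) = x"
  shows "qpow Q x y e = z"
  using qpow_in(2)[OF assms(1,4,3), of "opp e"] assms(5) by simp

lemma qpow_distrib:
  assumes Q: "quandle Q" and "x \<in> qcarrier Q" "y \<in> qcarrier Q" "z \<in> qcarrier Q"
  shows "qpow Q (qpow Q x y d) z e = qpow Q (qpow Q x z e) (qpow Q y z e) d"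
proof -
  have PP: "qpow Q (qpow Q x y Pos) z Pos = qpow Q (qpow Q x z Pos) (qpow Q y z Pos) Pos"
    if "x \<in> qcarrier Q" "y \<in> qcarrier Q" "z \<in> qcarrier Q" for x y z
    using Q that unfolding quandle_def qpow_def sign.case by blast
  have P: "qpow Q (qpow Q x y d) z Pos = qpow Q (qpow Q x z Pos) (qpow Q y z Pos) d"
    if *: "x \<in> qcarrier Q" "y \<in> qcarrier Q" "z \<in> qcarrier Q" for x y z
  proof (cases d)
    case Neg
    let ?w = "qpow Q x y Neg"
    have w: "?w \<in> qcarrier Q" using qpow_in(1)[OF Q *(1,2)] .
    have "qpow Q (qpow Q ?w z Pos) (qpow Q y z Pos) Pos = qpow Q x z Pos"
      using PP[OF w *(2,3)] qpow_in(2)[OF Q *(1,2), of Neg] by simp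
    then have "qpow Q (qpow Q x z Pos) (qpow Q y z Pos) Neg = qpow Q ?w z Pos"
      by (intro qpow_unique[OF Q _ _ _, where e = Neg, unfolded opp.simps] qpow_in(1)[OF Q] * w)
    then show ?thesis using Neg by simp
  qed (use PP * in simp)
  show ?thesis
  proof (cases e)
    case Neg
    let ?x = "qpow Q x z Neg" and ?y = "qpow Q y z Neg"
    have c: "?x \<in> qcarrier Q" "?y \<in> qcarrier Q" using assms by (auto intro: qpow_in(1))
    have "qpow Q (qpow Q ?x ?y d) z Pos = qpow Q x y d"
      using P[OF c assms(4)] qpow_in(2)[OF Q assms(2,4), of Neg] qpow_in(2)[OF Q assms(3,4), of Neg]
      by simp
    then have "qpow Q (qpow Q x y d) z Neg = qpow Q ?x ?y d"
      by (intro qpow_unique[OF Q _ _ _, where e = Neg, unfolded opp.simps] qpow_in(1)[OF Q] assms c)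
    then show ?thesis using Neg by simp
  qed (use P assms in simp)
qed

lemma symmetric_quandle_double:
  assumes Q: "quandle Q"
  shows "symmetric_quandle (double Q)"
proof -
  have idem: "qpow Q x x e = x" if "x \<in> qcarrier Q" for x e
  proof -
    have "qpow Q x x Pos = x" using that Q unfolding quandle_def qpow_def sign.case by blast
    then show ?thesis using qpow_unique[OF Q that that that, of Neg] by (cases e) simp_all
  qed
  have inv: "\<exists>!z. z \<in> qcarrier (double Q) \<and> z \<star>\<^bsub>double Q\<^esub> y = x"
    if "x \<in> qcarrier (double Q)" "y \<in> qcarrier (double Q)" for x y
  proof -
    obtain a e b d where xy: "x = (a, e)" "y = (b, d)" by (metis prod.exhaust)
    with that have ab: "a \<in> qcarrier Q" "b \<in> qcarrier Q" by (auto simp: double_def)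
    let ?z = "qpow Q a b (opp d)"
    have 1: "?z \<in> qcarrier Q" "qpow Q ?z b d = a"
      using qpow_in(1)[OF Q ab, of "opp d"] qpow_in(2)[OF Q ab, of "opp d"] by simp_all
    show ?thesis
    proof (rule ex1I[of _ "(?z, e)"])
      show "(?z, e) \<in> qcarrier (double Q) \<and> (?z, e) \<star>\<^bsub>double Q\<^esub> y = x"
        using 1 by (simp add: double_def xy)
      show "w = (?z, e)" if "w \<in> qcarrier (double Q) \<and> w \<star>\<^bsub>double Q\<^esub> y = x" for w
        using that by (cases w) (auto simp: double_def xy qpow_in(2)[OF Q _ ab(2)])
    qed
  qed
  have dQ: "quandle (double Q)"
    unfolding quandle_def
  proof (intro conjI ballI)
    fix x y z assume "x \<in> qcarrier (double Q)" "y \<in> qcarrier (double Q)" "z \<in> qcarrier (double Q)"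
    then show "x \<star>\<^bsub>double Q\<^esub> y \<star>\<^bsub>double Q\<^esub> z
        = x \<star>\<^bsub>double Q\<^esub> z \<star>\<^bsub>double Q\<^esub> (y \<star>\<^bsub>double Q\<^esub> z)"
      by (cases x; cases y; cases z) (simp add: double_def, rule qpow_distrib[OF Q])
  next
    fix x y assume "x \<in> qcarrier (double Q)" "y \<in> qcarrier (double Q)"
    then show "\<exists>!z. z \<in> qcarrier (double Q) \<and> z \<star>\<^bsub>double Q\<^esub> y = x" by (rule inv)
    show "x \<star>\<^bsub>double Q\<^esub> y \<in> qcarrier (double Q)"
      using \<open>x \<in> qcarrier (double Q)\<close> \<open>y \<in> qcarrier (double Q)\<close>
      by (cases x; cases y) (simp add: double_def qpow_in(1)[OF Q])
  next
    fix x assume "x \<in> qcarrier (double Q)"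
    then show "x \<star>\<^bsub>double Q\<^esub> x = x" by (cases x) (simp add: double_def idem)
  qed
  moreover have "x \<star>\<^bsub>double Q\<^esub> qinv (double Q) y = qpow (double Q) x y Neg"
    if "x \<in> qcarrier (double Q)" "y \<in> qcarrier (double Q)" for x y
  proof -
    obtain a e b d where xy: "x = (a, e)" "y = (b, d)" by (metis prod.exhaust)
    with that have ab: "a \<in> qcarrier Q" "b \<in> qcarrier Q" by (auto simp: double_def)
    have "qpow (double Q) x y Neg = (qpow Q a b (opp d), e)"
    proof (rule qpow_unique[OF dQ that])
      show "(qpow Q a b (opp d), e) \<in> qcarrier (double Q)"
        using qpow_in(1)[OF Q ab] by (simp add: double_def)
      show "qpow (double Q) (qpow Q a b (opp d), e) y (opp Neg) = x"
        using qpow_in(2)[OF Q ab, of "opp d"]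
        by (simp add: qpow_def[of "double Q" "(u, e)" "(b, d)" Pos for u] xy) (simp add: double_def)
    qed
    then show ?thesis by (simp add: double_def xy)
  qed
  ultimately show ?thesis
    unfolding symmetric_quandle_def
  proof (intro conjI ballI)
    fix x assume "x \<in> qcarrier (double Q)"
    then show "qinv (double Q) x \<in> qcarrier (double Q)" "qinv (double Q) (qinv (double Q) x) = x"
      by (cases x; simp add: double_def)+
    fix y
    show "qinv (double Q) (x \<star>\<^bsub>double Q\<^esub> y) = qinv (double Q) x \<star>\<^bsub>double Q\<^esub> y"
      by (cases x; cases y) (simp add: double_def)
  qed blast+
qed


section \<open>Associated groups and sets with action\<close>

text \<open>
  A word is a list of letters \<open>(g, \<epsilon>)\<close>, standing for the product of the \<open>g\<^sup>\<epsilon>\<close>.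
  \<open>pres_eq S R\<close> is the congruence on words over \<open>S\<close> whose quotient is the group
  \<open>\<langle>S | u = v, (u, v) \<in> R\<rangle>\<close>.
\<close>

type_synonym 'g gword = "('g \<times> sign) list"

inductive pres_eq :: "'g set \<Rightarrow> ('g gword \<times> 'g gword) set \<Rightarrow> 'g gword \<Rightarrow> 'g gword \<Rightarrow> bool"
  for S R where
  pres_refl: "w \<in> lists (S \<times> UNIV) \<Longrightarrow> pres_eq S R w w"
| pres_sym: "pres_eq S R u v \<Longrightarrow> pres_eq S R v u"
| pres_trans: "pres_eq S R u v \<Longrightarrow> pres_eq S R v w \<Longrightarrow> pres_eq S R u w"
| pres_append: "pres_eq S R u u' \<Longrightarrow> pres_eq S R v v' \<Longrightarrow> pres_eq S R (u @ v) (u' @ v')"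
| pres_cancel: "g \<in> S \<Longrightarrow> pres_eq S R [(g, e), (g, opp e)] []"
| pres_rel: "(u, v) \<in> R \<Longrightarrow> pres_eq S R u v"

definition pres_class :: "'g set \<Rightarrow> ('g gword \<times> 'g gword) set \<Rightarrow> 'g gword \<Rightarrow> 'g gword set" where
  "pres_class S R w = {v. pres_eq S R w v}"

definition presented_group :: "'g set \<Rightarrow> ('g gword \<times> 'g gword) set \<Rightarrow> 'g gword set monoid" where
  "presented_group S R =
     \<lparr>carrier = pres_class S R ` lists (S \<times> UNIV),
      monoid.mult = (\<lambda>A B. \<Union>u\<in>A. \<Union>v\<in>B. pres_class S R (u @ v)),
      one = pres_class S R []\<rparr>"

definition quandle_rels :: "('x, 'm) quandle_scheme \<Rightarrow> ('x gword \<times> 'x gword) set" where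
  "quandle_rels Q =
     {([(x \<star>\<^bsub>Q\<^esub> y, Pos)], [(y, Neg), (x, Pos), (y, Pos)]) | x y. x \<in> qcarrier Q \<and> y \<in> qcarrier Q}"

definition sym_quandle_rels :: "('x, 'm) sym_quandle_scheme \<Rightarrow> ('x gword \<times> 'x gword) set" where
  "sym_quandle_rels Q =
     quandle_rels Q \<union> {([(qinv Q x, Pos)], [(x, Neg)]) | x. x \<in> qcarrier Q}"

definition assoc_group :: "('x, 'm) quandle_scheme \<Rightarrow> 'x gword set monoid" where
  "assoc_group Q = presented_group (qcarrier Q) (quandle_rels Q)"

definition assoc_gen :: "('x, 'm) quandle_scheme \<Rightarrow> 'x \<Rightarrow> 'x gword set" where
  "assoc_gen Q x = pres_class (qcarrier Q) (quandle_rels Q) [(x, Pos)]"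

definition sym_assoc_group :: "('x, 'm) sym_quandle_scheme \<Rightarrow> 'x gword set monoid" where
  "sym_assoc_group Q = presented_group (qcarrier Q) (sym_quandle_rels Q)"

definition sym_assoc_gen :: "('x, 'm) sym_quandle_scheme \<Rightarrow> 'x \<Rightarrow> 'x gword set" where
  "sym_assoc_gen Q x = pres_class (qcarrier Q) (sym_quandle_rels Q) [(x, Pos)]"

definition right_action :: "('g, 'm) monoid_scheme \<Rightarrow> 'y set \<Rightarrow> ('y \<Rightarrow> 'g \<Rightarrow> 'y) \<Rightarrow> bool" where
  "right_action G Y act \<longleftrightarrow>
     (\<forall>r\<in>Y. \<forall>g\<in>carrier G. act r g \<in> Y) \<and>
     (\<forall>r\<in>Y. act r \<one>\<^bsub>G\<^esub> = r) \<and>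
     (\<forall>r\<in>Y. \<forall>g\<in>carrier G. \<forall>h\<in>carrier G. act r (g \<otimes>\<^bsub>G\<^esub> h) = act (act r g) h)"

definition quandle_set :: "('x, 'm) quandle_scheme \<Rightarrow> 'y set \<Rightarrow> ('y \<Rightarrow> 'x gword set \<Rightarrow> 'y) \<Rightarrow> bool" where
  "quandle_set Q Y act \<longleftrightarrow> right_action (assoc_group Q) Y act"

definition sym_quandle_set ::
    "('x, 'm) sym_quandle_scheme \<Rightarrow> 'y set \<Rightarrow> ('y \<Rightarrow> 'x gword set \<Rightarrow> 'y) \<Rightarrow> bool" where
  "sym_quandle_set Q Y act \<longleftrightarrow> right_action (sym_assoc_group Q) Y act"

text \<open>
  The homomorphism \<open>\<pi>\<close> from the group of the symmetric double to \<open>G\<^sub>X\<close>, sending the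
  generator \<open>x\<^sup>\<epsilon>\<close> to the group element \<open>x\<^sup>\<epsilon>\<close>, and the action of the former group
  obtained by pulling back along \<open>\<pi>\<close>.
\<close>

fun double_letter :: "('x \<times> sign) \<times> sign \<Rightarrow> 'x \<times> sign" where
  "double_letter ((x, e), Pos) = (x, e)"
| "double_letter ((x, e), Neg) = (x, opp e)"

definition double_proj :: "('x, 'm) quandle_scheme \<Rightarrow> ('x \<times> sign) gword set \<Rightarrow> 'x gword set" where
  "double_proj Q g =
     (\<Union>w\<in>g. pres_class (qcarrier Q) (quandle_rels Q) (map double_letter w))"

definition double_act ::
    "('x, 'm) quandle_scheme \<Rightarrow> ('y \<Rightarrow> 'x gword set \<Rightarrow> 'y) \<Rightarrow> 'y \<Rightarrow> ('x \<times> sign) gword set \<Rightarrow> 'y" where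
  "double_act Q act r g = act r (double_proj Q g)"

lemma pres_eq_words:
  assumes "pres_eq S R u v" "R \<subseteq> lists (S \<times> UNIV) \<times> lists (S \<times> UNIV)"
  shows "u \<in> lists (S \<times> UNIV) \<and> v \<in> lists (S \<times> UNIV)"
  using assms by induction auto

lemma pres_class_eq_iff:
  assumes "v \<in> lists (S \<times> UNIV)"
  shows "pres_class S R u = pres_class S R v \<longleftrightarrow> pres_eq S R u v"
  unfolding pres_class_def using assms by (blast intro: pres_refl pres_sym pres_trans)

lemma presented_group_mult:
  assumes "u \<in> lists (S \<times> UNIV)" "v \<in> lists (S \<times> UNIV)"
  shows "pres_class S R u \<otimes>\<^bsub>presented_group S R\<^esub> pres_class S R v = pres_class S R (u @ v)"
proof -
  let ?A = "pres_class S R u" and ?B = "pres_class S R v"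
  have eq: "pres_class S R (u' @ v') = pres_class S R (u @ v)" if "u' \<in> ?A" "v' \<in> ?B" for u' v'
    using that assms pres_sym[OF pres_append, of S R u u' v v']
    by (subst pres_class_eq_iff) (auto simp: pres_class_def)
  have "u \<in> ?A" "v \<in> ?B"
    using assms by (auto simp: pres_class_def intro: pres_refl)
  then have "(\<Union>u'\<in>?A. \<Union>v'\<in>?B. pres_class S R (u' @ v')) = pres_class S R (u @ v)"
    using eq by blast
  then show ?thesis by (simp add: presented_group_def)
qed

lemma group_presented_group: "group (presented_group S R)"
proof (rule groupI)
  let ?G = "presented_group S R"
  have carr: "carrier ?G = pres_class S R ` lists (S \<times> UNIV)" and
    one: "\<one>\<^bsub>?G\<^esub> = pres_class S R []" by (auto simp: presented_group_def)
  show "\<one>\<^bsub>?G\<^esub> \<in> carrier ?G" by (auto simp: carr one)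
  show "x \<otimes>\<^bsub>?G\<^esub> y \<in> carrier ?G" if xy: "x \<in> carrier ?G" "y \<in> carrier ?G" for x y
  proof -
    obtain u v where uv: "u \<in> lists (S \<times> UNIV)" "v \<in> lists (S \<times> UNIV)"
      "x = pres_class S R u" "y = pres_class S R v"
      using xy by (auto simp: carr)
    then have "x \<otimes>\<^bsub>?G\<^esub> y = pres_class S R (u @ v)" "u @ v \<in> lists (S \<times> UNIV)"
      by (simp_all add: presented_group_mult)
    then show ?thesis unfolding carr by blast
  qed
  show "x \<otimes>\<^bsub>?G\<^esub> y \<otimes>\<^bsub>?G\<^esub> z = x \<otimes>\<^bsub>?G\<^esub> (y \<otimes>\<^bsub>?G\<^esub> z)"
    if xyz: "x \<in> carrier ?G" "y \<in> carrier ?G" "z \<in> carrier ?G" for x y z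
  proof -
    obtain u v w where "u \<in> lists (S \<times> UNIV)" "v \<in> lists (S \<times> UNIV)" "w \<in> lists (S \<times> UNIV)"
      "x = pres_class S R u" "y = pres_class S R v" "z = pres_class S R w"
      using xyz by (auto simp: carr)
    then show ?thesis by (simp add: presented_group_mult)
  qed
  show "\<one>\<^bsub>?G\<^esub> \<otimes>\<^bsub>?G\<^esub> x = x" if x: "x \<in> carrier ?G" for x
  proof -
    obtain u where "u \<in> lists (S \<times> UNIV)" "x = pres_class S R u"
      using x by (auto simp: carr)
    then show ?thesis by (simp add: presented_group_mult one)
  qed
  have "\<exists>v\<in>lists (S \<times> UNIV). pres_eq S R (v @ u) []" if "u \<in> lists (S \<times> UNIV)" for u
    using that
  proof (induction u)
    case (Cons l u)
    obtain g e where l: "l = (g, e)" "g \<in> S" using Cons by (cases l) auto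
    obtain v where v: "v \<in> lists (S \<times> UNIV)" "pres_eq S R (v @ u) []" using Cons by auto
    have u: "u \<in> lists (S \<times> UNIV)" using Cons by simp
    have "pres_eq S R ([(g, opp e), (g, e)] @ u) ([] @ u)"
      using pres_cancel[OF l(2), of R "opp e"] pres_refl[OF u] by (intro pres_append) auto
    then have "pres_eq S R (v @ ([(g, opp e), (g, e)] @ u)) (v @ u)"
      using pres_refl[OF v(1)] by (intro pres_append) auto
    with v(2) l have "pres_eq S R ((v @ [(g, opp e)]) @ l # u) []"
      by (auto intro: pres_trans)
    then show ?case using v l by (intro bexI[of _ "v @ [(g, opp e)]"]) auto
  qed (auto intro: pres_refl)
  note left_inv = this
  show "\<exists>y\<in>carrier ?G. y \<otimes>\<^bsub>?G\<^esub> x = \<one>\<^bsub>?G\<^esub>" if x: "x \<in> carrier ?G" for x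
  proof -
    obtain u where u: "u \<in> lists (S \<times> UNIV)" "x = pres_class S R u"
      using x by (auto simp: carr)
    obtain v where v: "v \<in> lists (S \<times> UNIV)" "pres_eq S R (v @ u) []"
      using left_inv[OF u(1)] by blast
    have "pres_class S R v \<in> carrier ?G"
      unfolding carr using v(1) by blast
    moreover have "pres_class S R v \<otimes>\<^bsub>?G\<^esub> x = \<one>\<^bsub>?G\<^esub>"
      using u v by (simp add: presented_group_mult one pres_class_eq_iff)
    ultimately show ?thesis by blast
  qed
qed

lemma double_letter_in:
  "w \<in> lists (qcarrier (double Q) \<times> UNIV) \<Longrightarrow> map double_letter w \<in> lists (qcarrier Q \<times> UNIV)"
proof (induction w)
  case (Cons l w)
  then obtain x e d where "l = ((x, e), d)" by (metis prod.exhaust)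
  with Cons show ?case by (cases d) (auto simp: double_def)
qed auto

lemma pres_eq_double:
  assumes Q: "quandle Q"
    and "pres_eq (qcarrier (double Q)) (sym_quandle_rels (double Q)) u v"
  shows "pres_eq (qcarrier Q) (quandle_rels Q) (map double_letter u) (map double_letter v)"
  using assms(2)
proof induction
  case (pres_refl w)
  then show ?case by (intro pres_eq.pres_refl double_letter_in)
next
  case (pres_cancel g e)
  obtain x d where g: "g = (x, d)" by (metis prod.exhaust)
  with pres_cancel have x: "x \<in> qcarrier Q" by (auto simp: double_def)
  show ?case using pres_eq.pres_cancel[OF x, of _ d] pres_eq.pres_cancel[OF x, of _ "opp d"]
    by (cases e) (auto simp: g)
next
  case (pres_rel u v)
  let ?S = "qcarrier Q" and ?R = "quandle_rels Q"
  note I = pres_refl pres_append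
  have rel: "pres_eq ?S ?R [(qpow Q x y d, e)] [(y, opp d), (x, e), (y, d)]"
    if xy: "x \<in> ?S" "y \<in> ?S" for x y d e
  proof -
    define G where "G = assoc_group Q"
    interpret G: group G unfolding G_def assoc_group_def by (rule group_presented_group)
    let ?c = "\<lambda>w. pres_class ?S ?R w"
    have m: "?c u \<otimes>\<^bsub>G\<^esub> ?c v = ?c (u @ v)"
      if "u \<in> lists (?S \<times> UNIV)" "v \<in> lists (?S \<times> UNIV)" for u v
      using that by (simp add: G_def assoc_group_def presented_group_mult)
    have cG: "?c w \<in> carrier G" if "w \<in> lists (?S \<times> UNIV)" for w
      using that by (auto simp: G_def assoc_group_def presented_group_def)
    have 1: "\<one>\<^bsub>G\<^esub> = ?c []" by (simp add: G_def assoc_group_def presented_group_def)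
    have iv: "?c [(x, opp d)] = inv\<^bsub>G\<^esub> (?c [(x, d)])" if "x \<in> ?S" for x d
    proof (rule G.inv_equality[symmetric])
      have "pres_eq ?S ?R [(x, opp d), (x, d)] []"
        using pres_eq.pres_cancel[OF that, of ?R "opp d"] by simp
      then show "?c [(x, opp d)] \<otimes>\<^bsub>G\<^esub> ?c [(x, d)] = \<one>\<^bsub>G\<^esub>"
        using that by (simp add: m 1 pres_class_eq_iff)
    qed (use that cG in auto)
    define g where "g x = ?c [(x, Pos)]" for x
    have g: "g x \<in> carrier G" if "x \<in> ?S" for x using that by (simp add: g_def cG)
    have gN: "?c [(x, Neg)] = inv\<^bsub>G\<^esub> (g x)" if "x \<in> ?S" for x
      using iv[OF that, of Pos] by (simp add: g_def)
    have rP: "g (qpow Q x y Pos) = inv\<^bsub>G\<^esub> (g y) \<otimes>\<^bsub>G\<^esub> g x \<otimes>\<^bsub>G\<^esub> g y"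
      if "x \<in> ?S" "y \<in> ?S" for x y
    proof -
      have "pres_eq ?S ?R [(x \<star>\<^bsub>Q\<^esub> y, Pos)] [(y, Neg), (x, Pos), (y, Pos)]"
        using that by (intro pres_eq.pres_rel) (auto simp: quandle_rels_def)
      then have "g (qpow Q x y Pos) = ?c [(y, Neg), (x, Pos), (y, Pos)]"
        using that by (simp add: g_def qpow_def pres_class_eq_iff)
      also have "\<dots> = ?c [(y, Neg)] \<otimes>\<^bsub>G\<^esub> g x \<otimes>\<^bsub>G\<^esub> g y"
        using that by (simp add: g_def m)
      finally show ?thesis using that by (simp add: gN)
    qed
    have rN: "g (qpow Q x y Neg) = g y \<otimes>\<^bsub>G\<^esub> g x \<otimes>\<^bsub>G\<^esub> inv\<^bsub>G\<^esub> (g y)"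
      if xy: "x \<in> ?S" "y \<in> ?S" for x y
    proof -
      let ?z = "qpow Q x y Neg"
      have z: "?z \<in> ?S" using qpow_in(1)[OF Q xy] .
      have "g x = inv\<^bsub>G\<^esub> (g y) \<otimes>\<^bsub>G\<^esub> g ?z \<otimes>\<^bsub>G\<^esub> g y"
        using rP[OF z xy(2)] qpow_in(2)[OF Q xy, of Neg] by simp
      then have "g y \<otimes>\<^bsub>G\<^esub> g x = (g y \<otimes>\<^bsub>G\<^esub> inv\<^bsub>G\<^esub> (g y)) \<otimes>\<^bsub>G\<^esub> g ?z \<otimes>\<^bsub>G\<^esub> g y"
        using g[OF z] g[OF xy(2)] by (simp add: G.m_assoc[symmetric])
      then have "g y \<otimes>\<^bsub>G\<^esub> g x \<otimes>\<^bsub>G\<^esub> inv\<^bsub>G\<^esub> (g y) = g ?z \<otimes>\<^bsub>G\<^esub> g y \<otimes>\<^bsub>G\<^esub> inv\<^bsub>G\<^esub> (g y)"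
        using g[OF z] g[OF xy(2)] by simp
      then show ?thesis using g[OF z] g[OF xy(2)] by (simp add: G.m_assoc)
    qed
    have "?c [(qpow Q x y d, e)] = ?c [(y, opp d)] \<otimes>\<^bsub>G\<^esub> ?c [(x, e)] \<otimes>\<^bsub>G\<^esub> ?c [(y, d)]"
      using rP[OF xy] rN[OF xy] g[OF xy(1)] g[OF xy(2)] qpow_in(1)[OF Q xy, of d] xy
      by (cases d; cases e) (simp_all add: gN g_def[symmetric] G.inv_mult_group G.m_assoc)
    also have "\<dots> = ?c [(y, opp d), (x, e), (y, d)]"
      using xy by (simp add: m)
    finally show ?thesis using xy by (simp add: pres_class_eq_iff)
  qed
  from pres_rel show ?case
    using rel
    by (auto simp: sym_quandle_rels_def quandle_rels_def double_def intro!: pres_refl)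
qed (auto intro: pres_eq.intros)

lemma double_proj_class:
  assumes "quandle Q" and w: "w \<in> lists (qcarrier (double Q) \<times> UNIV)"
  shows "double_proj Q (pres_class (qcarrier (double Q)) (sym_quandle_rels (double Q)) w)
           = pres_class (qcarrier Q) (quandle_rels Q) (map double_letter w)"
proof -
  have "pres_class (qcarrier Q) (quandle_rels Q) (map double_letter v) =
        pres_class (qcarrier Q) (quandle_rels Q) (map double_letter w)"
    if "v \<in> pres_class (qcarrier (double Q)) (sym_quandle_rels (double Q)) w" for v
    using that pres_eq_double[OF assms(1)] double_letter_in[OF w]
    by (subst pres_class_eq_iff) (auto simp: pres_class_def intro: pres_sym)
  moreover have "w \<in> pres_class (qcarrier (double Q)) (sym_quandle_rels (double Q)) w"
    using w by (auto simp: pres_class_def intro: pres_refl)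
  ultimately show ?thesis unfolding double_proj_def by blast
qed

lemma double_proj_hom:
  assumes "quandle Q"
  shows "double_proj Q \<in> hom (sym_assoc_group (double Q)) (assoc_group Q)"
    and "x \<in> qcarrier Q \<Longrightarrow> double_proj Q (sym_assoc_gen (double Q) (x, Pos)) = assoc_gen Q x"
    and "x \<in> qcarrier Q \<Longrightarrow>
           double_proj Q (sym_assoc_gen (double Q) (x, Neg)) = inv\<^bsub>assoc_group Q\<^esub> assoc_gen Q x"
proof -
  show "double_proj Q \<in> hom (sym_assoc_group (double Q)) (assoc_group Q)"
  proof (rule homI)
    fix g assume "g \<in> carrier (sym_assoc_group (double Q))"
    then obtain u where "u \<in> lists (qcarrier (double Q) \<times> UNIV)"
      "g = pres_class (qcarrier (double Q)) (sym_quandle_rels (double Q)) u"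
      by (auto simp: sym_assoc_group_def presented_group_def)
    then show "double_proj Q g \<in> carrier (assoc_group Q)"
      by (simp only: double_proj_class[OF assms])
         (simp add: assoc_group_def presented_group_def double_letter_in del: map_append)
  next
    fix g h assume "g \<in> carrier (sym_assoc_group (double Q))" "h \<in> carrier (sym_assoc_group (double Q))"
    then obtain u v where uv: "u \<in> lists (qcarrier (double Q) \<times> UNIV)" "v \<in> lists (qcarrier (double Q) \<times> UNIV)"
      "g = pres_class (qcarrier (double Q)) (sym_quandle_rels (double Q)) u"
      "h = pres_class (qcarrier (double Q)) (sym_quandle_rels (double Q)) v"
      by (auto simp: sym_assoc_group_def presented_group_def)
    show "double_proj Q (g \<otimes>\<^bsub>sym_assoc_group (double Q)\<^esub> h)
            = double_proj Q g \<otimes>\<^bsub>assoc_group Q\<^esub> double_proj Q h"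
      using uv double_proj_class[OF assms uv(1)] double_proj_class[OF assms uv(2)]
        double_proj_class[OF assms, of "u @ v"]
        double_letter_in[OF uv(1)] double_letter_in[OF uv(2)]
      by (simp add: sym_assoc_group_def assoc_group_def presented_group_mult)
  qed
  assume x: "x \<in> qcarrier Q"
  then have x': "[((x, e), Pos)] \<in> lists (qcarrier (double Q) \<times> UNIV)" for e
    by (simp add: double_def)
  show "double_proj Q (sym_assoc_gen (double Q) (x, Pos)) = assoc_gen Q x"
    using double_proj_class[OF assms x'] by (simp add: sym_assoc_gen_def assoc_gen_def)
  interpret G: group "assoc_group Q" unfolding assoc_group_def by (rule group_presented_group)
  have "pres_eq (qcarrier Q) (quandle_rels Q) [(x, Neg), (x, Pos)] []"
    using pres_cancel[OF x, of _ Neg] by simp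
  then have "inv\<^bsub>assoc_group Q\<^esub> assoc_gen Q x = pres_class (qcarrier Q) (quandle_rels Q) [(x, Neg)]"
    using x unfolding assoc_gen_def
    by (intro G.inv_equality)
       (auto simp: assoc_group_def presented_group_mult pres_class_eq_iff presented_group_def[of _ _, THEN arg_cong[of _ _ carrier]] presented_group_def[of _ _, THEN arg_cong[of _ _ one]])
  then show "double_proj Q (sym_assoc_gen (double Q) (x, Neg)) = inv\<^bsub>assoc_group Q\<^esub> assoc_gen Q x"
    using double_proj_class[OF assms x'] by (simp add: sym_assoc_gen_def)
qed

lemma sym_quandle_set_double:
  assumes "quandle Q" "quandle_set Q Y act"
  shows "sym_quandle_set (double Q) Y (double_act Q act)"
proof -
  interpret h: group_hom "sym_assoc_group (double Q)" "assoc_group Q" "double_proj Q"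
    using double_proj_hom(1)[OF assms(1)]
    by (simp add: group_hom_def group_hom_axioms_def sym_assoc_group_def assoc_group_def
        group_presented_group)
  show ?thesis
    using assms(2)
    by (auto simp: sym_quandle_set_def quandle_set_def right_action_def double_act_def)
qed

text \<open>The operation \<open>r * x\<close> of a quandle element, through the corresponding generator.\<close>

definition gact :: "('x, 'm) quandle_scheme \<Rightarrow> ('y \<Rightarrow> 'x gword set \<Rightarrow> 'y) \<Rightarrow> 'y \<Rightarrow> 'x \<Rightarrow> 'y" where
  "gact Q act r x = act r (assoc_gen Q x)"

definition sym_gact :: "('x, 'm) sym_quandle_scheme \<Rightarrow> ('y \<Rightarrow> 'x gword set \<Rightarrow> 'y) \<Rightarrow> 'y \<Rightarrow> 'x \<Rightarrow> 'y" where
  "sym_gact Q act r x = act r (sym_assoc_gen Q x)"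


section \<open>Chain complexes and cocycles\<close>

text \<open>
  A tuple \<open>(r, x\<^sub>1, \<dots>, x\<^sub>n)\<close> is encoded as \<open>(r, [x\<^sub>1, \<dots>, x\<^sub>n])\<close>, so that list positions
  are shifted by one against the usual numbering. The argument \<open>ra\<close> is the operation
  \<open>r * x\<close> of quandle elements on \<open>Y\<close>.
\<close>

type_synonym ('y, 'x) chain = "('y \<times> 'x list) \<Rightarrow>\<^sub>0 int"

definition chain_basis :: "('x, 'm) quandle_scheme \<Rightarrow> 'y set \<Rightarrow> nat \<Rightarrow> ('y \<times> 'x list) set" where
  "chain_basis Q Y n =
     (if n \<ge> 1 then {(r, xs). r \<in> Y \<and> set xs \<subseteq> qcarrier Q \<and> length xs = n} else {})"

definition chain_group :: "('x, 'm) quandle_scheme \<Rightarrow> 'y set \<Rightarrow> nat \<Rightarrow> ('y, 'x) chain monoid" where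
  "chain_group Q Y n = free_Abelian_group (chain_basis Q Y n)"

definition del_tuple :: "nat \<Rightarrow> 'y \<times> 'x list \<Rightarrow> 'y \<times> 'x list" where
  "del_tuple i = (\<lambda>(r, xs). (r, take i xs @ drop (Suc i) xs))"

definition del_act_tuple ::
    "('x, 'm) quandle_scheme \<Rightarrow> ('y \<Rightarrow> 'x \<Rightarrow> 'y) \<Rightarrow> nat \<Rightarrow> 'y \<times> 'x list \<Rightarrow> 'y \<times> 'x list" where
  "del_act_tuple Q ra i =
     (\<lambda>(r, xs). (ra r (xs ! i), map (\<lambda>x. x \<star>\<^bsub>Q\<^esub> xs ! i) (take i xs) @ drop (Suc i) xs))"

definition boundary ::
    "('x, 'm) quandle_scheme \<Rightarrow> ('y \<Rightarrow> 'x \<Rightarrow> 'y) \<Rightarrow> nat \<Rightarrow> ('y, 'x) chain \<Rightarrow> ('y, 'x) chain" where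
  "boundary Q ra n =
     (if n > 1
      then frag_extend (\<lambda>t. \<Sum>i<n. frag_cmul ((- 1) ^ (i + 1))
             (frag_of (del_tuple i t) - frag_of (del_act_tuple Q ra i t)))
      else (\<lambda>_. 0))"

definition degenerate :: "('x, 'm) quandle_scheme \<Rightarrow> 'y set \<Rightarrow> nat \<Rightarrow> ('y, 'x) chain set" where
  "degenerate Q Y n = generate (chain_group Q Y n)
     {frag_of (r, xs) | r xs. (r, xs) \<in> chain_basis Q Y n \<and>
        (\<exists>i. Suc i < n \<and> xs ! i = xs ! Suc i)}"

definition inv_act_tuple ::
    "('x, 'm) sym_quandle_scheme \<Rightarrow> ('y \<Rightarrow> 'x \<Rightarrow> 'y) \<Rightarrow> nat \<Rightarrow> 'y \<times> 'x list \<Rightarrow> 'y \<times> 'x list" where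
  "inv_act_tuple Q ra i =
     (\<lambda>(r, xs). (ra r (xs ! i),
        map (\<lambda>x. x \<star>\<^bsub>Q\<^esub> xs ! i) (take i xs) @ qinv Q (xs ! i) # drop (Suc i) xs))"

definition sym_degenerate ::
    "('x, 'm) sym_quandle_scheme \<Rightarrow> 'y set \<Rightarrow> ('y \<Rightarrow> 'x \<Rightarrow> 'y) \<Rightarrow> nat \<Rightarrow> ('y, 'x) chain set" where
  "sym_degenerate Q Y ra n = generate (chain_group Q Y n)
     {frag_of t + frag_of (inv_act_tuple Q ra i t) | t i. t \<in> chain_basis Q Y n \<and> i < n}"

definition SQ_sub ::
    "('x, 'm) sym_quandle_scheme \<Rightarrow> 'y set \<Rightarrow> ('y \<Rightarrow> 'x \<Rightarrow> 'y) \<Rightarrow> nat \<Rightarrow> ('y, 'x) chain set" where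
  "SQ_sub Q Y ra n = degenerate Q Y n <#>\<^bsub>chain_group Q Y n\<^esub> sym_degenerate Q Y ra n"

definition CQ :: "('x, 'm) quandle_scheme \<Rightarrow> 'y set \<Rightarrow> nat \<Rightarrow> ('y, 'x) chain set monoid" where
  "CQ Q Y n = chain_group Q Y n Mod degenerate Q Y n"

definition CSQ ::
    "('x, 'm) sym_quandle_scheme \<Rightarrow> 'y set \<Rightarrow> ('y \<Rightarrow> 'x \<Rightarrow> 'y) \<Rightarrow> nat \<Rightarrow> ('y, 'x) chain set monoid" where
  "CSQ Q Y ra n = chain_group Q Y n Mod SQ_sub Q Y ra n"

definition Q_class :: "('x, 'm) quandle_scheme \<Rightarrow> 'y set \<Rightarrow> nat \<Rightarrow> ('y, 'x) chain \<Rightarrow> ('y, 'x) chain set" where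
  "Q_class Q Y n c = degenerate Q Y n #>\<^bsub>chain_group Q Y n\<^esub> c"

definition SQ_class ::
    "('x, 'm) sym_quandle_scheme \<Rightarrow> 'y set \<Rightarrow> ('y \<Rightarrow> 'x \<Rightarrow> 'y) \<Rightarrow> nat \<Rightarrow> ('y, 'x) chain \<Rightarrow> ('y, 'x) chain set" where
  "SQ_class Q Y ra n c = SQ_sub Q Y ra n #>\<^bsub>chain_group Q Y n\<^esub> c"

text \<open>The boundary maps induced on cosets.\<close>

definition boundary_Q ::
    "('x, 'm) quandle_scheme \<Rightarrow> 'y set \<Rightarrow> ('y \<Rightarrow> 'x \<Rightarrow> 'y) \<Rightarrow> nat \<Rightarrow> ('y, 'x) chain set \<Rightarrow> ('y, 'x) chain set" where
  "boundary_Q Q Y ra n K = (\<Union>c\<in>K. Q_class Q Y (n - 1) (boundary Q ra n c))"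

definition boundary_SQ ::
    "('x, 'm) sym_quandle_scheme \<Rightarrow> 'y set \<Rightarrow> ('y \<Rightarrow> 'x \<Rightarrow> 'y) \<Rightarrow> nat \<Rightarrow> ('y, 'x) chain set \<Rightarrow> ('y, 'x) chain set" where
  "boundary_SQ Q Y ra n K = (\<Union>c\<in>K. SQ_class Q Y ra (n - 1) (boundary Q ra n c))"

definition quandle_2_cocycle ::
    "('x, 'm) quandle_scheme \<Rightarrow> 'y set \<Rightarrow> ('y \<Rightarrow> 'x \<Rightarrow> 'y) \<Rightarrow> ('a, 'k) monoid_scheme \<Rightarrow>
     (('y, 'x) chain set \<Rightarrow> 'a) \<Rightarrow> bool" where
  "quandle_2_cocycle Q Y ra A \<theta> \<longleftrightarrow>
     \<theta> \<in> hom (CQ Q Y 2) A \<and> (\<forall>K\<in>carrier (CQ Q Y 3). \<theta> (boundary_Q Q Y ra 3 K) = \<one>\<^bsub>A\<^esub>)"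

definition sym_quandle_2_cocycle ::
    "('x, 'm) sym_quandle_scheme \<Rightarrow> 'y set \<Rightarrow> ('y \<Rightarrow> 'x \<Rightarrow> 'y) \<Rightarrow> ('a, 'k) monoid_scheme \<Rightarrow>
     (('y, 'x) chain set \<Rightarrow> 'a) \<Rightarrow> bool" where
  "sym_quandle_2_cocycle Q Y ra A \<theta> \<longleftrightarrow>
     \<theta> \<in> hom (CSQ Q Y ra 2) A \<and> (\<forall>K\<in>carrier (CSQ Q Y ra 3). \<theta> (boundary_SQ Q Y ra 3 K) = \<one>\<^bsub>A\<^esub>)"

text \<open>
  The chain isomorphism \<open>T\<^sub>n\<close>: the classes of tuples with entries in \<open>X\<^sup>+\<^sup>1\<close> generate the
  domain, so it is the only homomorphism with the prescribed values on them. Here \<open>act\<close>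
  is the action of \<open>G\<^sub>X\<close>. Extensionality only fixes the values outside the domain.
\<close>

definition double_chain_map ::
    "('x, 'm) quandle_scheme \<Rightarrow> 'y set \<Rightarrow> ('y \<Rightarrow> 'x gword set \<Rightarrow> 'y) \<Rightarrow> nat \<Rightarrow>
     ('y, 'x \<times> sign) chain set \<Rightarrow> ('y, 'x) chain set" where
  "double_chain_map Q Y act n =
     (let ra = sym_gact (double Q) (double_act Q act); C = CSQ (double Q) Y ra n in
      THE T. T \<in> hom C (CQ Q Y n) \<and> T \<in> extensional (carrier C) \<and>
        (\<forall>(r, xs) \<in> chain_basis Q Y n.
           T (SQ_class (double Q) Y ra n (frag_of (r, map (\<lambda>x. (x, Pos)) xs)))
             = Q_class Q Y n (frag_of (r, xs))))"


section \<open>Links and diagrams\<close>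

text \<open>
  A link is given by embeddings of \<open>ncomp L\<close> disjoint circles \<open>\<real>/\<int>\<close> into three-space, with
  regular C1 parametrizations \<open>strand L i\<close> of period 1, and is projected along the third
  coordinate axis, the strand with the larger third coordinate being the upper one.
  The parametrization serves as a reference for orientations: a sign \<open>Pos\<close> (\<open>Neg\<close>) on a
  piece of the link denotes the direction of increasing (decreasing) parameter.
\<close>

record link =
  ncomp :: nat
  strand :: "nat \<Rightarrow> real \<Rightarrow> real^3"

definition proj :: "real^3 \<Rightarrow> real^2" where
  "proj p = vector [p $ 1, p $ 2]"

definition det2 :: "real^2 \<Rightarrow> real^2 \<Rightarrow> real" where
  "det2 u v = u $ 1 * v $ 2 - u $ 2 * v $ 1"

definition right_handed :: "real^2 \<Rightarrow> real^2 \<Rightarrow> bool" where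
  "right_handed u v \<longleftrightarrow> det2 u v > 0"

definition rot90 :: "real^2 \<Rightarrow> real^2" where
  "rot90 v = vector [- (v $ 2), v $ 1]"

definition link_points :: "link \<Rightarrow> (real^3) set" where
  "link_points L = (\<Union>i<ncomp L. range (strand L i))"

definition tangent :: "link \<Rightarrow> nat \<Rightarrow> real \<Rightarrow> real^2" where
  "tangent L i t = vector_derivative (\<lambda>s. proj (strand L i s)) (at t)"

text \<open>
  The normal direction belonging to the orientation \<open>e\<close>: the pair of the oriented tangent
  and the normal is right-handed. (Tangents and normals are not normalized, only the
  signs of their products matter.)
\<close>

definition normal_vec :: "link \<Rightarrow> nat \<Rightarrow> real \<Rightarrow> sign \<Rightarrow> real^2" where
  "normal_vec L i t e = rot90 (sval e *\<^sub>R tangent L i t)"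

text \<open>
  A crossing \<open>(i, s, j, t)\<close> consists of the parameters \<open>(i, s)\<close> of the lower and \<open>(j, t)\<close>
  of the upper strand; parameters in \<open>{0..<1}\<close> make this unique.
\<close>

type_synonym crossing = "nat \<times> real \<times> nat \<times> real"

definition crossings :: "link \<Rightarrow> crossing set" where
  "crossings L = {(i, s, j, t). i < ncomp L \<and> j < ncomp L \<and> s \<in> {0..<1} \<and> t \<in> {0..<1} \<and>
     proj (strand L i s) = proj (strand L j t) \<and> strand L i s $ 3 < strand L j t $ 3}"

definition link_diagram :: "link \<Rightarrow> bool" where
  "link_diagram L \<longleftrightarrow>
     (\<forall>i<ncomp L. strand L i C1_differentiable_on UNIV) \<and>
     (\<forall>i<ncomp L. \<forall>j<ncomp L. \<forall>s t. strand L i s = strand L j t \<longleftrightarrow> i = j \<and> s - t \<in> \<int>) \<and>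
     (\<forall>i<ncomp L. \<forall>t. tangent L i t \<noteq> 0) \<and>
     (\<forall>i<ncomp L. \<forall>j<ncomp L. \<forall>s t. proj (strand L i s) = proj (strand L j t) \<and>
        strand L i s \<noteq> strand L j t \<longrightarrow> det2 (tangent L i s) (tangent L j t) \<noteq> 0) \<and>
     (\<forall>p\<in>link_points L. \<forall>q\<in>link_points L. \<forall>u\<in>link_points L.
        proj p = proj q \<and> proj q = proj u \<longrightarrow> p = q \<or> q = u \<or> p = u) \<and>
     finite (crossings L)"

definition under_points :: "link \<Rightarrow> (real^3) set" where
  "under_points L = {p \<in> link_points L. \<exists>q\<in>link_points L. proj q = proj p \<and> p $ 3 < q $ 3}"

definition over_points :: "link \<Rightarrow> (real^3) set" where
  "over_points L = {p \<in> link_points L. \<exists>q\<in>link_points L. proj q = proj p \<and> q $ 3 < p $ 3}"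

text \<open>
  Cutting the lower strand of the planar figure at a crossing leaves the upper strand
  intact. Arcs and semi-arcs are therefore described by their lifts to the link itself,
  where the two points over a crossing are distinct.
\<close>

definition arcs :: "link \<Rightarrow> (real^3) set set" where
  "arcs L = components (link_points L - under_points L)"

definition semi_arcs :: "link \<Rightarrow> (real^3) set set" where
  "semi_arcs L = components (link_points L - under_points L - over_points L)"

definition regions :: "link \<Rightarrow> (real^2) set set" where
  "regions L = components (- (proj ` link_points L))"

text \<open>
  The member of \<open>\<A>\<close> (arcs or semi-arcs) in which component \<open>i\<close> runs immediately after
  (\<open>e = Pos\<close>) or before (\<open>e = Neg\<close>) the parameter \<open>s\<close>.
\<close>

definition end_at :: "link \<Rightarrow> (real^3) set set \<Rightarrow> nat \<Rightarrow> real \<Rightarrow> sign \<Rightarrow> (real^3) set" where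
  "end_at L \<A> i s e =
     (THE A. A \<in> \<A> \<and> (\<forall>\<^sub>F h in at_right 0. strand L i (s + sval e * h) \<in> A))"

definition arc_through :: "link \<Rightarrow> nat \<Rightarrow> real \<Rightarrow> (real^3) set" where
  "arc_through L j t = (THE A. A \<in> arcs L \<and> strand L j t \<in> A)"

definition runs_into :: "real^2 \<Rightarrow> real^2 \<Rightarrow> (real^2) set \<Rightarrow> bool" where
  "runs_into c v R \<longleftrightarrow> (\<forall>\<^sub>F h in at_right 0. c + h *\<^sub>R v \<in> R)"

text \<open>
  Two regions are adjacent over the link at the parameter \<open>(i, t)\<close>, which is not at a
  crossing, with \<open>n\<close> pointing from the first to the second.
\<close>

definition adjacent_at ::
    "link \<Rightarrow> nat \<Rightarrow> real \<Rightarrow> real^2 \<Rightarrow> (real^2) set \<Rightarrow> (real^2) set \<Rightarrow> bool" where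
  "adjacent_at L i t n R1 R2 \<longleftrightarrow>
     R1 \<in> regions L \<and> R2 \<in> regions L \<and>
     strand L i t \<notin> under_points L \<and> strand L i t \<notin> over_points L \<and>
     runs_into (proj (strand L i t)) (- n) R1 \<and> runs_into (proj (strand L i t)) n R2"

text \<open>
  The four regions around a crossing correspond to pairs of signs: \<open>(a, b)\<close> stands for the
  region facing the \<open>a\<close>-end of the lower and the \<open>b\<close>-end of the upper strand.
\<close>

definition quadrant :: "link \<Rightarrow> crossing \<Rightarrow> sign \<Rightarrow> sign \<Rightarrow> real^2" where
  "quadrant L = (\<lambda>(i, s, j, t) a b. sval a *\<^sub>R tangent L i s + sval b *\<^sub>R tangent L j t)"

definition quadrant_region :: "link \<Rightarrow> crossing \<Rightarrow> sign \<Rightarrow> sign \<Rightarrow> (real^2) set" where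
  "quadrant_region L = (\<lambda>(i, s, j, t) a b.
     THE R. R \<in> regions L \<and> runs_into (proj (strand L i s)) (quadrant L (i, s, j, t) a b) R)"

definition hand_sign :: "real^2 \<Rightarrow> real^2 \<Rightarrow> sign" where
  "hand_sign u v = (if right_handed u v then Pos else Neg)"


section \<open>Colorings of oriented diagrams\<close>

text \<open>An orientation of the link is a sign for each of its components.\<close>

type_synonym orientation = "nat \<Rightarrow> sign"

record ('x, 'y) coloring =
  alab :: "(real^3) set \<Rightarrow> 'x"
  areg :: "(real^2) set \<Rightarrow> 'y"

definition Col_XY ::
    "('x, 'm) quandle_scheme \<Rightarrow> 'y set \<Rightarrow> ('y \<Rightarrow> 'x \<Rightarrow> 'y) \<Rightarrow> link \<Rightarrow> orientation \<Rightarrow> ('x, 'y) coloring set" where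
  "Col_XY Q Y ra L ori = {C.
     alab C \<in> arcs L \<rightarrow>\<^sub>E qcarrier Q \<and> areg C \<in> regions L \<rightarrow>\<^sub>E Y \<and>
     (\<forall>(i, s, j, t) \<in> crossings L. \<forall>a.
        (sval a *\<^sub>R tangent L i s) \<bullet> normal_vec L j t (ori j) < 0 \<longrightarrow>
        alab C (end_at L (arcs L) i s a) \<star>\<^bsub>Q\<^esub> alab C (arc_through L j t)
          = alab C (end_at L (arcs L) i s (opp a))) \<and>
     (\<forall>i<ncomp L. \<forall>t. \<forall>A\<in>arcs L. \<forall>R1 R2. strand L i t \<in> A \<longrightarrow>
        adjacent_at L i t (normal_vec L i t (ori i)) R1 R2 \<longrightarrow> ra (areg C R1) (alab C A) = areg C R2)}"

text \<open>
  The sign \<open>a\<close> singles out the under-arc from which the normal of the over-arc points, and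
  \<open>(a, b)\<close> the region from which both normals point.
\<close>

definition weight_XY :: "link \<Rightarrow> orientation \<Rightarrow> ('x, 'y) coloring \<Rightarrow> crossing \<Rightarrow> ('y, 'x) chain" where
  "weight_XY L ori C = (\<lambda>(i, s, j, t). THE w. \<exists>a b.
     let n1 = normal_vec L i s (ori i); n2 = normal_vec L j t (ori j); v = quadrant L (i, s, j, t) a b in
     (sval a *\<^sub>R tangent L i s) \<bullet> n2 < 0 \<and> v \<bullet> n1 < 0 \<and> v \<bullet> n2 < 0 \<and>
     w = frag_cmul (sval (hand_sign n2 n1))
           (frag_of (areg C (quadrant_region L (i, s, j, t) a b),
              [alab C (end_at L (arcs L) i s a), alab C (arc_through L j t)])))"

definition W_XY ::
    "('x, 'm) quandle_scheme \<Rightarrow> 'y set \<Rightarrow> link \<Rightarrow> orientation \<Rightarrow> ('x, 'y) coloring \<Rightarrow> ('y, 'x) chain set" where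
  "W_XY Q Y L ori C = Q_class Q Y 2 (\<Sum>k\<in>crossings L. weight_XY L ori C k)"


section \<open>Colorings of unoriented diagrams by symmetric quandles\<close>

text \<open>
  An assignment consists of normal orientations and labels of the semi-arcs and labels of
  the regions. The normal orientation of a semi-arc is encoded by the sign \<open>e\<close> such that
  \<open>normal_vec L i t e\<close> is the normal at its point with parameter \<open>(i, t)\<close>. Consequently two
  consecutive semi-arcs on a strand have coherent normal orientations iff their signs agree.
\<close>

record ('x, 'y) assignment =
  snor :: "(real^3) set \<Rightarrow> sign"
  slab :: "(real^3) set \<Rightarrow> 'x"
  sreg :: "(real^2) set \<Rightarrow> 'y"

definition assignments ::
    "('x, 'm) sym_quandle_scheme \<Rightarrow> 'y set \<Rightarrow> ('y \<Rightarrow> 'x \<Rightarrow> 'y) \<Rightarrow> link \<Rightarrow> ('x, 'y) assignment set" where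
  "assignments Q Y ra L = {c.
     snor c \<in> semi_arcs L \<rightarrow>\<^sub>E UNIV \<and> slab c \<in> semi_arcs L \<rightarrow>\<^sub>E qcarrier Q \<and>
     sreg c \<in> regions L \<rightarrow>\<^sub>E Y \<and>
     (\<forall>(i, s, j, t) \<in> crossings L. \<forall>b.
        let A1 = end_at L (semi_arcs L) j t b; A2 = end_at L (semi_arcs L) j t (opp b) in
        slab c A1 = (if snor c A1 = snor c A2 then slab c A2 else qinv Q (slab c A2))) \<and>
     (\<forall>(i, s, j, t) \<in> crossings L. \<forall>a b.
        let A1 = end_at L (semi_arcs L) i s a; A2 = end_at L (semi_arcs L) i s (opp a);
            A3 = end_at L (semi_arcs L) j t b in
        (sval a *\<^sub>R tangent L i s) \<bullet> normal_vec L j t (snor c A3) < 0 \<longrightarrow>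
        slab c A1 \<star>\<^bsub>Q\<^esub> slab c A3
          = (if snor c A1 = snor c A2 then slab c A2 else qinv Q (slab c A2))) \<and>
     (\<forall>i<ncomp L. \<forall>t. \<forall>A\<in>semi_arcs L. \<forall>R1 R2. strand L i t \<in> A \<longrightarrow>
        adjacent_at L i t (normal_vec L i t (snor c A)) R1 R2 \<longrightarrow> ra (sreg c R1) (slab c A) = sreg c R2)}"

definition basic_inversion ::
    "('x, 'm) sym_quandle_scheme \<Rightarrow> link \<Rightarrow> ('x, 'y) assignment \<Rightarrow> ('x, 'y) assignment \<Rightarrow> bool" where
  "basic_inversion Q L c c' \<longleftrightarrow> (\<exists>A\<in>semi_arcs L.
     c' = c\<lparr>snor := (snor c)(A := opp (snor c A)), slab := (slab c)(A := qinv Q (slab c A))\<rparr>)"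

definition Col_sym ::
    "('x, 'm) sym_quandle_scheme \<Rightarrow> 'y set \<Rightarrow> ('y \<Rightarrow> 'x \<Rightarrow> 'y) \<Rightarrow> link \<Rightarrow> ('x, 'y) assignment set set" where
  "Col_sym Q Y ra L = assignments Q Y ra L //
     {(c, c'). c \<in> assignments Q Y ra L \<and> c' \<in> assignments Q Y ra L \<and>
               equivclp (basic_inversion Q L) c c'}"

definition weights_sym :: "link \<Rightarrow> ('x, 'y) assignment set \<Rightarrow> crossing \<Rightarrow> ('y, 'x) chain set" where
  "weights_sym L C = (\<lambda>(i, s, j, t). {w. \<exists>a b. \<exists>c\<in>C.
     let A1 = end_at L (semi_arcs L) i s a; A2 = end_at L (semi_arcs L) j t b;
         n1 = normal_vec L i s (snor c A1); n2 = normal_vec L j t (snor c A2);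
         v = quadrant L (i, s, j, t) a b in
     v \<bullet> n1 < 0 \<and> v \<bullet> n2 < 0 \<and>
     w = frag_cmul (sval (hand_sign n2 n1))
           (frag_of (sreg c (quadrant_region L (i, s, j, t) a b), [slab c A1, slab c A2]))})"

text \<open>The choice \<open>SOME\<close> includes the choice of one of the four regions at each crossing.\<close>

definition W_sym ::
    "('x, 'm) sym_quandle_scheme \<Rightarrow> 'y set \<Rightarrow> ('y \<Rightarrow> 'x \<Rightarrow> 'y) \<Rightarrow> link \<Rightarrow>
     ('x, 'y) assignment set \<Rightarrow> ('y, 'x) chain set" where
  "W_sym Q Y ra L C = SQ_class Q Y ra 2 (\<Sum>k\<in>crossings L. SOME w. w \<in> weights_sym L C k)"

definition canonical_form :: "link \<Rightarrow> ('x \<times> sign, 'y) assignment set \<Rightarrow> ('x \<times> sign, 'y) assignment" where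
  "canonical_form L C = (THE c. c \<in> C \<and> (\<forall>A\<in>semi_arcs L. snd (slab c A) = Pos))"

definition induces_orientation :: "link \<Rightarrow> ('x \<times> sign, 'y) assignment set \<Rightarrow> orientation \<Rightarrow> bool" where
  "induces_orientation L C ori \<longleftrightarrow>
     (\<forall>i<ncomp L. \<forall>A\<in>semi_arcs L. A \<subseteq> range (strand L i) \<longrightarrow> snor (canonical_form L C) A = ori i)"

definition same_ori ::
    "link \<Rightarrow> ('x \<times> sign, 'y) assignment set \<Rightarrow> ('x \<times> sign, 'y) assignment set \<Rightarrow> bool" where
  "same_ori L C C' \<longleftrightarrow> (\<exists>ori. induces_orientation L C ori \<and> induces_orientation L C' ori)"

definition ori_class ::
    "('x, 'm) quandle_scheme \<Rightarrow> 'y set \<Rightarrow> ('y \<Rightarrow> 'x \<times> sign \<Rightarrow> 'y) \<Rightarrow> link \<Rightarrow>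
     ('x \<times> sign, 'y) assignment set \<Rightarrow> ('x \<times> sign, 'y) assignment set set" where
  "ori_class Q Y ra L C = {C' \<in> Col_sym (double Q) Y ra L. same_ori L C C'}"


section \<open>Multi-sets of invariants\<close>

text \<open>
  The multi-set \<open>{f i | i \<in> I}\<close> is represented by the family \<open>(I, f)\<close>. As \<open>I\<close> may be infinite,
  multiplicities are cardinals, and two families denote the same multi-set iff
  every element has the same multiplicity in both.
\<close>

type_synonym ('i, 'a) family = "'i set \<times> ('i \<Rightarrow> 'a)"

definition same_multiset :: "('i, 'a) family \<Rightarrow> ('j, 'a) family \<Rightarrow> bool"  (infix \<open>\<simeq>\<^sub>m\<close> 50) where
  "F \<simeq>\<^sub>m G \<longleftrightarrow> (\<forall>a. {i \<in> fst F. snd F i = a} \<approx> {j \<in> fst G. snd G j = a})"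

definition Phi_Q ::
    "('x, 'm) quandle_scheme \<Rightarrow> 'y set \<Rightarrow> ('y \<Rightarrow> 'x gword set \<Rightarrow> 'y) \<Rightarrow> (('y, 'x) chain set \<Rightarrow> 'a) \<Rightarrow>
     link \<Rightarrow> orientation \<Rightarrow> (('x, 'y) coloring, 'a) family" where
  "Phi_Q Q Y act \<theta> L ori = (Col_XY Q Y (gact Q act) L ori, \<lambda>C. \<theta> (W_XY Q Y L ori C))"

definition Phi_SQ ::
    "('x, 'm) quandle_scheme \<Rightarrow> 'y set \<Rightarrow> ('y \<Rightarrow> 'x gword set \<Rightarrow> 'y) \<Rightarrow>
     (('y, 'x \<times> sign) chain set \<Rightarrow> 'a) \<Rightarrow> link \<Rightarrow> ('x \<times> sign, 'y) assignment set \<Rightarrow>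
     (('x \<times> sign, 'y) assignment set, 'a) family" where
  "Phi_SQ Q Y act \<theta> L C =
     (let ra = sym_gact (double Q) (double_act Q act) in
      (ori_class Q Y ra L C, \<lambda>C'. \<theta> (W_sym (double Q) Y ra L C')))"

end

theory Submission
  imports Defs
begin

text \<open>
The two families are matched by a bijection of their index sets that preserves the values.

Index sets. An \<open>X\<^sub>Y\<close>-coloring of the oriented diagram gives every semi-arc the label
\<open>(x, Pos)\<close>, where \<open>x\<close> is the label of the arc around it, and the normal direction belonging
to \<open>ori\<close>; this is an assignment in canonical form. Conversely, in a canonical form the
labels on the two sides of an over-crossing agree, so the label is constant along each arc
(\<open>constant_on_arcs\<close>) and the canonical form comes from a coloring (\<open>bij_to_assignment\<close>).
Canonical forms in turn correspond to classes of assignments: basic inversions change neither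
the underlying label \<open>lab\<close> nor the direction \<open>dir\<close> of a semi-arc, the conditions
on an assignment can be expressed through these two (\<open>assignments_iff\<close>), and since there are
only finitely many semi-arcs, every class contains exactly one canonical form
(\<open>Col_sym_eq\<close>, \<open>canonical_form_inv_class\<close>).

Values. The weight of a crossing of an unoriented diagram involves the choice of a
representative of the class and of one of four regions. The oriented weight corresponds to one of these
choices, and each passage to a region on the other side of a strand changes the chain by
a generator of the subgroup that is divided out (\<open>weight_classes\<close>). This uses that the labels of
neighbouring quadrants at a crossing differ by the action of the label of the strand
between them. Adjacency of regions is defined at points away from the crossings, whereas
the quadrants are defined by rays issuing from the crossing, and the analytic part of the
development reconciles the two (\<open>quadrant_side\<close>): close to the
crossing, the points just beside a strand lie in the quadrant beside it.

Cocycles. Finally the map \<open>T\<^sub>2\<close> has to be evaluated. It is given by a definite description; on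
chains, \<open>flatten\<close> makes all signs in a tuple positive by means of the relations and
induces a map with the required properties, and every class of chains has a representative
with positive entries, so that there is no other such map
(\<open>double_chain_map_lift\<close>).
\<close>

section \<open>The strands of a diagram and their planar projections\<close>

lemma rot90_inner: "v \<bullet> rot90 w = det2 w v"
  by (simp add: rot90_def det2_def inner_vec_def sum_2)

lemma det2_simps:
  "det2 (a *\<^sub>R u) v = a * det2 u v" "det2 u (a *\<^sub>R v) = a * det2 u v"
  "det2 (u + w) v = det2 u v + det2 w v" "det2 u (v + w) = det2 u v + det2 u w"
  "det2 (u - w) v = det2 u v - det2 w v" "det2 u (v - w) = det2 u v - det2 u w"
  "det2 (- u) v = - det2 u v" "det2 u (- v) = - det2 u v" "det2 u u = 0"
  by (auto simp: det2_def algebra_simps)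

lemma det2_commute: "det2 v u = - det2 u v"
  by (simp add: det2_def)

lemma det2_rot90: "det2 (rot90 u) (rot90 v) = det2 u v"
  by (simp add: det2_def rot90_def)

lemma abs_det2_le: "\<bar>det2 u v\<bar> \<le> norm u * norm v"
proof -
  have "norm (rot90 u) = norm u"
    by (simp add: rot90_def norm_vec_def L2_set_def sum_2 add.commute)
  then show ?thesis
    using Cauchy_Schwarz_ineq2[of v "rot90 u"] by (simp add: rot90_inner mult.commute)
qed

lemma normal_vec_inner: "v \<bullet> normal_vec L i t e = sval e * det2 (tangent L i t) v"
  by (simp add: normal_vec_def rot90_inner det2_simps)

lemma bounded_linear_proj: "bounded_linear proj"
proof -
  have "proj = (\<lambda>p. \<chi> k. if k = 1 then p $ 1 else p $ 2)"
    by (auto simp: proj_def fun_eq_iff vec_eq_iff forall_2)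
  moreover have "linear (\<lambda>p::real^3. (\<chi> k. if k = 1 then p $ 1 else p $ 2)::real^2)"
    by (rule linearI) (auto simp: vec_eq_iff)
  ultimately show ?thesis by (simp add: linear_conv_bounded_linear)
qed

lemma sval_opp [simp]: "sval (opp e) = - (sval e :: 'a::ring_1)"
  by (cases e) auto

lemma continuous_on_det2 [continuous_intros]:
  "continuous_on S f \<Longrightarrow> continuous_on S g \<Longrightarrow> continuous_on S (\<lambda>x. det2 (f x) (g x))"
  unfolding det2_def by (intro continuous_intros)

locale diagram =
  fixes L :: link
  assumes diagram: "link_diagram L"
begin

abbreviation "\<gamma> i t \<equiv> proj (strand L i t)"

definition shadow where "shadow = proj ` link_points L"

lemma regions_eq: "regions L = components (- shadow)"
  by (simp add: regions_def shadow_def)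

lemma strand_eq: "i < ncomp L \<Longrightarrow> j < ncomp L \<Longrightarrow> strand L i s = strand L j t \<longleftrightarrow> i = j \<and> s - t \<in> \<int>"
  using diagram unfolding link_diagram_def by blast

lemma strand_periodic: "i < ncomp L \<Longrightarrow> m \<in> \<int> \<Longrightarrow> strand L i (s + m) = strand L i s"
  by (subst strand_eq) auto

lemma strand_diff:
  assumes "i < ncomp L"
  obtains D where "\<And>t. (strand L i has_vector_derivative D t) (at t)" "continuous_on UNIV D"
proof -
  have "strand L i C1_differentiable_on UNIV"
    using diagram assms unfolding link_diagram_def by blast
  then show thesis using that unfolding C1_differentiable_on_def by blast
qed

lemma strand_cont: "i < ncomp L \<Longrightarrow> continuous_on S (strand L i)"
  by (metis strand_diff continuous_on_vector_derivative has_vector_derivative_at_within)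

lemma planar_derivative:
  assumes "i < ncomp L"
  shows "(\<gamma> i has_vector_derivative tangent L i t) (at t)"
    and "continuous_on S (tangent L i)"
proof -
  obtain D where D: "\<And>t. (strand L i has_vector_derivative D t) (at t)" "continuous_on UNIV D"
    using strand_diff[OF assms] by blast
  have d: "(\<gamma> i has_vector_derivative proj (D t)) (at t)" for t
    by (rule bounded_linear.has_vector_derivative[OF bounded_linear_proj D(1)])
  have t: "tangent L i t = proj (D t)" for t
    unfolding tangent_def by (rule vector_derivative_at[OF d])
  show "(\<gamma> i has_vector_derivative tangent L i t) (at t)"
    using d t by simp
  have "continuous_on UNIV (\<lambda>t. proj (D t))"
    using D(2) by (rule bounded_linear.continuous_on[OF bounded_linear_proj])
  then have "continuous_on UNIV (tangent L i)"
    using t by (simp add: fun_eq_iff[symmetric])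
  then show "continuous_on S (tangent L i)" by (rule continuous_on_subset) auto
qed

lemma planar_cont: "i < ncomp L \<Longrightarrow> continuous_on S (\<gamma> i)"
  using bounded_linear.continuous_on[OF bounded_linear_proj] strand_cont by blast

lemma tangent_nonzero: "i < ncomp L \<Longrightarrow> tangent L i t \<noteq> 0"
  using diagram unfolding link_diagram_def by blast

lemma transverse:
  "i < ncomp L \<Longrightarrow> j < ncomp L \<Longrightarrow> \<gamma> i s = \<gamma> j t \<Longrightarrow> strand L i s \<noteq> strand L j t \<Longrightarrow>
   det2 (tangent L i s) (tangent L j t) \<noteq> 0"
  using diagram unfolding link_diagram_def by blast

lemma no_triple:
  "p \<in> link_points L \<Longrightarrow> q \<in> link_points L \<Longrightarrow> u \<in> link_points L \<Longrightarrow> proj p = proj q \<Longrightarrow>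
   proj q = proj u \<Longrightarrow> p = q \<or> q = u \<or> p = u"
  using diagram unfolding link_diagram_def by blast

lemma finite_crossings: "finite (crossings L)"
  using diagram unfolding link_diagram_def by blast

lemma in_link: "i < ncomp L \<Longrightarrow> strand L i s \<in> link_points L"
  by (auto simp: link_points_def)

lemma range_strand:
  assumes "i < ncomp L" shows "range (strand L i) = strand L i ` {0..<1}" 
proof -
  have "strand L i s = strand L i (frac s)" for s
    using strand_periodic[OF assms, of "of_int \<lfloor>s\<rfloor>" "frac s"] by (simp add: frac_def)
  then show ?thesis by (fastforce simp: frac_lt_1)
qed

lemma link_param:
  assumes "p \<in> link_points L"
  obtains i s where "i < ncomp L" "s \<in> {0..<1}" "p = strand L i s"
  using assms range_strand by (fastforce simp: link_points_def)

lemma compact_range_strand: "i < ncomp L \<Longrightarrow> compact (range (strand L i))"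
proof -
  assume i: "i < ncomp L"
  have "range (strand L i) = strand L i ` {0..1}" using range_strand[OF i] by auto
  then show ?thesis using compact_continuous_image[OF strand_cont[OF i]] by simp
qed

lemma crossing_point_cases:
  assumes "p \<in> link_points L" "q \<in> link_points L" "proj p = proj q" "p $ 3 < q $ 3"
  obtains i s j t where "(i, s, j, t) \<in> crossings L" "p = strand L i s" "q = strand L j t"
proof -
  obtain i s j t where "i < ncomp L" "s \<in> {0..<1}" "p = strand L i s"
     "j < ncomp L" "t \<in> {0..<1}" "q = strand L j t"
    using link_param[OF assms(1)] link_param[OF assms(2)] by metis
  with assms show thesis by (intro that[of i s j t]) (auto simp: crossings_def)
qed

lemma finite_under: "finite (under_points L)" and finite_over: "finite (over_points L)"
proof -
  have "p \<in> (\<lambda>(i,s,j,t). strand L i s) ` crossings L" if pu: "p \<in> under_points L" for p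
  proof -
    obtain q where "p \<in> link_points L" "q \<in> link_points L" "proj q = proj p" "p $ 3 < q $ 3"
      using pu unfolding under_points_def by blast
    then obtain i s j t where "(i, s, j, t) \<in> crossings L" "p = strand L i s"
      by (metis crossing_point_cases)
    then show ?thesis by (metis (mono_tags) case_prod_conv image_eqI)
  qed
  then have "under_points L \<subseteq> (\<lambda>(i,s,j,t). strand L i s) ` crossings L" by blast
  then show "finite (under_points L)" using finite_crossings finite_surj by blast
  have "p \<in> (\<lambda>(i,s,j,t). strand L j t) ` crossings L" if po: "p \<in> over_points L" for p
  proof -
    obtain q where "p \<in> link_points L" "q \<in> link_points L" "proj q = proj p" "q $ 3 < p $ 3"
      using po unfolding over_points_def by auto
    then obtain i s j t where "(i, s, j, t) \<in> crossings L" "p = strand L j t"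
      by (metis crossing_point_cases)
    then show ?thesis by (metis (mono_tags) case_prod_conv image_eqI)
  qed
  then have "over_points L \<subseteq> (\<lambda>(i,s,j,t). strand L j t) ` crossings L" by blast
  then show "finite (over_points L)" using finite_crossings finite_surj by blast
qed

lemma crossing_facts:
  assumes "(i, s, j, t) \<in> crossings L"
  shows "i < ncomp L" "j < ncomp L" "\<gamma> i s = \<gamma> j t" "strand L i s \<noteq> strand L j t"
    "strand L i s \<in> under_points L" "strand L j t \<in> over_points L"
    "det2 (tangent L i s) (tangent L j t) \<noteq> 0"
proof -
  show a: "i < ncomp L" "j < ncomp L" "\<gamma> i s = \<gamma> j t" "strand L i s \<noteq> strand L j t"
    using assms by (auto simp: crossings_def)
  show "strand L i s \<in> under_points L" "strand L j t \<in> over_points L"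
    using assms in_link a by (auto simp: crossings_def under_points_def over_points_def) 
  show "det2 (tangent L i s) (tangent L j t) \<noteq> 0" using transverse a by blast
qed

lemma under_over_disjoint: "under_points L \<inter> over_points L = {}"
proof -
  have False if "p \<in> under_points L" "p \<in> over_points L" for p
  proof -
    obtain q u where "q \<in> link_points L" "proj q = proj p" "p $ 3 < q $ 3"
      "u \<in> link_points L" "proj u = proj p" "u $ 3 < p $ 3" "p \<in> link_points L"
      using \<open>p \<in> under_points L\<close> \<open>p \<in> over_points L\<close>
      by (auto simp: under_points_def over_points_def)
    then show False using no_triple[of p q u] by auto
  qed
  then show ?thesis by blast
qed

end

section \<open>The shadow of a link near one of its points\<close>

text \<open>
The estimate is uniform in both points near \<open>c\<close>. It results from the mean value inequality
for \<open>f t - t D(c)\<close>, whose derivative is small near \<open>c\<close> by continuity of \<open>D\<close>.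
\<close>

lemma strict_derivative:
  fixes f :: "real \<Rightarrow> 'a::real_normed_vector"
  assumes f: "\<And>t. (f has_vector_derivative D t) (at t)" and D: "continuous_on UNIV D" and e: "0 < e"
  obtains d where "0 < d"
    "\<And>x y. \<bar>x - c\<bar> < d \<Longrightarrow> \<bar>y - c\<bar> < d \<Longrightarrow> norm (f x - f y - (x - y) *\<^sub>R D c) \<le> e * \<bar>x - y\<bar>"
proof -
  have "isCont D c" using D by (simp add: continuous_on_eq_continuous_at)
  then obtain d where d: "0 < d" "\<And>x. \<bar>x - c\<bar> < d \<Longrightarrow> norm (D x - D c) < e"
    using e unfolding continuous_at_eps_delta dist_norm real_norm_def by blast
  have "norm (f x - f y - (x - y) *\<^sub>R D c) \<le> e * \<bar>x - y\<bar>" if "\<bar>x - c\<bar> < d" "\<bar>y - c\<bar> < d" for x y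
  proof -
    let ?S = "ball c d"
    let ?g = "\<lambda>t. f t - t *\<^sub>R D c"
    have "norm (?g x - ?g y) \<le> e * norm (x - y)"
    proof (rule differentiable_bound[of ?S ?g "\<lambda>t h. h *\<^sub>R (D t - D c)"])
      fix t assume t: "t \<in> ?S"
      have "(?g has_vector_derivative (D t - D c)) (at t)"
        using f[of t] by (auto intro!: derivative_eq_intros)
      then show "(?g has_derivative (\<lambda>h. h *\<^sub>R (D t - D c))) (at t within ?S)"
        unfolding has_vector_derivative_def by (simp add: has_derivative_at_withinI)
      have "norm (D t - D c) < e" using t d(2)[of t] by (simp add: dist_real_def abs_minus_commute)
      then show "onorm (\<lambda>h. h *\<^sub>R (D t - D c)) \<le> e"
        by (subst onorm_scaleR_left) (auto simp: onorm_id bounded_linear_ident)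
    qed (use that in \<open>auto simp: dist_real_def abs_minus_commute\<close>)
    then show ?thesis by (simp add: algebra_simps)
  qed
  with d(1) show thesis using that by blast
qed

context diagram begin

text \<open>
The set \<open>B\<close> lists one parameter for each branch through \<open>z\<close>. The parameters in one period that
keep away from all branches form a compact set, whose image is closed and does not contain \<open>z\<close>.
\<close>

lemma localize:
  assumes B: "\<And>l x. l < ncomp L \<Longrightarrow> \<gamma> l x = z \<Longrightarrow> \<exists>(k, y)\<in>B. l = k \<and> x - y \<in> \<int>" and "0 < \<delta>"
  obtains \<eta> where "0 < \<eta>"
    "\<And>q. q \<in> shadow \<Longrightarrow> dist z q < \<eta> \<Longrightarrow> \<exists>(k, y)\<in>B. \<exists>x. k < ncomp L \<and> \<bar>x - y\<bar> < \<delta> \<and> q = \<gamma> k x"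
proof -
  define near where "near l e \<longleftrightarrow> 0 < e \<and> (\<forall>x. dist z (\<gamma> l x) < e \<longrightarrow>
      (\<exists>(k, y)\<in>B. \<exists>x'. k = l \<and> \<bar>x' - y\<bar> < \<delta> \<and> \<gamma> l x = \<gamma> k x'))" for l e
  have ex: "\<exists>\<eta>. near l \<eta>" if l: "l < ncomp L" for l
  proof -
    define U where "U = (\<Union>y\<in>{y. \<gamma> l y = z}. ball y \<delta>)"
    define K where "K = \<gamma> l ` ({0..1} - U)"
    have "compact ({0..1} - U)" unfolding U_def by (intro compact_diff) auto
    then have "compact K" unfolding K_def using planar_cont[OF l] compact_continuous_image by blast
    moreover have "z \<notin> K" using \<open>0 < \<delta>\<close> by (auto simp: K_def U_def)
    ultimately obtain \<eta> where \<eta>: "\<eta> > 0" "\<And>q. q \<in> K \<Longrightarrow> \<eta> \<le> dist z q"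
      using separate_point_closed[of K z] compact_imp_closed by metis
    have "\<exists>(k, y)\<in>B. \<exists>x'. k = l \<and> \<bar>x' - y\<bar> < \<delta> \<and> \<gamma> l x = \<gamma> k x'" if x: "dist z (\<gamma> l x) < \<eta>" for x
    proof -
      let ?x = "frac x"
      have "strand L l x = strand L l ?x"
        using strand_periodic[OF l, of "of_int \<lfloor>x\<rfloor>" "frac x"] by (simp add: frac_def)
      then have g: "\<gamma> l x = \<gamma> l ?x" by simp
      have "?x \<in> {0..1}" using frac_lt_1[of x] by auto
      then have "?x \<in> U" using x \<eta>(2)[of "\<gamma> l ?x"] g by (force simp: K_def)
      then obtain y where y: "\<gamma> l y = z" "\<bar>?x - y\<bar> < \<delta>"
        by (auto simp: U_def dist_real_def abs_minus_commute)
      then obtain k y' where "(k, y') \<in> B" "l = k" "y - y' \<in> \<int>" using B[OF l y(1)] by blast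
      moreover have "strand L l (?x + (y' - y)) = strand L l ?x"
        using \<open>y - y' \<in> \<int>\<close> by (intro strand_periodic l) (metis Ints_minus minus_diff_eq)
      moreover have "\<bar>?x + (y' - y) - y'\<bar> < \<delta>" using y by simp
      ultimately show ?thesis
        using g by (intro bexI[of _ "(k, y')"]) (auto intro!: exI[of _ "?x + (y' - y)"])
    qed
    then show ?thesis using \<eta>(1) unfolding near_def by blast
  qed
  then obtain \<eta> where "\<And>l. l < ncomp L \<Longrightarrow> near l (\<eta> l)" by metis
  then have \<eta>: "\<And>l. l < ncomp L \<Longrightarrow> 0 < \<eta> l"
    "\<And>l x. l < ncomp L \<Longrightarrow> dist z (\<gamma> l x) < \<eta> l \<Longrightarrow> \<exists>(k, y)\<in>B. \<exists>x'. k = l \<and> \<bar>x' - y\<bar> < \<delta> \<and> \<gamma> l x = \<gamma> k x'"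
    unfolding near_def by blast+
  define \<epsilon> where "\<epsilon> = Min (insert 1 (\<eta> ` {..<ncomp L}))"
  have "0 < \<epsilon>" unfolding \<epsilon>_def using \<eta>(1) by (subst Min_gr_iff) auto
  moreover have "\<exists>(k, y)\<in>B. \<exists>x. k < ncomp L \<and> \<bar>x - y\<bar> < \<delta> \<and> q = \<gamma> k x" if "q \<in> shadow" "dist z q < \<epsilon>" for q
  proof -
    obtain l x where l: "l < ncomp L" "q = \<gamma> l x" using \<open>q \<in> shadow\<close> by (auto simp: shadow_def link_points_def)
    have "\<epsilon> \<le> \<eta> l" unfolding \<epsilon>_def using l by (intro Min_le) auto
    then show ?thesis using \<eta>(2)[of l x] that l by fastforce
  qed
  ultimately show thesis using that by blast
qed

text \<open>
Near \<open>z\<close> a branch with tangent \<open>d\<close> stays in a thin double cone around the line of \<open>d\<close>. As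
\<open>det2 d w\<close> is bounded away from zero on the compact set \<open>W\<close>, the cone does not meet the
rays in the directions of \<open>W\<close>.
\<close>

lemma transverse_cone:
  assumes B: "\<And>l x. l < ncomp L \<Longrightarrow> \<gamma> l x = z \<Longrightarrow> \<exists>(k, y)\<in>B. l = k \<and> x - y \<in> \<int>"
    and fin: "finite B" and Bz: "\<And>k y. (k, y) \<in> B \<Longrightarrow> k < ncomp L \<and> \<gamma> k y = z"
    and W: "compact W" and tr: "\<And>k y w. (k, y) \<in> B \<Longrightarrow> w \<in> W \<Longrightarrow> det2 (tangent L k y) w \<noteq> 0"
  obtains \<eta> where "0 < \<eta>" "\<And>h w. 0 < h \<Longrightarrow> h < \<eta> \<Longrightarrow> w \<in> W \<Longrightarrow> z + h *\<^sub>R w \<notin> shadow"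
proof -
  obtain M where M: "0 < M" "\<And>w. w \<in> W \<Longrightarrow> norm w \<le> M"
    using compact_imp_bounded[OF W] bounded_pos by metis
  have "\<exists>d>0. \<forall>x h w. \<bar>x - y\<bar> < d \<and> 0 < h \<and> w \<in> W \<longrightarrow> \<gamma> k x \<noteq> z + h *\<^sub>R w" if ky: "(k, y) \<in> B" for k y
  proof (cases "W = {}")
    case True
    then show ?thesis by (intro exI[of _ 1]) auto
  next
    case False
    let ?D = "tangent L k y"
    have k: "k < ncomp L" "\<gamma> k y = z" using Bz[OF ky] by auto
    have "continuous_on W (\<lambda>w. \<bar>det2 ?D w\<bar>)" by (intro continuous_intros)
    then obtain w0 where w0: "w0 \<in> W" "\<And>w. w \<in> W \<Longrightarrow> \<bar>det2 ?D w0\<bar> \<le> \<bar>det2 ?D w\<bar>"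
      using continuous_attains_inf[OF W False] by blast
    define \<mu> where "\<mu> = \<bar>det2 ?D w0\<bar>"
    have \<mu>: "0 < \<mu>" "\<And>w. w \<in> W \<Longrightarrow> \<mu> \<le> \<bar>det2 ?D w\<bar>"
      using tr[OF ky w0(1)] w0 by (auto simp: \<mu>_def)
    have N: "0 < norm ?D" using tangent_nonzero[OF k(1)] by simp
    \<comment> \<open>The first bound makes the distance of the branch parameter from \<open>y\<close> at most of order \<open>h\<close>, the
      second makes the deviation from the tangent too small to reach a direction in \<open>W\<close>.\<close>
    define e where "e = min (norm ?D / 2) (\<mu> / (4 * M))"
    have e: "0 < e" "e \<le> norm ?D / 2" "e \<le> \<mu> / (4 * M)" using \<mu> N M by (auto simp: e_def)
    obtain d where d: "0 < d" "\<And>x x'. \<bar>x - y\<bar> < d \<Longrightarrow> \<bar>x' - y\<bar> < d \<Longrightarrow>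
        norm (\<gamma> k x - \<gamma> k x' - (x - x') *\<^sub>R ?D) \<le> e * \<bar>x - x'\<bar>"
      using strict_derivative[OF planar_derivative[OF k(1)] e(1), of y] by blast
    have False if *: "\<bar>x - y\<bar> < d" "0 < h" "w \<in> W" and eq: "\<gamma> k x = z + h *\<^sub>R w" for x h w
    proof -
      let ?s = "x - y" and ?r = "h *\<^sub>R w - (x - y) *\<^sub>R ?D"
      have r: "norm ?r \<le> e * \<bar>?s\<bar>" using d(2)[of x y] * d(1) eq k(2) by simp
      have "\<bar>?s\<bar> * norm ?D = norm (?s *\<^sub>R ?D)" by simp
      also have "\<dots> = norm (h *\<^sub>R w - ?r)" by simp
      also have "\<dots> \<le> h * norm w + norm ?r" using norm_triangle_ineq4[of "h *\<^sub>R w" ?r] *(2) by simp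
      also have "\<dots> \<le> h * M + norm ?D / 2 * \<bar>?s\<bar>"
        using r e(2) M(2)[OF *(3)] *(2) mult_right_mono[OF e(2), of "\<bar>?s\<bar>"] by (intro add_mono mult_left_mono) auto
      finally have s: "\<bar>?s\<bar> * norm ?D \<le> 2 * (h * M)" by (simp add: algebra_simps)
      have "det2 ?D ?r = h * det2 ?D w" by (simp add: det2_simps)
      then have "h * \<mu> \<le> \<bar>det2 ?D ?r\<bar>"
        using \<mu>(2)[OF *(3)] *(2) by (simp add: abs_mult)
      also have "\<dots> \<le> norm ?D * norm ?r" by (rule abs_det2_le)
      also have "\<dots> \<le> norm ?D * (e * \<bar>?s\<bar>)" using r by (intro mult_left_mono) auto
      also have "\<dots> = e * (\<bar>?s\<bar> * norm ?D)" by simp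
      also have "\<dots> \<le> \<mu> / (4 * M) * (2 * (h * M))"
        using s e \<mu>(1) M(1) by (intro mult_mono[of e _ "\<bar>?s\<bar> * norm ?D"]) auto
      also have "\<dots> = h * \<mu> / 2" using M(1) by (simp add: field_simps)
      finally show False using *(2) \<mu>(1) by simp
    qed
    then show ?thesis using d(1) by blast
  qed
  then have "\<exists>d>0. \<forall>x h w. \<bar>x - snd b\<bar> < d \<and> 0 < h \<and> w \<in> W \<longrightarrow> \<gamma> (fst b) x \<noteq> z + h *\<^sub>R w" if "b \<in> B" for b
    using that by (cases b) auto
  then obtain d where d: "\<And>b. b \<in> B \<Longrightarrow> 0 < d b"
      "\<And>b x h w. b \<in> B \<Longrightarrow> \<bar>x - snd b\<bar> < d b \<Longrightarrow> 0 < h \<Longrightarrow> w \<in> W \<Longrightarrow> \<gamma> (fst b) x \<noteq> z + h *\<^sub>R w"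
    by metis
  define \<delta> where "\<delta> = Min (insert 1 (d ` B))"
  have "0 < \<delta>" unfolding \<delta>_def using d(1) fin by (subst Min_gr_iff) auto
  obtain \<eta> where \<eta>: "0 < \<eta>"
    "\<And>q. q \<in> shadow \<Longrightarrow> dist z q < \<eta> \<Longrightarrow> \<exists>(k, y)\<in>B. \<exists>x. k < ncomp L \<and> \<bar>x - y\<bar> < \<delta> \<and> q = \<gamma> k x"
    using localize[of z B, OF B \<open>0 < \<delta>\<close>] by blast
  have "z + h *\<^sub>R w \<notin> shadow" if "0 < h" "h < \<eta> / M" "w \<in> W" for h w
  proof
    assume "z + h *\<^sub>R w \<in> shadow"
    moreover have "dist z (z + h *\<^sub>R w) < \<eta>"
    proof -
      have "dist z (z + h *\<^sub>R w) = h * norm w" using that by (simp add: dist_norm)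
      also have "\<dots> \<le> h * M" using that M by (intro mult_left_mono) auto
      also have "\<dots> < \<eta>" using that(2) M(1) by (simp add: field_simps)
      finally show ?thesis .
    qed
    ultimately have "\<exists>(k, y)\<in>B. \<exists>x. k < ncomp L \<and> \<bar>x - y\<bar> < \<delta> \<and> z + h *\<^sub>R w = \<gamma> k x"
      using \<eta>(2) by blast
    then obtain b x where b: "b \<in> B" "\<bar>x - snd b\<bar> < \<delta>" "z + h *\<^sub>R w = \<gamma> (fst b) x"
      by (auto simp: case_prod_unfold)
    have "\<delta> \<le> d b" unfolding \<delta>_def using fin b(1) by (intro Min_le) auto
    then show False using d(2)[OF b(1), of x h w] b that by auto
  qed
  then show thesis using that[of "\<eta> / M"] \<eta>(1) M(1) by simp
qed

lemma crossing_branches: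
  assumes "i < ncomp L" "j < ncomp L" "\<gamma> i s = z" "\<gamma> j t = z" "strand L i s \<noteq> strand L j t"
    and l: "l < ncomp L" "\<gamma> l x = z"
  shows "\<exists>(k, y)\<in>{(i, s), (j, t)}. l = k \<and> x - y \<in> \<int>"
proof -
  have "strand L l x = strand L i s \<or> strand L l x = strand L j t"
    using no_triple[of "strand L l x" "strand L i s" "strand L j t"] assms in_link by metis
  then show ?thesis using strand_eq assms by auto
qed

lemma regular_branches:
  assumes "k < ncomp L" "strand L k y \<notin> under_points L" "strand L k y \<notin> over_points L"
    and l: "l < ncomp L" "\<gamma> l x = \<gamma> k y"
  shows "\<exists>(k', y')\<in>{(k, y)}. l = k' \<and> x - y' \<in> \<int>"
proof -
  have "strand L k y $ 3 = strand L l x $ 3"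
    using assms in_link unfolding under_points_def over_points_def by force
  moreover have "strand L k y $ 1 = strand L l x $ 1" "strand L k y $ 2 = strand L l x $ 2"
    using arg_cong[OF l(2), of "\<lambda>v. v $ 1"] arg_cong[OF l(2), of "\<lambda>v. v $ 2"] by (auto simp: proj_def)
  ultimately have "strand L l x = strand L k y" by (simp add: vec_eq_iff forall_3)
  then show ?thesis using strand_eq assms by auto
qed

text \<open>
A walk that leaves the strand \<open>j\<close> at parameter distance \<open>u\<close> from the crossing, parallel to the
tangent \<open>p\<close> of the strand \<open>i\<close> and of length at most \<open>u\<close>, stays off the diagram. It cannot meet \<open>j\<close>
again, because \<open>j\<close> moves strictly monotonically transversally to \<open>p\<close>; and it
cannot meet \<open>i\<close>, because its distance to the tangent line of \<open>i\<close> remains of order \<open>u\<close>,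
while \<open>i\<close> deviates from this line only by a small multiple of \<open>u\<close>.
\<close>

lemma strand_side_free:
  assumes i: "i < ncomp L" "j < ncomp L" and z: "\<gamma> i s = z" "\<gamma> j t = z"
    and ne: "strand L i s \<noteq> strand L j t" and ab: "\<bar>a\<bar> = (1::real)" "\<bar>b\<bar> = (1::real)"
  shows "\<exists>\<eta>>0. \<forall>u k. 0 < u \<and> u < \<eta> \<and> 0 < k \<and> k \<le> u \<longrightarrow>
           \<gamma> j (t + b * u) + (k * a) *\<^sub>R tangent L i s \<notin> shadow"
proof -
  let ?p = "tangent L i s" and ?q = "tangent L j t"
  let ?N = "norm ?p + norm ?q"
  have D: "\<bar>det2 ?p ?q\<bar> > 0" using transverse[OF i] z ne by simp
  have np: "norm ?p > 0" "norm ?q > 0" using tangent_nonzero i by auto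
  \<comment> \<open>With this constant every deviation contributes at most a quarter of the determinant; a meeting
    with the strand \<open>i\<close> would give \<open>3 u \<le> \<bar>x - s\<bar>\<close> as well as \<open>3 \<bar>x - s\<bar> \<le> 5 u\<close>.\<close>
  define e where "e = \<bar>det2 ?p ?q\<bar> / (4 * ?N)"
  have e: "0 < e" unfolding e_def using D np by (intro divide_pos_pos mult_pos_pos add_pos_pos) auto
  have small: "\<bar>det2 w r\<bar> \<le> \<bar>det2 ?p ?q\<bar> / 4 * c" if "w = ?p \<or> w = ?q" "norm r \<le> e * c" for w r c
  proof -
    have c: "0 \<le> c" using order_trans[OF norm_ge_zero that(2)] e by (simp add: zero_le_mult_iff)
    have "\<bar>det2 w r\<bar> \<le> norm w * norm r" by (rule abs_det2_le)
    also have "\<dots> \<le> ?N * (e * c)" using that np by (intro mult_mono) auto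
    also have "?N * (e * c) = (?N * e) * c" by simp
    also have "?N * e = \<bar>det2 ?p ?q\<bar> / 4"
    proof -
      have "N * (D / (4 * N)) = D / 4" if "0 < N" for N D :: real using that by simp
      from this[OF add_pos_pos[OF np]] show ?thesis by (simp only: e_def)
    qed
    finally show ?thesis .
  qed
  obtain d1 where d1: "0 < d1" "\<And>x x'. \<bar>x - s\<bar> < d1 \<Longrightarrow> \<bar>x' - s\<bar> < d1 \<Longrightarrow>
      norm (\<gamma> i x - \<gamma> i x' - (x - x') *\<^sub>R ?p) \<le> e * \<bar>x - x'\<bar>"
    using strict_derivative[OF planar_derivative[OF i(1)] e, of s] by blast
  obtain d2 where d2: "0 < d2" "\<And>x x'. \<bar>x - t\<bar> < d2 \<Longrightarrow> \<bar>x' - t\<bar> < d2 \<Longrightarrow>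
      norm (\<gamma> j x - \<gamma> j x' - (x - x') *\<^sub>R ?q) \<le> e * \<bar>x - x'\<bar>"
    using strict_derivative[OF planar_derivative[OF i(2)] e, of t] by blast
  define \<delta> where "\<delta> = min d1 d2"
  have \<delta>: "0 < \<delta>" "\<delta> \<le> d1" "\<delta> \<le> d2" using d1 d2 by (auto simp: \<delta>_def)
  obtain \<eta> where \<eta>: "0 < \<eta>" "\<And>y. y \<in> shadow \<Longrightarrow> dist z y < \<eta> \<Longrightarrow>
      \<exists>(k, x)\<in>{(i, s), (j, t)}. \<exists>x'. k < ncomp L \<and> \<bar>x' - x\<bar> < \<delta> \<and> y = \<gamma> k x'"
    using localize[of z, OF crossing_branches[OF i z ne] \<delta>(1)] by blast
  let ?\<epsilon> = "min \<delta> (\<eta> / (e + ?N))"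
  have "\<gamma> j (t + b * u) + (k * a) *\<^sub>R ?p \<notin> shadow" if u: "0 < u" "u < ?\<epsilon>" and k: "0 < k" "k \<le> u" for u k
  proof
    let ?y = "\<gamma> j (t + b * u) + (k * a) *\<^sub>R ?p"
    assume y: "?y \<in> shadow"
    have bu: "\<bar>b * u\<bar> = u" "\<bar>k * a\<bar> = k" using ab u k by (auto simp: abs_mult)
    define r where "r = \<gamma> j (t + b * u) - z - (b * u) *\<^sub>R ?q"
    have r: "norm r \<le> e * u"
      using d2(2)[of "t + b * u" t] d2(1) u \<delta> bu z by (auto simp: r_def)
    have yz: "?y - z = r + (b * u) *\<^sub>R ?q + (k * a) *\<^sub>R ?p" by (simp add: r_def)
    have "dist z ?y < \<eta>"
    proof -
      have "dist z ?y = norm (r + (b * u) *\<^sub>R ?q + (k * a) *\<^sub>R ?p)"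
        unfolding yz[symmetric] by (simp add: dist_norm norm_minus_commute)
      also have "\<dots> \<le> norm r + u * norm ?q + k * norm ?p"
        using norm_triangle_ineq[of "r + (b * u) *\<^sub>R ?q" "(k * a) *\<^sub>R ?p"]
          norm_triangle_ineq[of r "(b * u) *\<^sub>R ?q"] bu by simp
      also have "\<dots> \<le> e * u + u * norm ?q + u * norm ?p"
        using r k by (intro add_mono mult_right_mono) auto
      also have "\<dots> = (e + ?N) * u" by (simp add: algebra_simps)
      also have "\<dots> < \<eta>" using u e np by (simp add: field_simps add_pos_pos)
      finally show ?thesis .
    qed
    then consider x where "\<bar>x - s\<bar> < \<delta>" "?y = \<gamma> i x" | x where "\<bar>x - t\<bar> < \<delta>" "?y = \<gamma> j x"
      using \<eta>(2)[OF y] by auto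
    then show False
    proof cases
      case 1
      define r' where "r' = \<gamma> i x - z - (x - s) *\<^sub>R ?p"
      have r': "norm r' \<le> e * \<bar>x - s\<bar>" using d1(2)[of x s] 1(1) d1(1) \<delta> z by (auto simp: r'_def)
      have eq: "r' + (x - s) *\<^sub>R ?p = r + (b * u) *\<^sub>R ?q + (k * a) *\<^sub>R ?p"
        using yz 1(2) by (simp add: r'_def)
      let ?D = "\<bar>det2 ?p ?q\<bar>"
      have "det2 ?p r' = det2 ?p r + (b * u) * det2 ?p ?q"
        using arg_cong[OF eq, of "det2 ?p"] by (simp add: det2_simps)
      moreover have "\<bar>(b * u) * det2 ?p ?q\<bar> = u * ?D" using bu by (simp add: abs_mult)
      ultimately have "u * ?D \<le> ?D / 4 * \<bar>x - s\<bar> + ?D / 4 * u"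
        using small[OF disjI1[OF refl] r] small[OF disjI1[OF refl] r'] by linarith
      then have "?D * (3 * u) \<le> ?D * \<bar>x - s\<bar>" by (simp add: algebra_simps)
      then have 3: "3 * u \<le> \<bar>x - s\<bar>" using D by simp
      have "det2 ?q r' + (x - s) * det2 ?q ?p = det2 ?q r + (k * a) * det2 ?q ?p"
        using arg_cong[OF eq, of "det2 ?q"] by (simp add: det2_simps)
      moreover have "\<bar>(k * a) * det2 ?q ?p\<bar> = k * ?D" "\<bar>(x - s) * det2 ?q ?p\<bar> = \<bar>x - s\<bar> * ?D"
        using bu by (simp_all add: abs_mult det2_commute[of ?q])
      moreover have "k * ?D \<le> u * ?D" using k by (intro mult_right_mono) auto
      ultimately have "\<bar>x - s\<bar> * ?D \<le> ?D / 4 * \<bar>x - s\<bar> + ?D / 4 * u + u * ?D"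
        using small[OF disjI2[OF refl] r] small[OF disjI2[OF refl] r'] by linarith
      then have "?D * (3 * \<bar>x - s\<bar>) \<le> ?D * (5 * u)" by (simp add: algebra_simps)
      then have "3 * \<bar>x - s\<bar> \<le> 5 * u" using D by simp
      with 3 u show False by simp
    next
      case 2
      let ?x = "x - (t + b * u)"
      define r' where "r' = \<gamma> j x - \<gamma> j (t + b * u) - ?x *\<^sub>R ?q"
      have r': "norm r' \<le> e * \<bar>?x\<bar>"
        using d2(2)[of x "t + b * u"] 2(1) u bu \<delta> by (auto simp: r'_def)
      have eq: "r' = (k * a) *\<^sub>R ?p - ?x *\<^sub>R ?q" using 2(2) by (simp add: r'_def algebra_simps)
      have "det2 ?p r' = - (?x * det2 ?p ?q)" using eq by (simp add: det2_simps)
      then have "\<bar>det2 ?p r'\<bar> = \<bar>?x\<bar> * \<bar>det2 ?p ?q\<bar>" by (simp only: abs_minus_cancel abs_mult)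
      then have "\<bar>?x\<bar> * \<bar>det2 ?p ?q\<bar> \<le> \<bar>det2 ?p ?q\<bar> / 4 * \<bar>?x\<bar>"
        using small[OF disjI1[OF refl] r'] by (simp only:)
      then have "\<bar>det2 ?p ?q\<bar> * (3 * \<bar>?x\<bar>) \<le> 0" by (simp add: algebra_simps)
      then have "?x = 0" using D by (simp add: mult_le_0_iff)
      then have "r' = 0" using r' by simp
      then have "(k * a) *\<^sub>R ?p = 0" using eq \<open>?x = 0\<close> by simp
      with bu k np show False by auto
    qed
  qed
  moreover have "0 < ?\<epsilon>" using \<delta> \<eta> e np by (simp add: add_pos_pos)
  ultimately show ?thesis by blast
qed

section \<open>Regions around a point\<close>

lemma same_region:
  assumes "connected S" "S \<inter> shadow = {}" "x \<in> S" "y \<in> S" "R \<in> regions L" "x \<in> R"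
  shows "y \<in> R"
proof -
  have "S \<subseteq> R"
    using assms by (intro components_maximal[of R "- shadow"]) (auto simp: regions_eq)
  then show ?thesis using assms by blast
qed

lemma runs_into_unique:
  assumes "R1 \<in> regions L" "R2 \<in> regions L" "runs_into c v R1" "runs_into c v R2"
  shows "R1 = R2"
proof -
  have "\<forall>\<^sub>F h in at_right 0. c + h *\<^sub>R v \<in> R1 \<and> c + h *\<^sub>R v \<in> R2"
    using assms(3,4) unfolding runs_into_def by (rule eventually_conj)
  then obtain h where "c + h *\<^sub>R v \<in> R1" "c + h *\<^sub>R v \<in> R2"
    using eventually_happens'[OF trivial_limit_at_right_real] by blast
  then show ?thesis using components_eq[of R1 "- shadow" R2] assms(1,2) by (auto simp: regions_eq)
qed

text \<open>
The union of the short pieces of the rays given by \<open>transverse_cone\<close> is connected, being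
an image of a product of connected sets.
\<close>

lemma transverse_sector:
  assumes B: "\<And>l x. l < ncomp L \<Longrightarrow> \<gamma> l x = z \<Longrightarrow> \<exists>(k, y)\<in>B. l = k \<and> x - y \<in> \<int>"
    and fin: "finite B" and Bz: "\<And>k y. (k, y) \<in> B \<Longrightarrow> k < ncomp L \<and> \<gamma> k y = z"
    and W: "compact W" "convex W" "W \<noteq> {}"
    and tr: "\<And>k y w. (k, y) \<in> B \<Longrightarrow> w \<in> W \<Longrightarrow> det2 (tangent L k y) w \<noteq> 0"
  obtains R \<eta> where "R \<in> regions L" "0 < \<eta>" "\<And>h w. 0 < h \<Longrightarrow> h < \<eta> \<Longrightarrow> w \<in> W \<Longrightarrow> z + h *\<^sub>R w \<in> R"
proof -
  obtain \<eta> where \<eta>: "0 < \<eta>" "\<And>h w. 0 < h \<Longrightarrow> h < \<eta> \<Longrightarrow> w \<in> W \<Longrightarrow> z + h *\<^sub>R w \<notin> shadow"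
    using transverse_cone[OF B fin Bz W(1) tr] by blast
  define S where "S = (\<lambda>(h, w). z + h *\<^sub>R w) ` ({0<..<\<eta>} \<times> W)"
  have S: "connected S" unfolding S_def
    by (intro connected_continuous_image connected_Times convex_connected W)
       (auto intro!: continuous_intros simp: case_prod_unfold)
  have "x \<notin> shadow" if xS: "x \<in> S" for x
  proof -
    obtain h w where "x = z + h *\<^sub>R w" "0 < h" "h < \<eta>" "w \<in> W" using xS by (auto simp: S_def)
    then show ?thesis using \<eta>(2)[of h w] by (simp only: simp_thms)
  qed
  then have Sfree: "S \<inter> shadow = {}" by blast
  obtain w where "w \<in> W" using W by blast
  have S_in: "z + h *\<^sub>R w' \<in> S" if "0 < h" "h < \<eta>" "w' \<in> W" for h w'
    unfolding S_def using that by (intro image_eqI[of _ _ "(h, w')"]) auto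
  then have w: "z + (\<eta> / 2) *\<^sub>R w \<in> S" using \<eta>(1) \<open>w \<in> W\<close> by simp
  then have "z + (\<eta> / 2) *\<^sub>R w \<in> - shadow" using Sfree by (metis ComplI IntI empty_iff)
  moreover have "\<Union> (regions L) = - shadow" unfolding regions_eq by (rule Union_components)
  ultimately have "z + (\<eta> / 2) *\<^sub>R w \<in> \<Union> (regions L)" by (simp only:)
  then obtain R where "R \<in> regions L" "z + (\<eta> / 2) *\<^sub>R w \<in> R" by blast
  then have "z + h *\<^sub>R w' \<in> R" if "0 < h" "h < \<eta>" "w' \<in> W" for h w'
    using same_region[OF S Sfree w S_in[OF that]] by blast
  then show thesis using that \<open>R \<in> regions L\<close> \<eta>(1) by blast
qed

lemma runs_intoI: "0 < \<eta> \<Longrightarrow> (\<And>h. 0 < h \<Longrightarrow> h < \<eta> \<Longrightarrow> c + h *\<^sub>R v \<in> R) \<Longrightarrow> runs_into c v R"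
  unfolding runs_into_def eventually_at_right_field by blast

text \<open>
A whole ball of directions around \<open>v\<close> is needed below, since the walks of
\<open>strand_side_free\<close> end near the ray through \<open>v\<close> but not on it.
\<close>

lemma crossing_sector:
  assumes i: "i < ncomp L" "j < ncomp L" and z: "\<gamma> i s = z" "\<gamma> j t = z"
    and ne: "strand L i s \<noteq> strand L j t"
    and tr: "det2 (tangent L i s) v \<noteq> 0" "det2 (tangent L j t) v \<noteq> 0"
  obtains R \<rho> \<eta> where "R \<in> regions L" "0 < \<eta>" "0 < \<rho>"
    "\<And>h w. 0 < h \<Longrightarrow> h < \<eta> \<Longrightarrow> dist v w \<le> \<rho> \<Longrightarrow> z + h *\<^sub>R w \<in> R"
proof -
  let ?U = "{w. det2 (tangent L i s) w \<noteq> 0} \<inter> {w. det2 (tangent L j t) w \<noteq> 0}"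
  have "open ?U"
    by (intro open_Int open_Collect_neq continuous_intros)
  then obtain \<rho> where \<rho>: "0 < \<rho>" "cball v \<rho> \<subseteq> ?U" using tr open_contains_cball by blast
  obtain R \<eta> where "R \<in> regions L" "0 < \<eta>" "\<And>h w. 0 < h \<Longrightarrow> h < \<eta> \<Longrightarrow> w \<in> cball v \<rho> \<Longrightarrow> z + h *\<^sub>R w \<in> R"
  proof (rule transverse_sector[of z "{(i, s), (j, t)}" "cball v \<rho>"])
    show "\<exists>(k, y)\<in>{(i, s), (j, t)}. l = k \<and> x - y \<in> \<int>" if "l < ncomp L" "\<gamma> l x = z" for l x
      using crossing_branches[OF i z ne that] .
    show "det2 (tangent L k y) w \<noteq> 0" if "(k, y) \<in> {(i, s), (j, t)}" "w \<in> cball v \<rho>" for k y w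
      using that \<rho>(2) by blast
    show "k < ncomp L \<and> \<gamma> k y = z" if "(k, y) \<in> {(i, s), (j, t)}" for k y using that i z by auto
  qed (use \<rho>(1) in auto)
  then show thesis using that[of R \<eta> \<rho>] \<rho>(1) by simp
qed

text \<open>
The sign of \<open>c\<close> selects a side of the strand. The segment between two directions on this side
is transverse to the strand, so the normal may be replaced by any other
direction on the same side.
\<close>

lemma regular_sector:
  assumes j: "j < ncomp L" and reg: "strand L j t \<notin> under_points L" "strand L j t \<notin> over_points L"
    and tr: "0 < c * det2 (tangent L j t) w1" "0 < c * det2 (tangent L j t) w2"
  obtains R where "R \<in> regions L" "runs_into (\<gamma> j t) w1 R" "runs_into (\<gamma> j t) w2 R"
proof -
  let ?W = "closed_segment w1 w2"
  obtain R \<eta> where R: "R \<in> regions L" "0 < \<eta>" "\<And>h w. 0 < h \<Longrightarrow> h < \<eta> \<Longrightarrow> w \<in> ?W \<Longrightarrow> \<gamma> j t + h *\<^sub>R w \<in> R"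
  proof (rule transverse_sector[of "\<gamma> j t" "{(j, t)}" ?W])
    show "\<exists>(k, y)\<in>{(j, t)}. l = k \<and> x - y \<in> \<int>" if "l < ncomp L" "\<gamma> l x = \<gamma> j t" for l x
      using regular_branches[OF j reg that] .
    show "det2 (tangent L k y) w \<noteq> 0" if ky: "(k, y) \<in> {(j, t)}" and w: "w \<in> ?W" for k y w
    proof -
      obtain u where u: "0 \<le> u" "u \<le> 1" "w = (1 - u) *\<^sub>R w1 + u *\<^sub>R w2"
        using w by (auto simp: closed_segment_def)
      have "c * det2 (tangent L j t) w = (1 - u) * (c * det2 (tangent L j t) w1) + u * (c * det2 (tangent L j t) w2)"
        by (simp add: u det2_simps algebra_simps)
      also have "\<dots> > 0"
        using u tr by (cases "u = 1") (auto intro!: add_pos_nonneg)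
      finally show ?thesis using ky by auto
    qed
  qed (use j in auto)
  have "runs_into (\<gamma> j t) w R" if "w \<in> ?W" for w
    using R that by (intro runs_intoI[of \<eta>]) auto
  then show thesis using that R(1) by blast
qed

lemma eventually_strand_avoids:
  assumes i: "i < ncomp L" and F: "finite F"
  shows "\<forall>\<^sub>F x in at s. strand L i x \<notin> F"
proof -
  have "\<forall>\<^sub>F x in at s. strand L i x \<noteq> p" for p
  proof (cases "p = strand L i s")
    case True
    have "\<forall>\<^sub>F x in at s. x \<noteq> s \<and> x \<in> ball s 1"
      unfolding eventually_at by (intro exI[of _ 1]) (auto simp: dist_commute)
    then show ?thesis
    proof (rule eventually_mono)
      fix x assume x: "x \<noteq> s \<and> x \<in> ball s 1"
      have "x - s \<notin> \<int>"
      proof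
        assume "x - s \<in> \<int>"
        then obtain m where m: "x - s = of_int m" by (auto elim: Ints_cases)
        then show False using x by (cases "m = 0") (auto simp: dist_real_def)
      qed
      then show "strand L i x \<noteq> p" using True strand_eq[OF i i] by simp
    qed
  next
    case False
    have "(strand L i \<longlongrightarrow> strand L i s) (at s)"
      using strand_cont[OF i, of UNIV] by (simp add: continuous_on_def)
    from tendsto_imp_eventually_ne[OF this] show ?thesis using False by simp
  qed
  then have "\<forall>\<^sub>F x in at s. \<forall>p\<in>F. strand L i x \<noteq> p"
    using F by (intro eventually_ball_finite) auto
  then show ?thesis by (rule eventually_mono) blast
qed

lemma eventually_at_shift:
  assumes "\<forall>\<^sub>F x in at (s::real). Q x"
  shows "\<forall>\<^sub>F h in at_right 0. Q (s + sval e * h)"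
proof -
  obtain d where d: "0 < d" "\<And>x. x \<noteq> s \<Longrightarrow> dist x s < d \<Longrightarrow> Q x"
    using assms unfolding eventually_at by blast
  have "Q (s + sval e * h)" if "0 < h" "h < d" for h
    using that d(2)[of "s + sval e * h"] by (cases e) (auto simp: dist_real_def)
  then show ?thesis unfolding eventually_at_right_field using d(1) by blast
qed

text \<open>
From a point of the strand \<open>j\<close> at parameter distance \<open>u\<close> from the crossing, walk the length \<open>u\<close>
in the direction of the end \<open>a\<close> of the other strand. By \<open>strand_side_free\<close> the walk stays in one
region, and it ends close to the ray in the direction of the quadrant, so this region is \<open>R\<close>.
The walk starts on the side of the normal, and \<open>regular_sector\<close> identifies its region
with the one into which the normal points.
\<close>

lemma quadrant_side:
  assumes i: "i < ncomp L" "j < ncomp L" and z: "\<gamma> i s = z" "\<gamma> j t = z"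
    and ne: "strand L i s \<noteq> strand L j t"
    and R: "R \<in> regions L" "runs_into z (sval a *\<^sub>R tangent L i s + sval b *\<^sub>R tangent L j t) R"
    and side: "(sval a *\<^sub>R tangent L i s) \<bullet> normal_vec L j t e > 0"
  shows "\<forall>\<^sub>F u in at_right 0. runs_into (\<gamma> j (t + sval b * u)) (normal_vec L j (t + sval b * u) e) R"
proof -
  let ?p = "tangent L i s" and ?q = "tangent L j t"
  let ?v = "sval a *\<^sub>R ?p + sval b *\<^sub>R ?q"
  have "det2 ?p ?q \<noteq> 0" using transverse[OF i _ ne] z by simp
  then have "det2 ?p ?v \<noteq> 0" "det2 ?q ?v \<noteq> 0"
    using det2_commute[of ?p ?q] by (cases a; cases b; auto simp: det2_simps)+
  then obtain R' \<rho> \<eta> where R': "R' \<in> regions L" "0 < \<eta>" "0 < \<rho>"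
    "\<And>h w. 0 < h \<Longrightarrow> h < \<eta> \<Longrightarrow> dist ?v w \<le> \<rho> \<Longrightarrow> z + h *\<^sub>R w \<in> R'"
  proof -
    assume "det2 ?p ?v \<noteq> 0" "det2 ?q ?v \<noteq> 0"
    from crossing_sector[OF i z ne this] show thesis using that by metis
  qed
  have "runs_into z ?v R'" using R' by (intro runs_intoI[of \<eta>]) auto
  then have "R' = R" using runs_into_unique R R'(1) by blast
  note R' = R'[unfolded this]
  obtain \<eta>2 where \<eta>2: "0 < \<eta>2"
    "\<And>u k. 0 < u \<Longrightarrow> u < \<eta>2 \<Longrightarrow> 0 < k \<Longrightarrow> k \<le> u \<Longrightarrow> \<gamma> j (t + sval b * u) + (k * sval a) *\<^sub>R ?p \<notin> shadow"
  proof -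
    have "\<bar>sval a\<bar> = (1::real)" "\<bar>sval b\<bar> = (1::real)" by (cases a; cases b; simp)+
    from strand_side_free[OF i z ne this] show thesis using that by blast
  qed
  obtain d where d: "0 < d" "\<And>x x'. \<bar>x - t\<bar> < d \<Longrightarrow> \<bar>x' - t\<bar> < d \<Longrightarrow>
      norm (\<gamma> j x - \<gamma> j x' - (x - x') *\<^sub>R ?q) \<le> \<rho> * \<bar>x - x'\<bar>"
    using strict_derivative[OF planar_derivative[OF i(2)] R'(3), of t] by blast
  have side': "0 < sval e * det2 ?q (sval a *\<^sub>R ?p)" using side by (simp add: normal_vec_inner)
  have "continuous_on UNIV (\<lambda>x. sval e * det2 (tangent L j x) (sval a *\<^sub>R ?p))"
    by (intro continuous_intros planar_derivative(2) i)
  then have "((\<lambda>x. sval e * det2 (tangent L j x) (sval a *\<^sub>R ?p)) \<longlongrightarrow> sval e * det2 ?q (sval a *\<^sub>R ?p)) (at t)"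
    by (simp add: continuous_on_def)
  from order_tendstoD(1)[OF this side']
  have "\<forall>\<^sub>F x in at t. 0 < sval e * det2 (tangent L j x) (sval a *\<^sub>R ?p)" .
  moreover have "\<forall>\<^sub>F x in at t. strand L j x \<notin> under_points L \<union> over_points L"
    using i finite_under finite_over by (intro eventually_strand_avoids) auto
  ultimately have "\<forall>\<^sub>F x in at t. 0 < sval e * det2 (tangent L j x) (sval a *\<^sub>R ?p) \<and>
      strand L j x \<notin> under_points L \<union> over_points L" by (rule eventually_conj)
  note ev = eventually_at_shift[OF this, of b]
  have "\<forall>\<^sub>F u in at_right 0. 0 < u \<and> u < min (min \<eta> \<eta>2) d"
    unfolding eventually_at_right_field using R'(2) \<eta>2(1) d(1) by (intro exI[of _ "min (min \<eta> \<eta>2) d"]) auto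
  with ev show ?thesis
  proof eventually_elim
    case (elim u)
    let ?x = "t + sval b * u" and ?n = "normal_vec L j (t + sval b * u) e"
    let ?y = "\<gamma> j ?x"
    let ?d = "tangent L j ?x"
    have u: "0 < u" "u < \<eta>" "u < \<eta>2" "u < d" using elim by auto
    have "?d \<bullet> ?d > 0" using tangent_nonzero[OF i(2)] by simp
    then have "0 < det2 ?d (rot90 ?d)" by (simp add: rot90_inner[symmetric] det2_def rot90_def inner_vec_def sum_2)
    then have n: "0 < sval e * det2 ?d ?n"
      by (cases e) (auto simp: normal_vec_def rot90_def det2_def)
    obtain R1 where R1: "R1 \<in> regions L" "runs_into ?y (sval a *\<^sub>R ?p) R1" "runs_into ?y ?n R1"
      using regular_sector[OF i(2), of ?x "sval e" "sval a *\<^sub>R ?p" ?n] elim n by auto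
    define S where "S = (\<lambda>k. ?y + (k * sval a) *\<^sub>R ?p) ` {0<..u}"
    have S: "connected S" unfolding S_def
      by (intro connected_continuous_image) (auto intro!: continuous_intros)
    have "x \<notin> shadow" if "x \<in> S" for x
    proof -
      have "\<exists>k\<in>{0<..u}. x = ?y + (k * sval a) *\<^sub>R ?p" using that unfolding S_def by blast
      then obtain k where "0 < k" "k \<le> u" and x: "x = ?y + (k * sval a) *\<^sub>R ?p" by auto
      then show ?thesis unfolding x using \<eta>2(2)[OF u(1,3)] by blast
    qed
    then have Sfree: "S \<inter> shadow = {}" by blast
    have "\<forall>\<^sub>F h in at_right 0. ?y + h *\<^sub>R sval a *\<^sub>R ?p \<in> R1 \<and> 0 < h \<and> h < u"
      using R1(2) u(1) unfolding runs_into_def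
      by (intro eventually_conj) (auto simp: eventually_at_right_field intro: exI[of _ u])
    then obtain h where h: "?y + h *\<^sub>R sval a *\<^sub>R ?p \<in> R1" "0 < h" "h < u"
      using eventually_happens'[OF trivial_limit_at_right_real] by blast
    \<comment> \<open>The walk ends at \<open>z + u ?w\<close>, and \<open>?w\<close> tends to \<open>?v\<close> with \<open>u\<close>.\<close>
    let ?w = "(1 / u) *\<^sub>R (?y - z) + sval a *\<^sub>R ?p"
    have "norm (?y - z - (sval b * u) *\<^sub>R ?q) \<le> \<rho> * u"
      using d(2)[of ?x t] u d(1) z by (cases b) auto
    then have "(1 / u) * norm (?y - z - (sval b * u) *\<^sub>R ?q) \<le> \<rho>"
      using u(1) by (simp add: field_simps)
    moreover have "?w - ?v = (1 / u) *\<^sub>R (?y - z - (sval b * u) *\<^sub>R ?q)"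
      using u(1) by (simp add: scaleR_diff_right)
    ultimately have "norm (?w - ?v) \<le> \<rho>" using u(1) by simp
    then have "dist ?v ?w \<le> \<rho>" by (metis dist_commute dist_norm)
    then have "z + u *\<^sub>R ?w \<in> R" using R'(4) u by blast
    moreover have "z + u *\<^sub>R ?w = ?y + (u * sval a) *\<^sub>R ?p"
      using u(1) by (simp add: scaleR_add_right)
    ultimately have tip: "?y + (u * sval a) *\<^sub>R ?p \<in> R" by simp
    have "?y + (h * sval a) *\<^sub>R ?p \<in> R"
      using h(2,3) u(1) by (intro same_region[OF S Sfree _ _ R(1) tip]) (auto simp: S_def)
    then have "R1 = R" using h(1) R(1) R1(1) components_eq[of R1 "- shadow" R] by (auto simp: regions_eq)
    then show ?case using R1(3) by simp
  qed
qed

end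

section \<open>Arcs and semi-arcs\<close>

text \<open>
The preimage of \<open>A\<close> in the interval may be disconnected, namely when \<open>A\<close> is a piece of a closed
curve that contains its base point; therefore the separation argument takes place in
the image. There both level sets are relatively closed, because \<open>f\<close> maps compact sets
to compact sets.
\<close>

lemma locally_constant_along_loop:
  fixes f :: "real \<Rightarrow> 'a::t2_space"
  assumes f: "continuous_on {0..1} f" and A: "connected A" "A \<subseteq> f ` {0..1}"
    and inv: "\<And>s t. f s \<in> A \<Longrightarrow> f s = f t \<Longrightarrow> Q s \<longleftrightarrow> Q t"
    and loc: "\<And>s. f s \<in> A \<Longrightarrow> \<forall>\<^sub>F t in at s. Q t \<longleftrightarrow> Q s"
    and st: "f s \<in> A" "f t \<in> A"
  shows "Q s \<longleftrightarrow> Q t"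
proof -
  \<comment> \<open>The closures are compact, so their images are closed; by local constancy they contain no new
    parameter of a point of \<open>A\<close>.\<close>
  define K where "K V = closure {u \<in> {0..1}. f u \<in> A \<and> (Q u \<longleftrightarrow> V)}" for V
  have K01: "K V \<subseteq> {0..1}" for V
    unfolding K_def by (rule closure_minimal) auto
  have "compact (K V)" for V
    using K01[of V] unfolding K_def by (intro compact_closure[THEN iffD2]) (rule bounded_subset[of "{0..1}"], auto)
  then have closed: "closed (f ` K V)" for V
    using K01 f by (intro compact_imp_closed compact_continuous_image continuous_on_subset[OF f])
  have KQ: "Q u \<longleftrightarrow> V" if u: "u \<in> K V" "f u \<in> A" for u V
  proof -
    obtain d where d: "0 < d" "\<And>t. t \<noteq> u \<Longrightarrow> dist t u < d \<Longrightarrow> Q t \<longleftrightarrow> Q u"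
      using loc[OF u(2)] unfolding eventually_at by blast
    obtain t where "dist t u < d" "Q t \<longleftrightarrow> V"
      using u(1) d(1) unfolding K_def closure_approachable by blast
    then show ?thesis using d(2)[of t] by auto
  qed
  have cover: "u \<in> {0..1} \<Longrightarrow> f u \<in> A \<Longrightarrow> u \<in> K (Q u)" for u
    unfolding K_def by (rule closure_subset[THEN subsetD]) auto
  have "\<not> (f ` K True \<inter> A \<noteq> {} \<and> f ` K False \<inter> A \<noteq> {})"
  proof -
    have "f ` K True \<inter> f ` K False \<inter> A = {}"
    proof -
      have False if "u \<in> K True" "t \<in> K False" "f u = f t" "f u \<in> A" for u t
        using KQ[OF that(1,4)] KQ[OF that(2)] inv[of u t] that by simp
      then show ?thesis by (force simp: image_iff)
    qed
    moreover have "A \<subseteq> f ` K True \<union> f ` K False"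
    proof
      fix x assume x: "x \<in> A"
      then obtain u where "u \<in> {0..1}" "x = f u" using A(2) by blast
      then show "x \<in> f ` K True \<union> f ` K False" using cover[of u] x by (cases "Q u") auto
    qed
    ultimately show ?thesis
      using connected_closedD[OF A(1) _ _ closed[of True] closed[of False]] by blast
  qed
  moreover have "f ` K (Q u) \<inter> A \<noteq> {}" if uA: "f u \<in> A" for u
  proof -
    obtain u' where u': "u' \<in> {0..1}" "f u' = f u" using uA A(2) by (metis imageE subsetD)
    then have "Q u' \<longleftrightarrow> Q u" using inv[of u' u] uA by simp
    then show ?thesis using cover[of u'] u' uA by auto
  qed
  ultimately show ?thesis using st by (cases "Q s"; cases "Q t") fastforce+
qed

context diagram begin

definition pieces where "pieces F = components (link_points L - F)"

lemma arcs_pieces: "arcs L = pieces (under_points L)"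
  by (simp add: arcs_def pieces_def)

lemma semi_arcs_pieces: "semi_arcs L = pieces (under_points L \<union> over_points L)"
  by (simp add: semi_arcs_def pieces_def Diff_Un Diff_Diff_Int set_diff_eq conj_assoc)

lemma finite_cuts: "finite (under_points L \<union> over_points L)"
  using finite_under finite_over by simp

lemma pieces_disjoint: "A \<in> pieces F \<Longrightarrow> B \<in> pieces F \<Longrightarrow> p \<in> A \<Longrightarrow> p \<in> B \<Longrightarrow> A = B"
  unfolding pieces_def using components_eq by blast

lemma pieces_in: "A \<in> pieces F \<Longrightarrow> A \<subseteq> link_points L - F" "A \<in> pieces F \<Longrightarrow> A \<noteq> {}" "A \<in> pieces F \<Longrightarrow> connected A"
  unfolding pieces_def using in_components_subset in_components_nonempty in_components_connected by blast+

lemma pieces_cover: "p \<in> link_points L - F \<Longrightarrow> \<exists>A\<in>pieces F. p \<in> A"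
  unfolding pieces_def by (metis UnionE Union_components)

lemma connected_in_piece:
  assumes "connected S" "S \<subseteq> link_points L - F" "A \<in> pieces F" "p \<in> S" "p \<in> A"
  shows "S \<subseteq> A"
  using assms unfolding pieces_def by (intro components_maximal[of A "link_points L - F"]) auto

lemma end_eqI:
  assumes "A \<in> pieces F" "\<forall>\<^sub>F h in at_right 0. strand L i (s + sval e * h) \<in> A"
  shows "end_at L (pieces F) i s e = A"
  unfolding end_at_def
proof (rule the_equality)
  fix B assume B: "B \<in> pieces F \<and> (\<forall>\<^sub>F h in at_right 0. strand L i (s + sval e * h) \<in> B)"
  then have "\<forall>\<^sub>F h in at_right 0. strand L i (s + sval e * h) \<in> B \<and> strand L i (s + sval e * h) \<in> A"
    using assms(2) by (intro eventually_conj) auto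
  then obtain h where "strand L i (s + sval e * h) \<in> B" "strand L i (s + sval e * h) \<in> A"
    using eventually_happens'[OF trivial_limit_at_right_real] by blast
  then show "B = A" using pieces_disjoint assms(1) B by blast
qed (use assms in blast)

lemma end_in:
  assumes i: "i < ncomp L" and F: "finite F"
  shows "end_at L (pieces F) i s e \<in> pieces F" (is ?A)
    and "\<forall>\<^sub>F h in at_right 0. strand L i (s + sval e * h) \<in> end_at L (pieces F) i s e" (is ?B)
proof -
  obtain d where d: "0 < d" "\<And>h. 0 < h \<Longrightarrow> h < d \<Longrightarrow> strand L i (s + sval e * h) \<notin> F"
    using eventually_at_shift[OF eventually_strand_avoids[OF i F], of s e]
    unfolding eventually_at_right_field by auto
  define S where "S = (\<lambda>h. strand L i (s + sval e * h)) ` {0<..<d}"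
  have "continuous_on {0<..<d} (\<lambda>h. strand L i (s + sval e * h))"
    by (intro continuous_on_compose2[OF strand_cont[OF i, of UNIV]] continuous_intros) auto
  then have S: "connected S" unfolding S_def by (intro connected_continuous_image) auto
  have SF: "S \<subseteq> link_points L - F" using d(2) in_link[OF i] by (auto simp: S_def)
  have p: "strand L i (s + sval e * (d/2)) \<in> S"
    unfolding S_def using d(1) by (intro image_eqI[of _ _ "d/2"]) auto
  then obtain A where A: "A \<in> pieces F" "strand L i (s + sval e * (d/2)) \<in> A"
    using pieces_cover SF by blast
  have "S \<subseteq> A" using connected_in_piece[OF S SF A(1) p A(2)] .
  then have ev: "\<forall>\<^sub>F h in at_right 0. strand L i (s + sval e * h) \<in> A"
    unfolding eventually_at_right_field using d(1) by (intro exI[of _ d]) (auto simp: S_def)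
  show ?A ?B using end_eqI[OF A(1) ev] A(1) ev by simp_all
qed

lemma end_through:
  assumes i: "i < ncomp L" and F: "finite F" and A: "A \<in> pieces F" "strand L i s \<in> A"
  shows "end_at L (pieces F) i s e = A"
proof (rule end_eqI[OF A(1)])
  obtain d where d: "0 < d" "\<And>h. 0 < h \<Longrightarrow> h < d \<Longrightarrow> strand L i (s + sval e * h) \<notin> F"
    using eventually_at_shift[OF eventually_strand_avoids[OF i F], of s e]
    unfolding eventually_at_right_field by auto
  define S where "S = (\<lambda>h. strand L i (s + sval e * h)) ` {0..<d}"
  have "continuous_on {0..<d} (\<lambda>h. strand L i (s + sval e * h))"
    by (intro continuous_on_compose2[OF strand_cont[OF i, of UNIV]] continuous_intros) auto
  then have S: "connected S" unfolding S_def by (intro connected_continuous_image) auto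
  have "strand L i (s + sval e * h) \<notin> F" if "0 \<le> h" "h < d" for h
    using that d(2)[of h] A pieces_in(1) by (cases "h = 0") auto
  then have SF: "S \<subseteq> link_points L - F" using in_link[OF i] by (auto simp: S_def)
  have p: "strand L i s \<in> S" using d(1) unfolding S_def by (intro image_eqI[of _ _ 0]) auto
  have "S \<subseteq> A" using connected_in_piece[OF S SF A(1) p A(2)] .
  then show "\<forall>\<^sub>F h in at_right 0. strand L i (s + sval e * h) \<in> A"
    unfolding eventually_at_right_field using d(1) by (intro exI[of _ d]) (auto simp: S_def)
qed

lemma end_near:
  assumes i: "i < ncomp L" and F: "finite F"
  shows "\<forall>\<^sub>F h in at_right 0. \<forall>e'. end_at L (pieces F) i (s + sval e * h) e' = end_at L (pieces F) i s e"
  using end_in(2)[OF i F] by eventually_elim (use end_through[OF i F end_in(1)[OF i F]] in blast)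

text \<open>
The components of the link are disjoint and compact, so they separate the link.
\<close>

lemma piece_in_strand:
  assumes A: "A \<in> pieces F"
  obtains i where "i < ncomp L" "A \<subseteq> range (strand L i)"
proof -
  obtain p where p: "p \<in> A" using pieces_in(2)[OF A] by blast
  then obtain i where i: "i < ncomp L" "p \<in> range (strand L i)"
    using pieces_in(1)[OF A] by (auto simp: link_points_def)
  let ?R = "range (strand L i)" and ?S = "\<Union>j\<in>{..<ncomp L} - {i}. range (strand L j)"
  have "closed ?R" "closed ?S"
    using compact_range_strand i by (auto intro!: closed_UN compact_imp_closed)
  moreover have "A \<subseteq> ?R \<union> ?S" using pieces_in(1)[OF A] by (force simp: link_points_def)
  moreover have "?R \<inter> ?S \<inter> A = {}"
  proof -
    have "strand L i s \<noteq> strand L j t" if "j < ncomp L" "j \<noteq> i" for j s t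
      using strand_eq[OF i(1) that(1)] that(2) by simp
    then show ?thesis by blast
  qed
  ultimately have "?R \<inter> A = {} \<or> ?S \<inter> A = {}"
    by (intro connected_closedD[OF pieces_in(3)[OF A]]) auto
  then have "A \<subseteq> ?R" using p i \<open>A \<subseteq> ?R \<union> ?S\<close> by blast
  then show thesis using that i by blast
qed

lemma strand_of_piece_unique:
  assumes "A \<in> pieces F" "i < ncomp L" "j < ncomp L" "A \<subseteq> range (strand L i)" "strand L j t \<in> A"
  shows "i = j"
proof -
  obtain s where "strand L j t = strand L i s" using assms(4,5) by blast
  then show ?thesis using strand_eq assms by auto
qed

lemma end_in_strand:
  assumes i: "i < ncomp L" and F: "finite F"
  shows "end_at L (pieces F) i s e \<subseteq> range (strand L i)"
proof -
  let ?A = "end_at L (pieces F) i s e"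
  obtain h where h: "strand L i (s + sval e * h) \<in> ?A"
    using eventually_happens'[OF trivial_limit_at_right_real end_in(2)[OF i F]] by blast
  obtain j where "j < ncomp L" "?A \<subseteq> range (strand L j)" using piece_in_strand[OF end_in(1)[OF i F]] .
  moreover then have "j = i" using strand_of_piece_unique[OF end_in(1)[OF i F] _ i _ h] by blast
  ultimately show ?thesis by simp
qed

text \<open>
Close to a given parameter only the two pieces occur into which the strand runs from there;
finitely many such neighbourhoods cover a period.
\<close>

lemma finite_pieces:
  assumes F: "finite F" shows "finite (pieces F)"
proof -
  have "\<exists>X. finite X \<and> (\<forall>s\<in>{0..1}. \<forall>A\<in>pieces F. strand L i s \<in> A \<longrightarrow> A \<in> X)" if i: "i < ncomp L" for i
  proof -
    have "\<exists>d>0. \<forall>t. dist s t < d \<longrightarrow> (\<forall>A\<in>pieces F. strand L i t \<in> A \<longrightarrow>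
        A \<in> {end_at L (pieces F) i s Pos, end_at L (pieces F) i s Neg})" for s
    proof -
      obtain d1 where d1: "0 < d1" "\<And>h. 0 < h \<Longrightarrow> h < d1 \<Longrightarrow> strand L i (s + sval Pos * h) \<in> end_at L (pieces F) i s Pos"
        using end_in(2)[OF i F, of s Pos] unfolding eventually_at_right_field by blast
      obtain d2 where d2: "0 < d2" "\<And>h. 0 < h \<Longrightarrow> h < d2 \<Longrightarrow> strand L i (s + sval Neg * h) \<in> end_at L (pieces F) i s Neg"
        using end_in(2)[OF i F, of s Neg] unfolding eventually_at_right_field by blast
      have "A \<in> {end_at L (pieces F) i s Pos, end_at L (pieces F) i s Neg}"
        if "dist s t < min d1 d2" "A \<in> pieces F" "strand L i t \<in> A" for t A
      proof -
        consider "t = s" | "t > s" | "t < s" by linarith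
        then show ?thesis
        proof cases
          case 1 then show ?thesis using end_through[OF i F that(2), of s Pos] that(3) by simp
        next
          case 2 then show ?thesis
            using d1(2)[of "t - s"] pieces_disjoint[OF that(2) end_in(1)[OF i F] that(3)] that(1)
            by (auto simp: dist_real_def)
        next
          case 3 then show ?thesis
            using d2(2)[of "s - t"] pieces_disjoint[OF that(2) end_in(1)[OF i F] that(3)] that(1)
            by (auto simp: dist_real_def)
        qed
      qed
      then show ?thesis using d1(1) d2(1) by (intro exI[of _ "min d1 d2"]) auto
    qed
    then obtain d where d: "\<And>s. 0 < d s" "\<And>s t A. dist s t < d s \<Longrightarrow> A\<in>pieces F \<Longrightarrow> strand L i t \<in> A \<Longrightarrow>
        A \<in> {end_at L (pieces F) i s Pos, end_at L (pieces F) i s Neg}"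
      by metis
    have "{0..1} \<subseteq> (\<Union>s\<in>{0..1}. ball s (d s))" using d(1) by force
    then obtain T where T: "finite T" "{0..1} \<subseteq> (\<Union>s\<in>T. ball s (d s))"
      using compactE_image[of "{0..1::real}" "{0..1}" "\<lambda>s. ball s (d s)"] by (metis compact_Icc open_ball)
    let ?X = "\<Union>s\<in>T. {end_at L (pieces F) i s Pos, end_at L (pieces F) i s Neg}"
    have "A \<in> ?X" if s: "s \<in> {0..1}" "A \<in> pieces F" "strand L i s \<in> A" for s A
    proof -
      have "s \<in> (\<Union>s\<in>T. ball s (d s))" using T(2) s(1) by blast
      then obtain u where "u \<in> T" "dist u s < d u" by (elim UN_E) (simp only: mem_ball)
      then show ?thesis using d(2) s by blast
    qed
    then show ?thesis using T(1) by (intro exI[of _ ?X]) auto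
  qed
  then obtain X where X: "\<And>i. i < ncomp L \<Longrightarrow> finite (X i)"
    "\<And>i s A. i < ncomp L \<Longrightarrow> s \<in> {0..1} \<Longrightarrow> A \<in> pieces F \<Longrightarrow> strand L i s \<in> A \<Longrightarrow> A \<in> X i"
    by metis
  have "A \<in> (\<Union>i<ncomp L. X i)" if AF: "A \<in> pieces F" for A
  proof -
    obtain p where p: "p \<in> A" "p \<in> link_points L" using pieces_in[OF AF] by blast
    then obtain i s where "i < ncomp L" "s \<in> {0..<1}" "p = strand L i s" by (elim link_param)
    then show ?thesis using X(2)[of i s A] AF p by auto
  qed
  then show ?thesis using X(1) by (intro finite_subset[of "pieces F" "\<Union>i<ncomp L. X i"]) auto
qed

abbreviation "ends i s e \<equiv> end_at L (semi_arcs L) i s e"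
abbreviation "arc_ends i s e \<equiv> end_at L (arcs L) i s e"

lemmas semi_end_in = end_in[OF _ finite_cuts, folded semi_arcs_pieces]
lemmas semi_end_through = end_through[OF _ finite_cuts, folded semi_arcs_pieces]
lemmas arc_end_through = end_through[OF _ finite_under, folded arcs_pieces]
lemmas finite_semi_arcs = finite_pieces[OF finite_cuts, folded semi_arcs_pieces]
lemmas semi_end_in_strand = end_in_strand[OF _ finite_cuts, folded semi_arcs_pieces]

definition arc_of where "arc_of A = (THE B. B \<in> arcs L \<and> A \<subseteq> B)"

lemma arc_of_eqI:
  assumes A: "A \<in> semi_arcs L" and B: "B \<in> arcs L" and p: "p \<in> A" "p \<in> B"
  shows "A \<subseteq> B" "arc_of A = B"
proof -
  note A' = A[unfolded semi_arcs_pieces] and B' = B[unfolded arcs_pieces]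
  show AB: "A \<subseteq> B"
    using connected_in_piece[OF pieces_in(3)[OF A'] _ B' p] pieces_in(1)[OF A'] by blast
  show "arc_of A = B" unfolding arc_of_def
    using AB B p pieces_disjoint[of _ "under_points L", folded arcs_pieces] by (intro the_equality) blast+
qed

lemma arc_of_in:
  assumes "A \<in> semi_arcs L" shows "arc_of A \<in> arcs L" "A \<subseteq> arc_of A"
proof -
  note A' = assms[unfolded semi_arcs_pieces]
  obtain p where p: "p \<in> A" "p \<in> link_points L - under_points L" using pieces_in[OF A'] by blast
  then obtain B where "B \<in> arcs L" "p \<in> B" using pieces_cover[of p "under_points L", folded arcs_pieces] by blast
  then show "arc_of A \<in> arcs L" "A \<subseteq> arc_of A" using arc_of_eqI[OF assms _ p(1)] by blast+
qed

lemma arc_of_end: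
  assumes i: "i < ncomp L" shows "arc_of (ends i s e) = arc_ends i s e"
proof -
  have "\<forall>\<^sub>F h in at_right 0. strand L i (s + sval e * h) \<in> arc_of (ends i s e)"
    using semi_end_in(2)[OF i, of s e] by eventually_elim (use arc_of_in(2)[OF semi_end_in(1)[OF i]] in blast)
  then show ?thesis
    using end_eqI[of _ "under_points L", folded arcs_pieces, OF arc_of_in(1)[OF semi_end_in(1)[OF i]]] by simp
qed

lemma arc_through_in:
  assumes "i < ncomp L" "strand L i s \<notin> under_points L"
  shows "arc_through L i s \<in> arcs L" "strand L i s \<in> arc_through L i s"
proof -
  obtain B where B: "B \<in> arcs L" "strand L i s \<in> B"
    using pieces_cover[of "strand L i s" "under_points L", folded arcs_pieces] in_link assms by blast
  have "arc_through L i s = B" unfolding arc_through_def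
    using B pieces_disjoint[of _ "under_points L", folded arcs_pieces] by (intro the_equality) blast+
  then show "arc_through L i s \<in> arcs L" "strand L i s \<in> arc_through L i s" using B by simp_all
qed

lemma arc_of_over_end:
  assumes "i < ncomp L" "strand L i s \<notin> under_points L"
  shows "arc_of (ends i s e) = arc_through L i s"
  using arc_of_end[OF assms(1)] arc_end_through[OF assms(1) arc_through_in[OF assms]] by simp

lemma arc_of_surj:
  assumes B: "B \<in> arcs L" shows "\<exists>A\<in>semi_arcs L. arc_of A = B"
proof -
  obtain p where p: "p \<in> B" "p \<in> link_points L" using pieces_in[OF B[unfolded arcs_pieces]] by blast
  then obtain i s where i: "i < ncomp L" "p = strand L i s" by (elim link_param)
  then have "arc_of (ends i s Pos) = B" using arc_of_end[OF i(1)] arc_end_through[OF i(1) B] p by simp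
  then show ?thesis using semi_end_in(1)[OF i(1)] by blast
qed

text \<open>
The label of the semi-arc that begins at a parameter is locally constant along the arc: at a
point over a crossing this is the hypothesis, and at any other point of the arc the two
ends belong to the same semi-arc.
\<close>

lemma constant_on_arcs:
  assumes f: "\<And>i s j t. (i, s, j, t) \<in> crossings L \<Longrightarrow> f (ends j t Pos) = f (ends j t Neg)"
    and A: "A \<in> semi_arcs L" "A' \<in> semi_arcs L" "arc_of A = arc_of A'"
  shows "f A = f A'"
proof -
  let ?B = "arc_of A"
  have B: "?B \<in> arcs L" using arc_of_in A by blast
  note B' = B[unfolded arcs_pieces]
  obtain i where i: "i < ncomp L" "?B \<subseteq> range (strand L i)" using piece_in_strand[OF B'] .
  have through: "\<exists>s. strand L i s \<in> ?B \<and> ends i s Pos = A0" if A0: "A0 \<in> semi_arcs L" "arc_of A0 = ?B" for A0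
  proof -
    obtain p where p: "p \<in> A0" using A0(1) pieces_in(2) by (metis ex_in_conv semi_arcs_pieces)
    then have "p \<in> ?B" using arc_of_in(2)[OF A0(1)] A0(2) by blast
    then obtain s where "p = strand L i s" using i(2) by blast
    then show ?thesis using p \<open>p \<in> ?B\<close> semi_end_through[OF i(1) A0(1)] by blast
  qed
  obtain s where s: "strand L i s \<in> ?B" "ends i s Pos = A" using through[OF A(1)] by blast
  obtain s' where s': "strand L i s' \<in> ?B" "ends i s' Pos = A'" using through[OF A(2)] A(3) by auto
  define Q where "Q u \<longleftrightarrow> f (ends i u Pos) = f A" for u
  have ends_period: "ends i u e = ends i (u + m) e" if "m \<in> \<int>" for u m e
  proof -
    have "strand L i (u + m + x) = strand L i (u + x)" for x
      using strand_periodic[OF i(1) that, of "u + x"] by (simp add: add.commute add.left_commute)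
    then show ?thesis by (simp add: end_at_def)
  qed
  have both: "f (ends i u Pos) = f (ends i u Neg)" if u: "strand L i u \<in> ?B" for u
  proof (cases "strand L i u \<in> over_points L")
    case True
    then obtain q where "q \<in> link_points L" "proj q = proj (strand L i u)" "q $ 3 < strand L i u $ 3"
      unfolding over_points_def by blast
    then obtain k v j t where c: "(k, v, j, t) \<in> crossings L" "strand L i u = strand L j t"
      using crossing_point_cases[OF _ in_link[OF i(1)]] by metis
    then have "i = j" "t - u \<in> \<int>"
      using strand_eq[OF crossing_facts(2)[OF c(1)] i(1), of t u] by auto
    then show ?thesis using f[OF c(1)] ends_period[of "t - u" u] by simp
  next
    case False
    moreover have "strand L i u \<in> link_points L - under_points L" using u pieces_in(1)[OF B'] by blast
    ultimately obtain A0 where "A0 \<in> semi_arcs L" "strand L i u \<in> A0"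
      using pieces_cover[of "strand L i u" "under_points L \<union> over_points L", folded semi_arcs_pieces] by blast
    then show ?thesis using semi_end_through[OF i(1)] by simp
  qed
  have "Q s \<longleftrightarrow> Q s'"
  proof (rule locally_constant_along_loop[of "strand L i" ?B])
    show "continuous_on {0..1} (strand L i)" using strand_cont i by blast
    show "connected ?B" using pieces_in(3)[OF B'] .
    show "?B \<subseteq> strand L i ` {0..1}"
      using i(2) range_strand[OF i(1)] by (force simp: subset_eq image_iff)
    show "Q u \<longleftrightarrow> Q v" if "strand L i u \<in> ?B" "strand L i u = strand L i v" for u v
    proof -
      have "v - u \<in> \<int>" using that(2)[symmetric] strand_eq[OF i(1) i(1)] by simp
      then show ?thesis using ends_period[of "v - u" u] by (simp add: Q_def)
    qed
    show "\<forall>\<^sub>F v in at u. Q v \<longleftrightarrow> Q u" if u: "strand L i u \<in> ?B" for u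
    proof -
      have ev: "\<forall>\<^sub>F h in at_right 0. Q (u + sval e * h) \<longleftrightarrow> Q u" for e
        using end_near[OF i(1) finite_cuts, folded semi_arcs_pieces, of u e]
      proof eventually_elim
        case (elim h)
        then show ?case using both[OF u] by (cases e) (simp_all add: Q_def)
      qed
      obtain d1 where d1: "0 < d1" "\<And>h. 0 < h \<Longrightarrow> h < d1 \<Longrightarrow> Q (u + sval Pos * h) \<longleftrightarrow> Q u"
        using ev[of Pos] unfolding eventually_at_right_field by blast
      obtain d2 where d2: "0 < d2" "\<And>h. 0 < h \<Longrightarrow> h < d2 \<Longrightarrow> Q (u + sval Neg * h) \<longleftrightarrow> Q u"
        using ev[of Neg] unfolding eventually_at_right_field by blast
      show ?thesis unfolding eventually_at
      proof (intro exI[of _ "min d1 d2"] conjI ballI impI)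
        fix v assume "v \<noteq> u \<and> dist v u < min d1 d2"
        then show "Q v \<longleftrightarrow> Q u"
          using d1(2)[of "v - u"] d2(2)[of "u - v"] by (cases "v > u") (auto simp: dist_real_def)
      qed (use d1(1) d2(1) in auto)
    qed
  qed (use s s' in auto)
  then show ?thesis using s(2) s'(2) by (simp add: Q_def)
qed

end

section \<open>The action of a symmetric quandle\<close>

lemma pres_eq_sym_rel:
  assumes "x \<in> qcarrier Q"
  shows "pres_eq (qcarrier Q) (sym_quandle_rels Q) [(qinv Q x, Pos)] [(x, Neg)]"
  using assms by (intro pres_rel) (auto simp: sym_quandle_rels_def)

context
  fixes Q :: "('x, 'm) sym_quandle_scheme" and Y :: "'y set" and act
  assumes Q: "symmetric_quandle Q" and Y: "sym_quandle_set Q Y act"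
begin

lemma sym_gact_pair:
  assumes "r \<in> Y" "x \<in> qcarrier Q" "y \<in> qcarrier Q"
  shows "sym_gact Q act (sym_gact Q act r x) y
           = act r (pres_class (qcarrier Q) (sym_quandle_rels Q) [(x, Pos), (y, Pos)])"
    and "sym_gact Q act r x \<in> Y"
proof -
  have c: "sym_assoc_gen Q z \<in> carrier (sym_assoc_group Q)" if "z \<in> qcarrier Q" for z
    using that by (auto simp: sym_assoc_gen_def sym_assoc_group_def presented_group_def)
  have m: "sym_assoc_gen Q x \<otimes>\<^bsub>sym_assoc_group Q\<^esub> sym_assoc_gen Q y
      = pres_class (qcarrier Q) (sym_quandle_rels Q) [(x, Pos), (y, Pos)]"
    using assms by (simp add: sym_assoc_gen_def sym_assoc_group_def presented_group_mult)
  show "sym_gact Q act (sym_gact Q act r x) y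
           = act r (pres_class (qcarrier Q) (sym_quandle_rels Q) [(x, Pos), (y, Pos)])"
    "sym_gact Q act r x \<in> Y"
    using Y assms c[OF assms(2)] c[OF assms(3)] m
    unfolding sym_gact_def sym_quandle_set_def right_action_def by metis+
qed

lemma sym_gact_cancel:
  assumes r: "r \<in> Y" and x: "x \<in> qcarrier Q"
  shows "sym_gact Q act (sym_gact Q act r x) (qinv Q x) = r"
proof -
  let ?S = "qcarrier Q" and ?R = "sym_quandle_rels Q"
  have x': "qinv Q x \<in> ?S" using Q x unfolding symmetric_quandle_def by blast
  have "pres_eq ?S ?R ([(x, Pos)] @ [(qinv Q x, Pos)]) ([(x, Pos)] @ [(x, Neg)])"
    using x pres_eq_sym_rel[OF x] by (intro pres_append pres_refl) auto
  moreover have "pres_eq ?S ?R [(x, Pos), (x, Neg)] []" using pres_cancel[OF x, of ?R Pos] by simp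
  ultimately have "pres_eq ?S ?R [(x, Pos), (qinv Q x, Pos)] []" using pres_trans by fastforce
  then have "pres_class ?S ?R [(x, Pos), (qinv Q x, Pos)] = \<one>\<^bsub>sym_assoc_group Q\<^esub>"
    by (simp add: sym_assoc_group_def presented_group_def pres_class_eq_iff)
  then show ?thesis
    using sym_gact_pair(1)[OF r x x'] Y r unfolding sym_quandle_set_def right_action_def by simp
qed

text \<open>
In the group, the relation for \<open>x * y\<close> says that \<open>y (x * y) = x y\<close>.
\<close>

lemma sym_gact_distrib:
  assumes r: "r \<in> Y" and x: "x \<in> qcarrier Q" and y: "y \<in> qcarrier Q"
  shows "sym_gact Q act (sym_gact Q act r x) y = sym_gact Q act (sym_gact Q act r y) (x \<star>\<^bsub>Q\<^esub> y)"
proof -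
  let ?S = "qcarrier Q" and ?R = "sym_quandle_rels Q"
  have xy: "x \<star>\<^bsub>Q\<^esub> y \<in> ?S" using Q x y unfolding symmetric_quandle_def quandle_def by blast
  have "pres_eq ?S ?R [(x \<star>\<^bsub>Q\<^esub> y, Pos)] [(y, Neg), (x, Pos), (y, Pos)]"
    using x y by (intro pres_rel) (auto simp: sym_quandle_rels_def quandle_rels_def)
  then have "pres_eq ?S ?R ([(y, Pos)] @ [(x \<star>\<^bsub>Q\<^esub> y, Pos)]) ([(y, Pos)] @ [(y, Neg), (x, Pos), (y, Pos)])"
    using y by (intro pres_append pres_refl) auto
  moreover have "pres_eq ?S ?R ([(y, Pos), (y, Neg)] @ [(x, Pos), (y, Pos)]) ([] @ [(x, Pos), (y, Pos)])"
    using x y pres_cancel[OF y, of ?R Pos] by (intro pres_append pres_refl) auto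
  ultimately have "pres_eq ?S ?R [(y, Pos), (x \<star>\<^bsub>Q\<^esub> y, Pos)] [(x, Pos), (y, Pos)]"
    using pres_trans by fastforce
  then have "pres_class ?S ?R [(y, Pos), (x \<star>\<^bsub>Q\<^esub> y, Pos)] = pres_class ?S ?R [(x, Pos), (y, Pos)]"
    using x y by (simp add: pres_class_eq_iff)
  then show ?thesis
    using sym_gact_pair(1)[OF r x y] sym_gact_pair(1)[OF r y xy] by simp
qed

end

locale double_action =
  fixes X :: "'x quandle" and Y :: "'y set" and act :: "'y \<Rightarrow> 'x gword set \<Rightarrow> 'y"
  assumes X: "quandle X" and Y: "quandle_set X Y act"
begin

abbreviation "ra \<equiv> sym_gact (double X) (double_act X act)"

lemma double_simps [simp]:
  "qcarrier (double X) = qcarrier X \<times> UNIV"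
  "(x, e) \<star>\<^bsub>double X\<^esub> (y, d) = (qpow X x y d, e)"
  "qinv (double X) (x, e) = (x, opp e)"
  by (simp_all add: double_def)

lemma qpow_closed [simp]: "x \<in> qcarrier X \<Longrightarrow> y \<in> qcarrier X \<Longrightarrow> qpow X x y e \<in> qcarrier X"
  using qpow_in(1)[OF X] .

lemma qpow_cancel [simp]:
  "x \<in> qcarrier X \<Longrightarrow> y \<in> qcarrier X \<Longrightarrow> qpow X (qpow X x y Pos) y Neg = x"
  "x \<in> qcarrier X \<Longrightarrow> y \<in> qcarrier X \<Longrightarrow> qpow X (qpow X x y Neg) y Pos = x"
  using qpow_in(2)[OF X, of x y Pos] qpow_in(2)[OF X, of x y Neg] by simp_all

lemma qpow_self: "x \<in> qcarrier X \<Longrightarrow> qpow X x x Neg = x"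
proof -
  assume x: "x \<in> qcarrier X"
  then have "qpow X x x Pos = x" using X by (auto simp: quandle_def qpow_def)
  then show ?thesis using qpow_cancel(1)[OF x x] by simp
qed

lemmas double_sym = symmetric_quandle_double[OF X] sym_quandle_set_double[OF X Y]

lemma ra_in [simp]: "r \<in> Y \<Longrightarrow> x \<in> qcarrier X \<Longrightarrow> ra r (x, e) \<in> Y"
  using sym_gact_pair(2)[OF double_sym, of r "(x, e)"] by auto

lemma ra_cancel [simp]:
  assumes "r \<in> Y" "x \<in> qcarrier X"
  shows "ra (ra r (x, Pos)) (x, Neg) = r" "ra (ra r (x, Neg)) (x, Pos) = r"
  using sym_gact_cancel[OF double_sym, of r "(x, Pos)"] sym_gact_cancel[OF double_sym, of r "(x, Neg)"] assms
  by auto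

lemma ra_distrib:
  assumes "r \<in> Y" "x \<in> qcarrier X" "y \<in> qcarrier X"
  shows "ra (ra r (x, e)) (y, d) = ra (ra r (y, d)) (qpow X x y d, e)"
  using sym_gact_distrib[OF double_sym, of r "(x, e)" "(y, d)"] assms by simp

lemma ra_Pos: "x \<in> qcarrier X \<Longrightarrow> ra r (x, Pos) = gact X act r x"
  using double_proj_hom(2)[OF X] by (simp add: sym_gact_def double_act_def gact_def)

section \<open>The comparison of chain groups in degree two\<close>

abbreviation "B \<equiv> chain_basis X Y 2"
abbreviation "BD \<equiv> chain_basis (double X) Y 2"
abbreviation "N \<equiv> SQ_sub (double X) Y ra 2"

definition lift :: "('y, 'x) chain \<Rightarrow> ('y, 'x \<times> sign) chain" where
  "lift = frag_extend (\<lambda>(r, xs). frag_of (r, map (\<lambda>x. (x, Pos)) xs))"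

text \<open>
The sign of the last entry is removed first, which replaces \<open>x\<close> by \<open>x'\<close> and the base label by
\<open>r1\<close>; then that of the first entry is removed. Each removal reverses the sign of the tuple.
\<close>

definition positive_tuple :: "'y \<times> ('x \<times> sign) list \<Rightarrow> ('y, 'x) chain" where
  "positive_tuple = (\<lambda>(r, zs).
     let (x, e) = zs ! 0; (y, d) = zs ! 1;
         x' = (if d = Pos then x else qpow X x y Neg);
         r1 = (if d = Pos then r else ra r (y, Neg));
         r2 = (if e = Pos then r1 else ra r1 (x', Neg))
     in frag_cmul (sval e * sval d) (frag_of (r2, [x', y])))"

definition flatten :: "('y, 'x \<times> sign) chain \<Rightarrow> ('y, 'x) chain" where
  "flatten = frag_extend positive_tuple"

lemma B_iff: "t \<in> B \<longleftrightarrow> (\<exists>r x y. t = (r, [x, y]) \<and> r \<in> Y \<and> x \<in> qcarrier X \<and> y \<in> qcarrier X)"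
  by (cases t) (auto simp: chain_basis_def length_Suc_conv numeral_2_eq_2)

lemma BD_iff: "t \<in> BD \<longleftrightarrow> (\<exists>r x e y d. t = (r, [(x, e), (y, d)]) \<and> r \<in> Y \<and> x \<in> qcarrier X \<and> y \<in> qcarrier X)"
  by (cases t) (auto simp: chain_basis_def length_Suc_conv numeral_2_eq_2)

lemma keys_extend:
  assumes "Poly_Mapping.keys c \<subseteq> S" "\<And>t. t \<in> S \<Longrightarrow> Poly_Mapping.keys (f t) \<subseteq> S'"
  shows "Poly_Mapping.keys (frag_extend f c) \<subseteq> S'"
  using keys_frag_extend[of f c] assms by blast

lemma keys_lift: "Poly_Mapping.keys c \<subseteq> B \<Longrightarrow> Poly_Mapping.keys (lift c) \<subseteq> BD"
  unfolding lift_def by (rule keys_extend) (auto simp: B_iff BD_iff keys_frag_of)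

lemma keys_positive_tuple: "t \<in> BD \<Longrightarrow> Poly_Mapping.keys (positive_tuple t) \<subseteq> B"
  by (auto simp: BD_iff B_iff positive_tuple_def Let_def keys_frag_of split: if_splits)

lemma keys_flatten: "Poly_Mapping.keys c \<subseteq> BD \<Longrightarrow> Poly_Mapping.keys (flatten c) \<subseteq> B"
  unfolding flatten_def by (rule keys_extend[OF _ keys_positive_tuple])

lemma comm_chain_group: "comm_group (chain_group Q Z n)"
  by (simp add: chain_group_def abelian_free_Abelian_group)

lemma chain_group_simps [simp]:
  "c \<in> carrier (chain_group Q Z n) \<longleftrightarrow> Poly_Mapping.keys c \<subseteq> chain_basis Q Z n"
  "\<one>\<^bsub>chain_group Q Z n\<^esub> = 0" "c \<otimes>\<^bsub>chain_group Q Z n\<^esub> d = c + d"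
  "Poly_Mapping.keys c \<subseteq> chain_basis Q Z n \<Longrightarrow> inv\<^bsub>chain_group Q Z n\<^esub> c = - c"
  by (simp_all add: chain_group_def)

lemma degenerate_subgroup: "subgroup (degenerate Q Z n) (chain_group Q Z n)"
  unfolding degenerate_def
  by (intro group.generate_is_subgroup comm_group.axioms(2)[OF comm_chain_group]) (auto simp: keys_frag_of)

lemma inv_act_basis: "t \<in> BD \<Longrightarrow> i < 2 \<Longrightarrow> inv_act_tuple (double X) ra i t \<in> BD"
  by (auto simp: BD_iff inv_act_tuple_def less_2_cases_iff)

lemma sym_generator_keys:
  assumes "t \<in> BD" "i < 2"
  shows "Poly_Mapping.keys (frag_of t + frag_of (inv_act_tuple (double X) ra i t)) \<subseteq> BD"
  by (rule order_trans[OF keys_add]) (use assms inv_act_basis[OF assms] in \<open>auto simp: keys_frag_of\<close>)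

lemma sym_degenerate_subgroup: "subgroup (sym_degenerate (double X) Y ra 2) (chain_group (double X) Y 2)"
  unfolding sym_degenerate_def
  by (intro group.generate_is_subgroup comm_group.axioms(2)[OF comm_chain_group])
     (use sym_generator_keys in auto)

lemma N_subgroup: "subgroup N (chain_group (double X) Y 2)"
  unfolding SQ_sub_def
  by (intro comm_group.mult_subgroups[OF comm_chain_group] degenerate_subgroup sym_degenerate_subgroup)

lemma N_simps:
  shows N_0: "0 \<in> N" and N_add: "c \<in> N \<Longrightarrow> d \<in> N \<Longrightarrow> c + d \<in> N"
    and N_uminus: "c \<in> N \<Longrightarrow> - c \<in> N" and N_keys: "c \<in> N \<Longrightarrow> Poly_Mapping.keys c \<subseteq> BD"
proof -
  show k: "c \<in> N \<Longrightarrow> Poly_Mapping.keys c \<subseteq> BD" for c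
    using subgroup.mem_carrier[OF N_subgroup] by simp
  show "0 \<in> N" using subgroup.one_closed[OF N_subgroup] by simp
  show "c \<in> N \<Longrightarrow> d \<in> N \<Longrightarrow> c + d \<in> N" using subgroup.m_closed[OF N_subgroup] by simp
  show "c \<in> N \<Longrightarrow> - c \<in> N" using subgroup.m_inv_closed[OF N_subgroup] k by simp
qed

lemma N_diff: "c \<in> N \<Longrightarrow> d \<in> N \<Longrightarrow> c - d \<in> N"
  using N_add N_uminus by (metis add_uminus_conv_diff)

lemma N_sym:
  assumes "t \<in> BD" "i < 2"
  shows "frag_of t + frag_of (inv_act_tuple (double X) ra i t) \<in> N"
proof -
  have "frag_of t + frag_of (inv_act_tuple (double X) ra i t) \<in> sym_degenerate (double X) Y ra 2"
    unfolding sym_degenerate_def using assms by (intro generate.incl) blast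
  moreover have "0 \<in> degenerate (double X) Y 2"
    using subgroup.one_closed[OF degenerate_subgroup, of "double X" Y 2] by simp
  ultimately show ?thesis unfolding SQ_sub_def set_mult_def
    by (intro UN_I[of 0 "degenerate (double X) Y 2"] UN_I) auto
qed

lemma N_flip_last:
  assumes "r \<in> Y" "x \<in> qcarrier X" "y \<in> qcarrier X"
  shows "frag_of (r, [(x, e), (y, d)]) + frag_of (ra r (y, d), [(qpow X x y d, e), (y, opp d)]) \<in> N"
  using N_sym[of "(r, [(x, e), (y, d)])" 1] assms by (auto simp: BD_iff inv_act_tuple_def)

lemma N_flip_first:
  assumes "r \<in> Y" "x \<in> qcarrier X" "y \<in> qcarrier X"
  shows "frag_of (r, [(x, e), (y, d)]) + frag_of (ra r (x, e), [(x, opp e), (y, d)]) \<in> N"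
  using N_sym[of "(r, [(x, e), (y, d)])" 0] assms by (auto simp: BD_iff inv_act_tuple_def)

text \<open>
Each of the two steps in the definition of \<open>positive_tuple\<close> is an instance of one of the
generators of \<open>N\<close>.
\<close>

lemma lift_flatten:
  assumes "Poly_Mapping.keys c \<subseteq> BD" shows "c - lift (flatten c) \<in> N"
  using assms
proof (induction c rule: frag_induction)
  case zero
  show ?case using N_0 by (simp add: lift_def flatten_def)
next
  case (one t)
  then obtain r x e y d where t: "t = (r, [(x, e), (y, d)])" and c: "r \<in> Y" "x \<in> qcarrier X" "y \<in> qcarrier X"
    by (auto simp: BD_iff)
  define x' where "x' = (if d = Pos then x else qpow X x y Neg)"
  define r1 where "r1 = (if d = Pos then r else ra r (y, Neg))"
  define r2 where "r2 = (if e = Pos then r1 else ra r1 (x', Neg))"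
  have c1: "r1 \<in> Y" "x' \<in> qcarrier X" "r2 \<in> Y" using c by (auto simp: r1_def x'_def r2_def)
  have 1: "frag_of t - frag_cmul (sval d) (frag_of (r1, [(x', e), (y, Pos)])) \<in> N"
    using N_flip_last[OF c1(1,2) c(3), of e Pos] N_0 c
    by (cases d) (auto simp: t r1_def x'_def add.commute)
  have 2: "frag_of (r1, [(x', e), (y, Pos)]) - frag_cmul (sval e) (frag_of (r2, [(x', Pos), (y, Pos)])) \<in> N"
    using N_flip_first[OF c1(3,2) c(3), of Pos Pos] N_0 c1
    by (cases e) (auto simp: r2_def add.commute)
  have "lift (flatten (frag_of t)) = frag_cmul (sval e * sval d) (frag_of (r2, [(x', Pos), (y, Pos)]))"
    by (simp add: lift_def flatten_def positive_tuple_def t frag_extend_cmul r1_def r2_def x'_def Let_def)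
  moreover have "frag_of t - frag_cmul (sval e * sval d) (frag_of (r2, [(x', Pos), (y, Pos)])) \<in> N"
  proof (cases d)
    case Pos
    then show ?thesis using N_add[OF 1 2]
      by (simp add: minus_frag_cmul[symmetric] algebra_simps del: minus_frag_cmul)
  next
    case Neg
    then show ?thesis using N_diff[OF 1 2]
      by (simp add: minus_frag_cmul[symmetric] algebra_simps del: minus_frag_cmul)
  qed
  ultimately show ?case by simp
next
  case (diff a b)
  then show ?case using N_diff[of "a - lift (flatten a)" "b - lift (flatten b)"]
    by (simp add: lift_def flatten_def frag_extend_diff algebra_simps)
qed

lemma degenerate_closed:
  shows "0 \<in> degenerate Q Z n" "c \<in> degenerate Q Z n \<Longrightarrow> d \<in> degenerate Q Z n \<Longrightarrow> c + d \<in> degenerate Q Z n"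
    "c \<in> degenerate Q Z n \<Longrightarrow> - c \<in> degenerate Q Z n"
    "c \<in> degenerate Q Z n \<Longrightarrow> Poly_Mapping.keys c \<subseteq> chain_basis Q Z n"
proof -
  show k: "c \<in> degenerate Q Z n \<Longrightarrow> Poly_Mapping.keys c \<subseteq> chain_basis Q Z n" for c
    using subgroup.mem_carrier[OF degenerate_subgroup] by simp
  show "0 \<in> degenerate Q Z n" using subgroup.one_closed[OF degenerate_subgroup] by simp
  show "c \<in> degenerate Q Z n \<Longrightarrow> d \<in> degenerate Q Z n \<Longrightarrow> c + d \<in> degenerate Q Z n"
    using subgroup.m_closed[OF degenerate_subgroup] by simp
  show "c \<in> degenerate Q Z n \<Longrightarrow> - c \<in> degenerate Q Z n"
    using subgroup.m_inv_closed[OF degenerate_subgroup, of c Q Z n] k by simp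
qed

lemma flatten_degenerate:
  assumes "c \<in> degenerate (double X) Y 2" shows "flatten c \<in> degenerate X Y 2"
proof -
  let ?G = "{frag_of (r, xs) | r xs. (r, xs) \<in> BD \<and> (\<exists>i. Suc i < 2 \<and> xs ! i = xs ! Suc i)}"
  have gen: "flatten h \<in> degenerate X Y 2" if h: "h \<in> ?G" for h
  proof -
    obtain r x e where hh: "h = frag_of (r, [(x, e), (x, e)])" "r \<in> Y" "x \<in> qcarrier X"
      using h by (auto simp: BD_iff)
    have "frag_of (s, [x, x]) \<in> degenerate X Y 2" if "s \<in> Y" for s
      unfolding degenerate_def using hh that by (intro generate.incl) (auto simp: B_iff frag_of_eq)
    then show ?thesis
      using hh by (cases e) (simp_all add: flatten_def positive_tuple_def qpow_self)
  qed
  show ?thesis using assms[unfolded degenerate_def]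
  proof induction
    case one then show ?case by (simp add: flatten_def degenerate_closed)
  next
    case (inv h)
    then have "Poly_Mapping.keys h \<subseteq> BD" by (auto simp: keys_frag_of)
    then show ?case using degenerate_closed(3)[OF gen[OF inv]] by (simp add: flatten_def frag_extend_minus)
  next
    case (eng a b)
    then show ?case using degenerate_closed(2) by (simp add: flatten_def frag_extend_add)
  qed (use gen in blast)
qed

text \<open>
The two tuples of a generator are flattened to the same tuple with opposite signs. If the
first entry is inverted and the last one is negative, the two base labels are
compared by \<open>ra_distrib\<close>, as making the last entry positive changes the first one.
\<close>

lemma flatten_sym_degenerate:
  assumes "c \<in> sym_degenerate (double X) Y ra 2" shows "flatten c = 0"
proof -
  let ?G = "{frag_of t + frag_of (inv_act_tuple (double X) ra i t) | t i. t \<in> BD \<and> i < 2}"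
  have gen: "flatten h = 0" if h: "h \<in> ?G" for h
  proof -
    obtain r x e y d i where hh: "h = frag_of (r, [(x, e), (y, d)]) + frag_of (inv_act_tuple (double X) ra i (r, [(x, e), (y, d)]))"
      and c: "r \<in> Y" "x \<in> qcarrier X" "y \<in> qcarrier X" and i: "i = 0 \<or> i = 1"
      using h by (auto simp: BD_iff less_2_cases_iff)
    have xy: "qpow X x y Neg \<in> qcarrier X" using c by simp
    from i show ?thesis
    proof
      assume "i = 0"
      then show ?thesis
        using c xy ra_distrib[OF c, of Pos Neg] ra_distrib[OF c, of Neg Neg]
        by (cases e; cases d)
           (simp_all add: hh inv_act_tuple_def flatten_def frag_extend_add positive_tuple_def Let_def)
    next
      assume "i = 1"
      then show ?thesis
        using c xy
        by (cases e; cases d)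
           (simp_all add: hh inv_act_tuple_def flatten_def frag_extend_add positive_tuple_def Let_def)
    qed
  qed
  show ?thesis using assms[unfolded sym_degenerate_def]
  proof induction
    case one then show ?case by (simp add: flatten_def)
  next
    case (inv h)
    then have "Poly_Mapping.keys h \<subseteq> BD" using sym_generator_keys by blast
    then show ?case using gen[OF inv] by (simp add: flatten_def frag_extend_minus)
  next
    case (eng a b)
    then show ?case by (simp add: flatten_def frag_extend_add)
  qed (use gen in blast)
qed

lemma flatten_N: "c \<in> N \<Longrightarrow> flatten c \<in> degenerate X Y 2"
proof -
  assume "c \<in> N"
  then obtain a b where ab: "c = a + b" "a \<in> degenerate (double X) Y 2" "b \<in> sym_degenerate (double X) Y ra 2"
    by (auto simp: SQ_sub_def set_mult_def)
  have "flatten c = flatten a + flatten b" by (simp add: ab flatten_def frag_extend_add)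
  then show ?thesis using flatten_degenerate[OF ab(2)] flatten_sym_degenerate[OF ab(3)] by simp
qed

lemma r_coset_eq:
  fixes c d :: "'b \<Rightarrow>\<^sub>0 int"
  assumes "\<And>a b. a \<in> M \<Longrightarrow> b \<in> M \<Longrightarrow> a + b \<in> M" "\<And>a. a \<in> M \<Longrightarrow> - a \<in> M" "c - d \<in> M"
  shows "M #>\<^bsub>free_Abelian_group S\<^esub> c = M #>\<^bsub>free_Abelian_group S\<^esub> d"
proof -
  have "\<exists>b\<in>M. a + c = b + d" "\<exists>b\<in>M. a + d = b + c" if "a \<in> M" for a
  proof -
    show "\<exists>b\<in>M. a + c = b + d"
      using assms(1)[OF that assms(3)] by (intro bexI[of _ "a + (c - d)"]) auto
    show "\<exists>b\<in>M. a + d = b + c"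
      using assms(1)[OF that assms(2)[OF assms(3)]] by (intro bexI[of _ "a + - (c - d)"]) auto
  qed
  then show ?thesis unfolding r_coset_def by fastforce
qed

lemma SQ_class_eq:
  "c - d \<in> N \<Longrightarrow> SQ_class (double X) Y ra 2 c = SQ_class (double X) Y ra 2 d"
  unfolding SQ_class_def chain_group_def by (intro r_coset_eq N_add N_uminus)

lemma Q_class_eq: "c - d \<in> degenerate X Y 2 \<Longrightarrow> Q_class X Y 2 c = Q_class X Y 2 d"
  unfolding Q_class_def chain_group_def by (intro r_coset_eq degenerate_closed)

lemma Q_class_hom: "Q_class X Y 2 \<in> hom (chain_group X Y 2) (CQ X Y 2)"
  unfolding Q_class_def[abs_def] CQ_def
  by (intro normal.r_coset_hom_Mod comm_group.subgroup_imp_normal[OF comm_chain_group] degenerate_subgroup)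

lemma SQ_class_hom: "SQ_class (double X) Y ra 2 \<in> hom (chain_group (double X) Y 2) (CSQ (double X) Y ra 2)"
  unfolding SQ_class_def[abs_def] CSQ_def
  by (intro normal.r_coset_hom_Mod comm_group.subgroup_imp_normal[OF comm_chain_group] N_subgroup)

lemma group_CQ: "group (CQ X Y 2)" and group_CSQ: "group (CSQ (double X) Y ra 2)"
  unfolding CQ_def CSQ_def
  by (intro normal.factorgroup_is_group comm_group.subgroup_imp_normal[OF comm_chain_group]
      degenerate_subgroup N_subgroup)+

lemma hom_chain_diff:
  assumes h: "h \<in> hom (chain_group Q Z n) H" "group H"
    and k: "Poly_Mapping.keys a \<subseteq> chain_basis Q Z n" "Poly_Mapping.keys b \<subseteq> chain_basis Q Z n"
  shows "h (a - b) = h a \<otimes>\<^bsub>H\<^esub> inv\<^bsub>H\<^esub> h b"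
proof -
  interpret group_hom "chain_group Q Z n" H h
    using h comm_group.axioms(2)[OF comm_chain_group] by (simp add: group_hom_def group_hom_axioms_def)
  have "h (a + - b) = h a \<otimes>\<^bsub>H\<^esub> inv\<^bsub>H\<^esub> h b"
    using hom_mult[of a "- b"] hom_inv[of b] k by simp
  then show ?thesis by simp
qed

lemma hom_chain_eq:
  assumes h: "h \<in> hom (chain_group Q Z n) H" "h' \<in> hom (chain_group Q Z n) H" and H: "group H"
    and eq: "\<And>t. t \<in> chain_basis Q Z n \<Longrightarrow> h (frag_of t) = h' (frag_of t)"
    and c: "Poly_Mapping.keys c \<subseteq> chain_basis Q Z n"
  shows "h c = h' c"
proof (rule free_Abelian_group_induct[OF c])
  show "h 0 = h' 0"
    using hom_one[OF h(1) _ H] hom_one[OF h(2) _ H] comm_group.axioms(2)[OF comm_chain_group, of Q Z n] by simp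
  show "h (a - b) = h' (a - b)"
    if "Poly_Mapping.keys a \<subseteq> chain_basis Q Z n" "Poly_Mapping.keys b \<subseteq> chain_basis Q Z n" "h a = h' a" "h b = h' b" for a b
    using that hom_chain_diff[OF h(1) H that(1,2)] hom_chain_diff[OF h(2) H that(1,2)] by simp
qed (use eq in simp)

lemma lift_hom: "lift \<in> hom (chain_group X Y 2) (chain_group (double X) Y 2)"
  by (rule homI) (auto simp: keys_lift[THEN subsetD] lift_def frag_extend_add)

lemma flatten_hom: "flatten \<in> hom (chain_group (double X) Y 2) (chain_group X Y 2)"
  by (rule homI) (auto simp: keys_flatten[THEN subsetD] flatten_def frag_extend_add)

text \<open>
The definite description in \<open>double_chain_map\<close> denotes a map: \<open>flatten\<close> induces one with the
required properties, and by \<open>lift_flatten\<close> these properties determine its value on every class.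
\<close>

lemma double_chain_map_lift:
  assumes d: "Poly_Mapping.keys d \<subseteq> B"
  shows "double_chain_map X Y act 2 (SQ_class (double X) Y ra 2 (lift d)) = Q_class X Y 2 d"
proof -
  let ?C = "CSQ (double X) Y ra 2" and ?S = "SQ_class (double X) Y ra 2" and ?G = "chain_group (double X) Y 2"
  define good where "good T \<longleftrightarrow> T \<in> hom ?C (CQ X Y 2) \<and> T \<in> extensional (carrier ?C) \<and>
      (\<forall>(r, xs) \<in> B. T (?S (frag_of (r, map (\<lambda>x. (x, Pos)) xs))) = Q_class X Y 2 (frag_of (r, xs)))" for T
  have carrier_C: "carrier ?C = ?S ` carrier ?G"
    by (auto simp: CSQ_def SQ_class_def carrier_FactGroup)
  have val: "T (?S (lift c)) = Q_class X Y 2 c" if T: "good T" and c: "Poly_Mapping.keys c \<subseteq> B" for T c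
  proof -
    have "T \<circ> (?S \<circ> lift) \<in> hom (chain_group X Y 2) (CQ X Y 2)"
      using T unfolding good_def by (intro hom_compose[OF hom_compose[OF lift_hom SQ_class_hom]]) blast
    then have "(T \<circ> (?S \<circ> lift)) c = Q_class X Y 2 c"
      by (rule hom_chain_eq[OF _ Q_class_hom group_CQ _ c]) (use T in \<open>auto simp: good_def lift_def\<close>)
    then show ?thesis by simp
  qed
  have "\<exists>T. good T"
  proof -
    interpret h: group_hom ?G "CQ X Y 2" "Q_class X Y 2 \<circ> flatten"
      using hom_compose[OF flatten_hom Q_class_hom] comm_group.axioms(2)[OF comm_chain_group] group_CQ
      by (simp add: group_hom_def group_hom_axioms_def)
    have "N \<subseteq> kernel ?G (CQ X Y 2) (Q_class X Y 2 \<circ> flatten)"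
    proof
      fix c assume c: "c \<in> N"
      have "Q_class X Y 2 (flatten c) = Q_class X Y 2 0"
        using flatten_N[OF c] by (intro Q_class_eq) simp
      also have "\<dots> = \<one>\<^bsub>CQ X Y 2\<^esub>"
        using hom_one[OF Q_class_hom _ group_CQ] comm_group.axioms(2)[OF comm_chain_group, of X Y 2] by simp
      finally show "c \<in> kernel ?G (CQ X Y 2) (Q_class X Y 2 \<circ> flatten)"
        using N_keys[OF c] by (simp add: kernel_def)
    qed
    then obtain g where g: "g \<in> hom ?C (CQ X Y 2)"
      "\<And>c. c \<in> carrier ?G \<Longrightarrow> g (?S c) = Q_class X Y 2 (flatten c)"
      using h.FactGroup_universal_kernel[OF comm_group.subgroup_imp_normal[OF comm_chain_group N_subgroup]]
      unfolding CSQ_def SQ_class_def by auto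
    have "good (restrict g (carrier ?C))"
      unfolding good_def
    proof (intro conjI ballI)
      show "restrict g (carrier ?C) \<in> hom ?C (CQ X Y 2)"
        using g(1) group.is_monoid[OF group_CSQ] monoid.m_closed by (fastforce simp: hom_def)
      fix t assume t: "t \<in> B"
      then obtain r x y where t': "t = (r, [x, y])" "r \<in> Y" "x \<in> qcarrier X" "y \<in> qcarrier X" by (auto simp: B_iff)
      let ?c = "frag_of (r, [(x, Pos), (y, Pos)])"
      have c: "?c \<in> carrier ?G" using t' by (auto simp: keys_frag_of BD_iff)
      then have "?S ?c \<in> carrier ?C" unfolding carrier_C by blast
      moreover have "flatten ?c = frag_of (r, [x, y])" by (simp add: flatten_def positive_tuple_def)
      ultimately show "case t of (r, xs) \<Rightarrow> restrict g (carrier ?C) (?S (frag_of (r, map (\<lambda>x. (x, Pos)) xs))) = Q_class X Y 2 (frag_of (r, xs))"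
        using g(2)[OF c] t' by simp
    qed auto
    then show ?thesis by blast
  qed
  moreover have "T = T'" if T: "good T" "good T'" for T T'
  proof
    fix K show "T K = T' K"
    proof (cases "K \<in> carrier ?C")
      case True
      then obtain c where c: "Poly_Mapping.keys c \<subseteq> BD" "K = ?S c" unfolding carrier_C by auto
      have "K = ?S (lift (flatten c))" unfolding c(2) using lift_flatten[OF c(1)] by (rule SQ_class_eq)
      then show ?thesis using val[OF T(1) keys_flatten[OF c(1)]] val[OF T(2) keys_flatten[OF c(1)]] by simp
    next
      case False
      then show ?thesis using T unfolding good_def extensional_def by simp
    qed
  qed
  ultimately have "\<exists>!T. good T" by blast
  moreover have "double_chain_map X Y act 2 = (THE T. good T)"
    unfolding double_chain_map_def good_def Let_def by simp
  ultimately have "good (double_chain_map X Y act 2)" using theI'[of good] by simp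
  then show ?thesis by (rule val[OF _ d])
qed

lemma SQ_class_carrier: "Poly_Mapping.keys c \<subseteq> BD \<Longrightarrow> SQ_class (double X) Y ra 2 c \<in> carrier (CSQ (double X) Y ra 2)"
  using SQ_class_hom by (auto simp: hom_def)

end

section \<open>Assignments and their canonical forms\<close>

lemma all_opp: "(\<forall>a. f a) \<longleftrightarrow> (\<forall>a. f (opp a))"
  by (metis opp_opp)

lemma normal_vec_opp: "normal_vec L i t (opp e) = - normal_vec L i t e"
  by (cases e) (simp_all add: normal_vec_def rot90_def vec_eq_iff forall_2)

lemma adjacent_at_uminus: "adjacent_at L i t (- n) R1 R2 \<longleftrightarrow> adjacent_at L i t n R2 R1"
  by (auto simp: adjacent_at_def)

text \<open>
\<open>lab\<close> and \<open>dir\<close> are the label and the normal orientation that a semi-arc has after its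
label has been made positive. Basic inversions leave both unchanged.
\<close>

definition lab :: "('x \<times> sign, 'y) assignment \<Rightarrow> (real^3) set \<Rightarrow> 'x" where
  "lab c A = fst (slab c A)"

definition dir :: "('x \<times> sign, 'y) assignment \<Rightarrow> (real^3) set \<Rightarrow> sign" where
  "dir c A = (if snd (slab c A) = Pos then snor c A else opp (snor c A))"

locale colored_diagram = diagram L + double_action X Y act
  for L :: link and X :: "'x quandle" and Y :: "'y set" and act :: "'y \<Rightarrow> 'x gword set \<Rightarrow> 'y"
begin

abbreviation "asg \<equiv> assignments (double X) Y ra L"

definition typed :: "('x \<times> sign, 'y) assignment \<Rightarrow> bool" where
  "typed c \<longleftrightarrow> snor c \<in> semi_arcs L \<rightarrow>\<^sub>E UNIV \<and> slab c \<in> semi_arcs L \<rightarrow>\<^sub>E qcarrier X \<times> UNIV \<and>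
     sreg c \<in> regions L \<rightarrow>\<^sub>E Y"

text \<open>
These are the conditions on an assignment after all labels have been made positive.
\<close>

definition consistent :: "('x \<times> sign, 'y) assignment \<Rightarrow> bool" where
  "consistent c \<longleftrightarrow>
     (\<forall>(i, s, j, t) \<in> crossings L. \<forall>b.
        lab c (ends j t b) = lab c (ends j t (opp b)) \<and> dir c (ends j t b) = dir c (ends j t (opp b))) \<and>
     (\<forall>(i, s, j, t) \<in> crossings L. \<forall>b a.
        (sval a *\<^sub>R tangent L i s) \<bullet> normal_vec L j t (dir c (ends j t b)) < 0 \<longrightarrow>
        qpow X (lab c (ends i s a)) (lab c (ends j t b)) Pos = lab c (ends i s (opp a)) \<and>
        dir c (ends i s a) = dir c (ends i s (opp a))) \<and>
     (\<forall>i<ncomp L. \<forall>t. \<forall>A\<in>semi_arcs L. strand L i t \<in> A \<longrightarrow> (\<forall>R1 R2.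
        adjacent_at L i t (normal_vec L i t (dir c A)) R1 R2 \<longrightarrow> ra (sreg c R1) (lab c A, Pos) = sreg c R2))"

lemma consistent_over:
  assumes "consistent c" "(i, s, j, t) \<in> crossings L"
  shows "lab c (ends j t b) = lab c (ends j t (opp b))" "dir c (ends j t b) = dir c (ends j t (opp b))"
  using bspec[OF conjunct1[OF assms(1)[unfolded consistent_def]] assms(2)] by simp_all

lemma consistent_under:
  assumes "consistent c" "(i, s, j, t) \<in> crossings L"
    "(sval a *\<^sub>R tangent L i s) \<bullet> normal_vec L j t (dir c (ends j t b)) < 0"
  shows "qpow X (lab c (ends i s a)) (lab c (ends j t b)) Pos = lab c (ends i s (opp a))"
  using bspec[OF conjunct1[OF conjunct2[OF assms(1)[unfolded consistent_def]]] assms(2)] assms(3) by simp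

lemma consistent_regions:
  assumes "consistent c" "i < ncomp L" "A \<in> semi_arcs L" "strand L i t \<in> A"
    "adjacent_at L i t (normal_vec L i t (dir c A)) R1 R2"
  shows "ra (sreg c R1) (lab c A, Pos) = sreg c R2"
  using conjunct2[OF conjunct2[OF assms(1)[unfolded consistent_def]]] assms(2-5) by blast

lemma typed_lab: "typed c \<Longrightarrow> A \<in> semi_arcs L \<Longrightarrow> lab c A \<in> qcarrier X"
  unfolding typed_def lab_def by (metis PiE_mem mem_Times_iff)

lemma typed_reg: "typed c \<Longrightarrow> R \<in> regions L \<Longrightarrow> sreg c R \<in> Y"
  unfolding typed_def by (metis PiE_mem)

lemma over_rule:
  "z1 = (if n1 = n2 then z2 else qinv (double X) z2) \<longleftrightarrow>
   fst z1 = fst z2 \<and> (if snd z1 = Pos then n1 else opp n1) = (if snd z2 = Pos then n2 else opp n2)"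
  by (cases z1; cases z2; cases n1; cases n2; cases "snd z1"; cases "snd z2") auto

text \<open>
Inverting the over-semi-arc, whose label is \<open>(y, e)\<close>, reverses its normal, so that the two
under-ends change places, and replaces \<open>x * y\<close> by \<open>x * y\<^sup>-\<^sup>1\<close>. The two changes compensate each
other, which is the reindexing by \<open>opp\<close> in the case of a negative label. The factor \<open>w\<close> stands for
the determinant of the two tangents.
\<close>

lemma under_rule:
  assumes x: "\<And>a. fst (z a) \<in> qcarrier X" "y \<in> qcarrier X"
  shows "(\<forall>a. sval a * (sval n * w) < (0::real) \<longrightarrow>
            z a \<star>\<^bsub>double X\<^esub> (y, e) = (if m a = m (opp a) then z (opp a) else qinv (double X) (z (opp a)))) \<longleftrightarrow>
         (\<forall>a. sval a * (sval (if e = Pos then n else opp n) * w) < 0 \<longrightarrow>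
            qpow X (fst (z a)) y Pos = fst (z (opp a)) \<and>
            (if snd (z a) = Pos then m a else opp (m a)) = (if snd (z (opp a)) = Pos then m (opp a) else opp (m (opp a))))"
    (is "?l \<longleftrightarrow> ?r")
proof -
  have op: "z a \<star>\<^bsub>double X\<^esub> (y, e) = (qpow X (fst (z a)) y e, snd (z a))" for a
    by (cases "z a") simp
  have inv: "qpow X (fst (z a)) y Neg = fst (z b) \<longleftrightarrow> qpow X (fst (z b)) y Pos = fst (z a)" for a b
    using qpow_cancel[OF x(1) x(2)] by metis
  show ?thesis
  proof (cases e)
    case Pos
    then show ?thesis unfolding op over_rule by simp
  next
    case Neg
    have "?l \<longleftrightarrow> (\<forall>a. sval a * (sval n * w) < (0::real) \<longrightarrow> qpow X (fst (z (opp a))) y Pos = fst (z a) \<and>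
       (if snd (z a) = Pos then m a else opp (m a)) = (if snd (z (opp a)) = Pos then m (opp a) else opp (m (opp a))))"
      unfolding op over_rule by (simp only: Neg inv fst_conv snd_conv)
    also have "\<dots> \<longleftrightarrow> ?r" (is "(\<forall>a. ?f a) \<longleftrightarrow> (\<forall>a. ?g a)")
    proof -
      have "?f (opp a) = ?g a" for a by (auto simp: Neg)
      then show ?thesis by (intro trans[OF all_opp[of "\<lambda>a. ?f a"]] all_cong1)
    qed
    finally show ?thesis .
  qed
qed

lemma assignments_iff: "c \<in> asg \<longleftrightarrow> typed c \<and> consistent c"
proof -
  have over: "(let A1 = ends j t b; A2 = ends j t (opp b) in
        slab c A1 = (if snor c A1 = snor c A2 then slab c A2 else qinv (double X) (slab c A2))) \<longleftrightarrow>
     lab c (ends j t b) = lab c (ends j t (opp b)) \<and> dir c (ends j t b) = dir c (ends j t (opp b))" for j t b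
    by (simp only: Let_def over_rule lab_def dir_def)
  have under: "(\<forall>a. let A1 = ends i s a; A2 = ends i s (opp a); A3 = ends j t b in
        (sval a *\<^sub>R tangent L i s) \<bullet> normal_vec L j t (snor c A3) < 0 \<longrightarrow>
        slab c A1 \<star>\<^bsub>double X\<^esub> slab c A3 = (if snor c A1 = snor c A2 then slab c A2 else qinv (double X) (slab c A2))) \<longleftrightarrow>
     (\<forall>a. (sval a *\<^sub>R tangent L i s) \<bullet> normal_vec L j t (dir c (ends j t b)) < 0 \<longrightarrow>
        qpow X (lab c (ends i s a)) (lab c (ends j t b)) Pos = lab c (ends i s (opp a)) \<and>
        dir c (ends i s a) = dir c (ends i s (opp a)))"
    if c: "typed c" and k: "(i, s, j, t) \<in> crossings L" for i s j t b
  proof -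
    note i = crossing_facts(1,2)[OF k]
    have in1: "fst (slab c (ends i s a)) \<in> qcarrier X" for a
      using typed_lab[OF c semi_end_in(1)[OF i(1)]] by (simp add: lab_def)
    have in2: "fst (slab c (ends j t b)) \<in> qcarrier X"
      using typed_lab[OF c semi_end_in(1)[OF i(2)]] by (simp add: lab_def)
    have n: "(sval a *\<^sub>R tangent L i s) \<bullet> normal_vec L j t e = sval a * (sval e * det2 (tangent L j t) (tangent L i s))" for a e
      by (simp add: normal_vec_inner det2_simps)
    show ?thesis
      using under_rule[of "\<lambda>a. slab c (ends i s a)" "fst (slab c (ends j t b))" "snor c (ends j t b)"
          "det2 (tangent L j t) (tangent L i s)" "snd (slab c (ends j t b))" "\<lambda>a. snor c (ends i s a)", OF in1 in2]
      by (simp only: Let_def n lab_def dir_def prod.collapse)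
  qed
  have reg: "(\<forall>R1 R2. adjacent_at L i t (normal_vec L i t (snor c A)) R1 R2 \<longrightarrow> ra (sreg c R1) (slab c A) = sreg c R2) \<longleftrightarrow>
     (\<forall>R1 R2. adjacent_at L i t (normal_vec L i t (dir c A)) R1 R2 \<longrightarrow> ra (sreg c R1) (lab c A, Pos) = sreg c R2)"
    if c: "typed c" and A: "A \<in> semi_arcs L" for i t A
  proof (cases "snd (slab c A)")
    case Pos
    then show ?thesis by (simp add: dir_def lab_def prod_eq_iff[of "slab c A"] surjective_pairing[of "slab c A", symmetric])
       (metis Pos prod.collapse)
  next
    case Neg
    then have z: "slab c A = (lab c A, Neg)" by (simp add: lab_def prod_eq_iff)
    have d: "snor c A = opp (dir c A)" using Neg by (simp add: dir_def)
    have "ra (sreg c R1) (lab c A, Neg) = sreg c R2 \<longleftrightarrow> ra (sreg c R2) (lab c A, Pos) = sreg c R1"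
      if "R1 \<in> regions L" "R2 \<in> regions L" for R1 R2
      using ra_cancel[OF typed_reg[OF c] typed_lab[OF c A]] that by metis
    then show ?thesis
      unfolding z d normal_vec_opp adjacent_at_uminus unfolding adjacent_at_def by blast
  qed
  have "c \<in> asg \<longleftrightarrow> typed c \<and>
     (\<forall>(i, s, j, t) \<in> crossings L. \<forall>b.
        let A1 = ends j t b; A2 = ends j t (opp b) in
        slab c A1 = (if snor c A1 = snor c A2 then slab c A2 else qinv (double X) (slab c A2))) \<and>
     (\<forall>(i, s, j, t) \<in> crossings L. \<forall>b. \<forall>a.
        let A1 = ends i s a; A2 = ends i s (opp a); A3 = ends j t b in
        (sval a *\<^sub>R tangent L i s) \<bullet> normal_vec L j t (snor c A3) < 0 \<longrightarrow>
        slab c A1 \<star>\<^bsub>double X\<^esub> slab c A3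
          = (if snor c A1 = snor c A2 then slab c A2 else qinv (double X) (slab c A2))) \<and>
     (\<forall>i<ncomp L. \<forall>t. \<forall>A\<in>semi_arcs L. strand L i t \<in> A \<longrightarrow> (\<forall>R1 R2.
        adjacent_at L i t (normal_vec L i t (snor c A)) R1 R2 \<longrightarrow> ra (sreg c R1) (slab c A) = sreg c R2))"
    unfolding assignments_def typed_def double_simps mem_Collect_eq conj_assoc
    by (intro conj_cong refl)
       (rule ball_cong[OF refl], simp only: split_paired_all prod.case, rule all_comm,
        rule all_cong1, rule imp_cong[OF refl], rule all_cong1, rule ball_cong[OF refl], blast)
  also have "\<dots> \<longleftrightarrow> typed c \<and> consistent c"
    unfolding consistent_def
  proof (intro conj_cong refl)
    assume c: "typed c"
    show "(\<forall>(i, s, j, t) \<in> crossings L. \<forall>b.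
        let A1 = ends j t b; A2 = ends j t (opp b) in
        slab c A1 = (if snor c A1 = snor c A2 then slab c A2 else qinv (double X) (slab c A2))) \<longleftrightarrow>
      (\<forall>(i, s, j, t) \<in> crossings L. \<forall>b.
        lab c (ends j t b) = lab c (ends j t (opp b)) \<and> dir c (ends j t b) = dir c (ends j t (opp b)))"
      by (simp only: over)
    show "(\<forall>(i, s, j, t) \<in> crossings L. \<forall>b. \<forall>a.
        let A1 = ends i s a; A2 = ends i s (opp a); A3 = ends j t b in
        (sval a *\<^sub>R tangent L i s) \<bullet> normal_vec L j t (snor c A3) < 0 \<longrightarrow>
        slab c A1 \<star>\<^bsub>double X\<^esub> slab c A3
          = (if snor c A1 = snor c A2 then slab c A2 else qinv (double X) (slab c A2))) \<longleftrightarrow>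
      (\<forall>(i, s, j, t) \<in> crossings L. \<forall>b a.
        (sval a *\<^sub>R tangent L i s) \<bullet> normal_vec L j t (dir c (ends j t b)) < 0 \<longrightarrow>
        qpow X (lab c (ends i s a)) (lab c (ends j t b)) Pos = lab c (ends i s (opp a)) \<and>
        dir c (ends i s a) = dir c (ends i s (opp a)))" (is "(\<forall>k\<in>_. ?l k) \<longleftrightarrow> (\<forall>k\<in>_. ?r k)")
    proof (rule ball_cong[OF refl])
      fix k assume "k \<in> crossings L"
      then obtain i s j t where "k = (i, s, j, t)" "(i, s, j, t) \<in> crossings L" by (cases k) auto
      then show "?l k \<longleftrightarrow> ?r k" using under[OF c, of i s j t] by (simp only: prod.case)
    qed
    show "(\<forall>i<ncomp L. \<forall>t. \<forall>A\<in>semi_arcs L. strand L i t \<in> A \<longrightarrow> (\<forall>R1 R2.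
        adjacent_at L i t (normal_vec L i t (snor c A)) R1 R2 \<longrightarrow> ra (sreg c R1) (slab c A) = sreg c R2)) \<longleftrightarrow>
      (\<forall>i<ncomp L. \<forall>t. \<forall>A\<in>semi_arcs L. strand L i t \<in> A \<longrightarrow> (\<forall>R1 R2.
        adjacent_at L i t (normal_vec L i t (dir c A)) R1 R2 \<longrightarrow> ra (sreg c R1) (lab c A, Pos) = sreg c R2))"
      by (rule all_cong1, rule imp_cong[OF refl], rule all_cong1, rule ball_cong[OF refl],
          rule imp_cong[OF refl], rule reg[OF c])
  qed
  finally show ?thesis .
qed

definition canon :: "('x \<times> sign, 'y) assignment \<Rightarrow> ('x \<times> sign, 'y) assignment" where
  "canon c = c\<lparr>snor := \<lambda>A. if A \<in> semi_arcs L then dir c A else snor c A,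
               slab := \<lambda>A. if A \<in> semi_arcs L then (lab c A, Pos) else slab c A\<rparr>"

definition positive :: "('x \<times> sign, 'y) assignment \<Rightarrow> bool" where
  "positive c \<longleftrightarrow> (\<forall>A\<in>semi_arcs L. snd (slab c A) = Pos)"

lemma canon_simps:
  "sreg (canon c) = sreg c"
  "A \<in> semi_arcs L \<Longrightarrow> snor (canon c) A = dir c A"
  "A \<in> semi_arcs L \<Longrightarrow> slab (canon c) A = (lab c A, Pos)"
  "A \<in> semi_arcs L \<Longrightarrow> dir (canon c) A = dir c A"
  "A \<in> semi_arcs L \<Longrightarrow> lab (canon c) A = lab c A"
  by (simp_all add: canon_def dir_def lab_def)

lemma canon_positive: "positive (canon c)"
  by (simp add: positive_def canon_def)

lemma canon_of_positive:
  assumes "positive c" shows "canon c = c"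
proof -
  have "(lab c A, Pos) = slab c A" "dir c A = snor c A" if "A \<in> semi_arcs L" for A
    using assms that by (auto simp: positive_def lab_def dir_def prod_eq_iff)
  then have "(\<lambda>A. if A \<in> semi_arcs L then dir c A else snor c A) = snor c"
    "(\<lambda>A. if A \<in> semi_arcs L then (lab c A, Pos) else slab c A) = slab c" by auto
  then show ?thesis by (simp add: canon_def)
qed

lemma consistent_cong:
  assumes "\<And>A. A \<in> semi_arcs L \<Longrightarrow> lab c A = lab c' A" "\<And>A. A \<in> semi_arcs L \<Longrightarrow> dir c A = dir c' A" "sreg c = sreg c'"
  shows "consistent c \<longleftrightarrow> consistent c'"
proof -
  have e: "lab c (ends i s a) = lab c' (ends i s a)" "dir c (ends i s a) = dir c' (ends i s a)" if "i < ncomp L" for i s a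
    using assms(1,2) semi_end_in(1)[OF that] by blast+
  show ?thesis unfolding consistent_def
    using e crossing_facts(1,2) assms
    by (intro arg_cong2[of _ _ _ _ "(\<and>)"] ball_cong refl) (auto simp: e crossing_facts(1,2))
qed

lemma canon_in: assumes "c \<in> asg" shows "canon c \<in> asg"
proof -
  have c: "typed c" "consistent c" using assms assignments_iff by auto
  have "typed (canon c)"
    using c(1) typed_lab[OF c(1)] unfolding typed_def canon_def by (auto simp: PiE_iff extensional_def)
  moreover have "consistent (canon c)"
    using c(2) consistent_cong[of "canon c" c] canon_simps by simp
  ultimately show ?thesis using assignments_iff by blast
qed

lemma canon_inversion:
  assumes "basic_inversion (double X) L c c'" shows "canon c' = canon c"
proof -
  obtain A where A: "A \<in> semi_arcs L"
    "c' = c\<lparr>snor := (snor c)(A := opp (snor c A)), slab := (slab c)(A := qinv (double X) (slab c A))\<rparr>"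
    using assms unfolding basic_inversion_def by blast
  obtain x e where z: "slab c A = (x, e)" by (cases "slab c A")
  have "dir c' B = dir c B" "lab c' B = lab c B" for B
    by (cases e; simp add: A(2) dir_def lab_def z)+
  then show ?thesis using A(1) by (auto simp: canon_def A(2) fun_eq_iff)
qed

lemma canon_equivclp: "equivclp (basic_inversion (double X) L) c c' \<Longrightarrow> canon c = canon c'"
  by (induction rule: equivclp_induct) (auto dest: canon_inversion)

definition partial_canon where
  "partial_canon Z c = c\<lparr>snor := \<lambda>A. if A \<in> Z then dir c A else snor c A,
               slab := \<lambda>A. if A \<in> Z then (lab c A, Pos) else slab c A\<rparr>"

text \<open>
The negative semi-arcs are inverted one after the other, which terminates because there are
only finitely many semi-arcs.
\<close>

lemma equivclp_canon: "equivclp (basic_inversion (double X) L) c (canon c)"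
proof -
  have "equivclp (basic_inversion (double X) L) c (partial_canon Z c)" if "finite Z" "Z \<subseteq> semi_arcs L" for Z
    using that
  proof (induction Z)
    case empty
    show ?case by (simp add: partial_canon_def)
  next
    case (insert A Z)
    let ?c = "partial_canon Z c"
    have eq: "partial_canon (insert A Z) c = ?c\<lparr>snor := (snor ?c)(A := dir c A), slab := (slab ?c)(A := (lab c A, Pos))\<rparr>"
      by (auto simp: partial_canon_def fun_eq_iff)
    have at: "snor ?c A = snor c A" "slab ?c A = slab c A" using insert.hyps by (simp_all add: partial_canon_def)
    obtain x e where z: "slab c A = (x, e)" by (cases "slab c A")
    show ?case
    proof (cases e)
      case Pos
      then have "(snor ?c)(A := dir c A) = snor ?c" "(slab ?c)(A := (lab c A, Pos)) = slab ?c"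
        using at z by (auto simp: dir_def lab_def fun_eq_iff)
      then show ?thesis using insert eq by simp
    next
      case Neg
      then have "basic_inversion (double X) L ?c (partial_canon (insert A Z) c)"
        unfolding basic_inversion_def eq using insert.prems z at
        by (intro bexI[of _ A]) (auto simp: dir_def lab_def)
      then show ?thesis using insert by (auto intro: equivclp_into_equivclp)
    qed
  qed
  from this[OF finite_semi_arcs subset_refl] show ?thesis by (simp add: partial_canon_def canon_def)
qed

definition inv_class where "inv_class c = {c' \<in> asg. canon c' = c}"

text \<open>
Two assignments are equivalent iff they have the same \<open>canon\<close>.
\<close>

lemma Col_sym_eq: "Col_sym (double X) Y ra L = inv_class ` {c \<in> asg. positive c}"
proof -
  let ?rel = "{(c, c'). c \<in> asg \<and> c' \<in> asg \<and> equivclp (basic_inversion (double X) L) c c'}"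
  have rel: "equivclp (basic_inversion (double X) L) c c' \<longleftrightarrow> canon c = canon c'" for c c' :: "('x \<times> sign, 'y) assignment"
    using canon_equivclp equivclp_canon[of c] equivclp_canon[of c'] by (metis equivclp_sym equivclp_trans)
  have "?rel `` {c} = inv_class (canon c)" if "c \<in> asg" for c
    using that by (auto simp: rel inv_class_def)
  moreover have "c = canon c" if "positive c" for c using canon_of_positive[OF that] by simp
  ultimately show ?thesis
    unfolding Col_sym_def quotient_def using canon_in canon_positive by (auto simp: image_iff)
qed

lemma canonical_form_inv_class:
  assumes "c \<in> asg" "positive c" shows "canonical_form L (inv_class c) = c"
  unfolding canonical_form_def positive_def[symmetric]
proof (rule the_equality)
  show "c \<in> inv_class c \<and> positive c" using assms canon_of_positive by (simp add: inv_class_def)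
  show "c' = c" if "c' \<in> inv_class c \<and> positive c'" for c'
    using that canon_of_positive[of c'] by (simp add: inv_class_def)
qed

section \<open>From colorings to canonical forms\<close>

definition strand_index where "strand_index A = (THE i. i < ncomp L \<and> A \<subseteq> range (strand L i))"

lemma strand_index_eqI:
  assumes A: "A \<in> semi_arcs L" and i: "i < ncomp L" "A \<subseteq> range (strand L i)"
  shows "strand_index A = i"
  unfolding strand_index_def
proof (rule the_equality)
  fix j assume j: "j < ncomp L \<and> A \<subseteq> range (strand L j)"
  obtain p where p: "p \<in> A" using pieces_in(2) A semi_arcs_pieces by blast
  then obtain t where "p = strand L i t" using i by blast
  then show "j = i" using strand_of_piece_unique[of A _ j i t] A semi_arcs_pieces j i p by blast
qed (use i in blast)

lemma strand_index_end: "i < ncomp L \<Longrightarrow> strand_index (ends i s e) = i"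
  using strand_index_eqI semi_end_in(1) semi_end_in_strand by blast

lemma strand_index_in:
  assumes "A \<in> semi_arcs L" shows "strand_index A < ncomp L" "A \<subseteq> range (strand L (strand_index A))"
proof -
  obtain i where "i < ncomp L" "A \<subseteq> range (strand L i)" using piece_in_strand assms semi_arcs_pieces by metis
  then show "strand_index A < ncomp L" "A \<subseteq> range (strand L (strand_index A))"
    using strand_index_eqI[OF assms] by auto
qed

lemma strand_index_point:
  assumes A: "A \<in> semi_arcs L" and i: "i < ncomp L" "strand L i t \<in> A"
  shows "strand_index A = i"
  using strand_of_piece_unique[of A _ "strand_index A" i t] strand_index_in[OF A] assms semi_arcs_pieces by blast

definition oriented :: "orientation \<Rightarrow> ('x \<times> sign, 'y) assignment set" where
  "oriented ori = {c \<in> asg. positive c \<and> (\<forall>A\<in>semi_arcs L. snor c A = ori (strand_index A))}"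

lemma induces_iff:
  assumes "c \<in> asg" "positive c"
  shows "induces_orientation L (inv_class c) ori \<longleftrightarrow> (\<forall>A\<in>semi_arcs L. snor c A = ori (strand_index A))"
  unfolding induces_orientation_def canonical_form_inv_class[OF assms]
  using strand_index_eqI strand_index_in by metis

text \<open>
Two orientations induced by \<open>C\<close> agree on every component that contains a semi-arc, so the
orientation that witnesses \<open>same_ori\<close> may be replaced by \<open>ori\<close>.
\<close>

lemma ori_class_eq:
  assumes C: "C \<in> Col_sym (double X) Y ra L" "induces_orientation L C ori"
  shows "ori_class X Y ra L C = inv_class ` oriented ori"
proof -
  obtain c where c: "c \<in> asg" "positive c" "C = inv_class c" using C(1) unfolding Col_sym_eq by blast
  have "same_ori L C (inv_class c') \<longleftrightarrow> (\<forall>A\<in>semi_arcs L. snor c' A = ori (strand_index A))"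
    if "c' \<in> asg" "positive c'" for c'
    unfolding same_ori_def c(3) using induces_iff[OF c(1,2)] induces_iff[OF that] C(2) c(3) by metis
  then show ?thesis unfolding ori_class_def Col_sym_eq oriented_def by blast
qed

lemma inj_inv_class: "inj_on inv_class (oriented ori)"
  by (rule inj_on_inverseI[of _ "canonical_form L"]) (auto simp: oriented_def canonical_form_inv_class)

definition to_assignment :: "orientation \<Rightarrow> ('x, 'y) coloring \<Rightarrow> ('x \<times> sign, 'y) assignment" where
  "to_assignment ori C = \<lparr>snor = (\<lambda>A\<in>semi_arcs L. ori (strand_index A)),
     slab = (\<lambda>A\<in>semi_arcs L. (alab C (arc_of A), Pos)), sreg = areg C\<rparr>"

abbreviation "colorings ori \<equiv> Col_XY X Y (gact X act) L ori"

lemma to_assignment_simps: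
  "A \<in> semi_arcs L \<Longrightarrow> snor (to_assignment ori C) A = ori (strand_index A)"
  "A \<in> semi_arcs L \<Longrightarrow> slab (to_assignment ori C) A = (alab C (arc_of A), Pos)"
  "A \<in> semi_arcs L \<Longrightarrow> dir (to_assignment ori C) A = ori (strand_index A)"
  "A \<in> semi_arcs L \<Longrightarrow> lab (to_assignment ori C) A = alab C (arc_of A)"
  "sreg (to_assignment ori C) = areg C"
  by (simp_all add: to_assignment_def dir_def lab_def)

lemma coloring_iff_consistent:
  assumes t: "alab C \<in> arcs L \<rightarrow>\<^sub>E qcarrier X" "areg C \<in> regions L \<rightarrow>\<^sub>E Y"
  shows "C \<in> colorings ori \<longleftrightarrow> consistent (to_assignment ori C)"
proof -
  let ?c = "to_assignment ori C"
  have crossing_ends: "lab ?c (ends i s a) = alab C (arc_ends i s a)" "dir ?c (ends i s a) = ori i"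
      "lab ?c (ends j t b) = alab C (arc_through L j t)" "dir ?c (ends j t b) = ori j"
    if k: "(i, s, j, t) \<in> crossings L" for i s j t a b
  proof -
    note f = crossing_facts[OF k]
    have "strand L j t \<notin> under_points L" using f(6) under_over_disjoint by blast
    then show "lab ?c (ends i s a) = alab C (arc_ends i s a)" "dir ?c (ends i s a) = ori i"
      "lab ?c (ends j t b) = alab C (arc_through L j t)" "dir ?c (ends j t b) = ori j"
      using semi_end_in(1) f(1,2)
      by (simp_all add: to_assignment_simps arc_of_end[OF f(1)] arc_of_over_end strand_index_end)
  qed
  have under: "(\<forall>(i, s, j, t) \<in> crossings L. \<forall>b a.
        (sval a *\<^sub>R tangent L i s) \<bullet> normal_vec L j t (dir ?c (ends j t b)) < 0 \<longrightarrow>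
        qpow X (lab ?c (ends i s a)) (lab ?c (ends j t b)) Pos = lab ?c (ends i s (opp a)) \<and>
        dir ?c (ends i s a) = dir ?c (ends i s (opp a))) \<longleftrightarrow>
      (\<forall>(i, s, j, t) \<in> crossings L. \<forall>a.
        (sval a *\<^sub>R tangent L i s) \<bullet> normal_vec L j t (ori j) < 0 \<longrightarrow>
        alab C (end_at L (arcs L) i s a) \<star>\<^bsub>X\<^esub> alab C (arc_through L j t)
          = alab C (end_at L (arcs L) i s (opp a)))"
    by (intro ball_cong refl) (auto simp: crossing_ends qpow_def)
  have reg: "(\<forall>i<ncomp L. \<forall>t. \<forall>A\<in>semi_arcs L. strand L i t \<in> A \<longrightarrow> (\<forall>R1 R2.
        adjacent_at L i t (normal_vec L i t (dir ?c A)) R1 R2 \<longrightarrow> ra (sreg ?c R1) (lab ?c A, Pos) = sreg ?c R2)) \<longleftrightarrow>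
      (\<forall>i<ncomp L. \<forall>t. \<forall>A\<in>arcs L. \<forall>R1 R2. strand L i t \<in> A \<longrightarrow>
        adjacent_at L i t (normal_vec L i t (ori i)) R1 R2 \<longrightarrow> gact X act (areg C R1) (alab C A) = areg C R2)"
    (is "?l \<longleftrightarrow> ?r")
  proof (intro iffI allI impI ballI)
    fix i t A R1 R2
    assume l: ?l and i: "i < ncomp L" and A: "A \<in> arcs L" "strand L i t \<in> A"
      and adj: "adjacent_at L i t (normal_vec L i t (ori i)) R1 R2"
    have "strand L i t \<in> link_points L - (under_points L \<union> over_points L)"
      using adj in_link[OF i] by (auto simp: adjacent_at_def)
    then obtain A' where A': "A' \<in> semi_arcs L" "strand L i t \<in> A'" using pieces_cover semi_arcs_pieces by metis
    have "arc_of A' = A" using arc_of_eqI[OF A'(1) A(1) A'(2) A(2)] by blast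
    moreover have "alab C A \<in> qcarrier X" using t(1) A(1) by (metis PiE_mem)
    moreover have "ra (sreg ?c R1) (lab ?c A', Pos) = sreg ?c R2"
      using l[rule_format, OF i A', of R1 R2] adj
      by (simp add: to_assignment_simps A' strand_index_point[OF A'(1) i A'(2)])
    ultimately show "gact X act (areg C R1) (alab C A) = areg C R2"
      by (simp add: to_assignment_simps A' ra_Pos)
  next
    fix i t A R1 R2
    assume r: ?r and i: "i < ncomp L" and A: "A \<in> semi_arcs L" "strand L i t \<in> A"
      and adj: "adjacent_at L i t (normal_vec L i t (dir ?c A)) R1 R2"
    have "alab C (arc_of A) \<in> qcarrier X" using t(1) arc_of_in[OF A(1)] by (metis PiE_mem)
    moreover have "strand L i t \<in> arc_of A" using arc_of_in[OF A(1)] A(2) by blast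
    ultimately show "ra (sreg ?c R1) (lab ?c A, Pos) = sreg ?c R2"
      using r[rule_format, OF i, of "arc_of A" t R1 R2] adj arc_of_in[OF A(1)]
      by (simp add: to_assignment_simps A strand_index_point[OF A(1) i A(2)] ra_Pos)
  qed
  have over: "\<forall>(i, s, j, t) \<in> crossings L. \<forall>b.
        lab ?c (ends j t b) = lab ?c (ends j t (opp b)) \<and> dir ?c (ends j t b) = dir ?c (ends j t (opp b))"
    by (auto simp: crossing_ends)
  show ?thesis unfolding consistent_def Col_XY_def mem_Collect_eq under reg using over t by blast
qed

lemma to_assignment_oriented:
  assumes C: "C \<in> colorings ori" shows "to_assignment ori C \<in> oriented ori"
proof -
  have t: "alab C \<in> arcs L \<rightarrow>\<^sub>E qcarrier X" "areg C \<in> regions L \<rightarrow>\<^sub>E Y"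
    using C by (auto simp: Col_XY_def)
  have "typed (to_assignment ori C)"
    using t arc_of_in(1) unfolding typed_def to_assignment_def by (auto simp: PiE_iff)
  then show ?thesis
    using coloring_iff_consistent[OF t] C assignments_iff
    by (simp add: oriented_def positive_def to_assignment_simps)
qed

text \<open>
Injectivity holds because every arc contains a semi-arc, surjectivity because of \<open>constant_on_arcs\<close>.
\<close>

lemma bij_to_assignment: "bij_betw (to_assignment ori) (colorings ori) (oriented ori)"
proof (rule bij_betwI')
  fix C C' assume C: "C \<in> colorings ori" "C' \<in> colorings ori"
  show "to_assignment ori C = to_assignment ori C' \<longleftrightarrow> C = C'"
  proof
    assume eq: "to_assignment ori C = to_assignment ori C'"
    have "alab C B = alab C' B" if B: "B \<in> arcs L" for B
    proof -
      obtain A where A: "A \<in> semi_arcs L" "arc_of A = B" using arc_of_surj[OF B] by blast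
      then show ?thesis using to_assignment_simps(4)[OF A(1), of ori C] to_assignment_simps(4)[OF A(1), of ori C'] eq by simp
    qed
    moreover have "alab C \<in> extensional (arcs L)" "alab C' \<in> extensional (arcs L)"
      using C by (auto simp: Col_XY_def PiE_iff)
    ultimately have "alab C = alab C'" by (metis extensionalityI)
    moreover have "areg C = areg C'" using to_assignment_simps(5) eq by metis
    ultimately show "C = C'" by simp
  qed simp
next
  fix c assume c: "c \<in> oriented ori"
  then have asg: "c \<in> asg" "typed c" "consistent c" "positive c" and o: "\<And>A. A \<in> semi_arcs L \<Longrightarrow> snor c A = ori (strand_index A)"
    using assignments_iff by (auto simp: oriented_def)
  define C :: "('x, 'y) coloring" where
    "C = \<lparr>alab = (\<lambda>B\<in>arcs L. lab c (SOME A. A \<in> semi_arcs L \<and> arc_of A = B)), areg = sreg c\<rparr>"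
  have some: "(SOME A. A \<in> semi_arcs L \<and> arc_of A = B) \<in> semi_arcs L \<and> arc_of (SOME A. A \<in> semi_arcs L \<and> arc_of A = B) = B"
    if "B \<in> arcs L" for B
    using someI_ex[of "\<lambda>A. A \<in> semi_arcs L \<and> arc_of A = B"] arc_of_surj[OF that] by blast
  have const: "lab c A = alab C (arc_of A)" if A: "A \<in> semi_arcs L" for A
  proof -
    have B: "arc_of A \<in> arcs L" using arc_of_in(1)[OF A] .
    have "lab c A = lab c (SOME A'. A' \<in> semi_arcs L \<and> arc_of A' = arc_of A)"
    proof (rule constant_on_arcs)
      show "lab c (ends j t Pos) = lab c (ends j t Neg)" if "(i, s, j, t) \<in> crossings L" for i s j t
        using consistent_over(1)[OF asg(3) that, of Pos] by simp
    qed (use some[OF B] A in auto)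
    then show ?thesis using B by (simp add: C_def)
  qed
  have t: "alab C \<in> arcs L \<rightarrow>\<^sub>E qcarrier X" "areg C \<in> regions L \<rightarrow>\<^sub>E Y"
    using some typed_lab[OF asg(2)] asg(2) by (auto simp: C_def typed_def)
  have pos: "slab c A = (lab c A, Pos)" if "A \<in> semi_arcs L" for A
    using asg(4) that by (simp add: positive_def lab_def prod_eq_iff)
  have "snor (to_assignment ori C) = snor c"
    using asg(2) o unfolding typed_def
    by (intro extensionalityI[of _ "semi_arcs L"]) (auto simp: to_assignment_def PiE_iff)
  moreover have "slab (to_assignment ori C) = slab c"
    using asg(2) pos const unfolding typed_def
    by (intro extensionalityI[of _ "semi_arcs L"]) (auto simp: to_assignment_def PiE_iff)
  moreover have "sreg (to_assignment ori C) = sreg c" by (simp add: to_assignment_def C_def)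
  ultimately have eq: "to_assignment ori C = c" by simp
  then have "C \<in> colorings ori" using coloring_iff_consistent[OF t] asg(3) by simp
  then show "\<exists>C\<in>colorings ori. c = to_assignment ori C" using eq by blast
qed (rule to_assignment_oriented)

end

section \<open>Weights\<close>

context diagram begin

lemma quadrant_sides:
  assumes "(i, s, j, t) \<in> crossings L"
  shows "quadrant L (i, s, j, t) a b \<bullet> normal_vec L i s e = sval e * sval b * det2 (tangent L i s) (tangent L j t)"
    and "quadrant L (i, s, j, t) a b \<bullet> normal_vec L j t e = - (sval e * sval a * det2 (tangent L i s) (tangent L j t))"
    and "(sval a *\<^sub>R tangent L i s) \<bullet> normal_vec L j t e = - (sval e * sval a * det2 (tangent L i s) (tangent L j t))"
    and "(sval b *\<^sub>R tangent L j t) \<bullet> normal_vec L i s e = sval e * sval b * det2 (tangent L i s) (tangent L j t)"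
    and "hand_sign (normal_vec L j t e) (normal_vec L i s d) =
           (if sval e * sval d * det2 (tangent L i s) (tangent L j t) < 0 then Pos else Neg)"
proof -
  note commute = det2_commute[of "tangent L j t" "tangent L i s"]
  show "quadrant L (i, s, j, t) a b \<bullet> normal_vec L i s e = sval e * sval b * det2 (tangent L i s) (tangent L j t)"
    "quadrant L (i, s, j, t) a b \<bullet> normal_vec L j t e = - (sval e * sval a * det2 (tangent L i s) (tangent L j t))"
    by (simp_all only: quadrant_def prod.case normal_vec_inner det2_simps commute) simp_all
  show "(sval a *\<^sub>R tangent L i s) \<bullet> normal_vec L j t e = - (sval e * sval a * det2 (tangent L i s) (tangent L j t))"
    "(sval b *\<^sub>R tangent L j t) \<bullet> normal_vec L i s e = sval e * sval b * det2 (tangent L i s) (tangent L j t)"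
    by (simp_all only: normal_vec_inner det2_simps commute)
  show "hand_sign (normal_vec L j t e) (normal_vec L i s d) =
           (if sval e * sval d * det2 (tangent L i s) (tangent L j t) < 0 then Pos else Neg)"
    by (cases e; cases d)
       (simp_all add: hand_sign_def right_handed_def normal_vec_def det2_rot90 det2_simps commute)
qed

lemma quadrant_region_facts:
  assumes k: "(i, s, j, t) \<in> crossings L"
  shows "quadrant_region L (i, s, j, t) a b \<in> regions L" (is ?A)
    and "runs_into (\<gamma> i s) (quadrant L (i, s, j, t) a b) (quadrant_region L (i, s, j, t) a b)" (is ?B)
proof -
  let ?v = "quadrant L (i, s, j, t) a b"
  note f = crossing_facts[OF k]
  have "det2 (tangent L i s) ?v \<noteq> 0" "det2 (tangent L j t) ?v \<noteq> 0"
    using f(7) det2_commute[of "tangent L j t" "tangent L i s"]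
    by (cases a; cases b; simp add: quadrant_def det2_simps)+
  then obtain R \<rho> \<eta> where R: "R \<in> regions L" "0 < \<eta>" "0 < \<rho>"
    "\<And>h w. 0 < h \<Longrightarrow> h < \<eta> \<Longrightarrow> dist ?v w \<le> \<rho> \<Longrightarrow> \<gamma> i s + h *\<^sub>R w \<in> R"
    by (rule crossing_sector[OF f(1,2) refl f(3)[symmetric] f(4)]) blast
  have r: "runs_into (\<gamma> i s) ?v R" using R by (intro runs_intoI[of \<eta>]) auto
  have "quadrant_region L (i, s, j, t) a b = R"
    unfolding quadrant_region_def prod.case
    using R(1) r runs_into_unique by (intro the_equality) auto
  then show ?A ?B using R(1) r by simp_all
qed

end

lemma (in diagram) semi_arc_avoids:
  "A \<in> semi_arcs L \<Longrightarrow> A \<inter> (under_points L \<union> over_points L) = {}"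
  using pieces_in(1)[of A "under_points L \<union> over_points L"] semi_arcs_pieces by blast

context colored_diagram begin

text \<open>
The two quadrants are adjacent along the semi-arc that forms the end \<open>b\<close> of the strand \<open>j\<close>,
at all of its points that are sufficiently close to the crossing.
\<close>

lemma label_across:
  assumes i: "i < ncomp L" "j < ncomp L" and z: "\<gamma> i s = z" "\<gamma> j t = z" and ne: "strand L i s \<noteq> strand L j t"
    and c: "consistent c"
    and R: "R \<in> regions L" "runs_into z (sval a *\<^sub>R tangent L i s + sval b *\<^sub>R tangent L j t) R"
    and R': "R' \<in> regions L" "runs_into z (sval (opp a) *\<^sub>R tangent L i s + sval b *\<^sub>R tangent L j t) R'"
    and side: "(sval a *\<^sub>R tangent L i s) \<bullet> normal_vec L j t (dir c (ends j t b)) < 0"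
  shows "sreg c R' = ra (sreg c R) (lab c (ends j t b), Pos)"
proof -
  let ?A = "ends j t b" and ?e = "dir c (ends j t b)"
  have s1: "(sval a *\<^sub>R tangent L i s) \<bullet> normal_vec L j t (opp ?e) > 0"
    using side by (simp add: normal_vec_opp)
  have s2: "(sval (opp a) *\<^sub>R tangent L i s) \<bullet> normal_vec L j t ?e > 0"
    using side by simp
  have "\<forall>\<^sub>F u in at_right 0. runs_into (\<gamma> j (t + sval b * u)) (normal_vec L j (t + sval b * u) (opp ?e)) R \<and>
      runs_into (\<gamma> j (t + sval b * u)) (normal_vec L j (t + sval b * u) ?e) R' \<and> strand L j (t + sval b * u) \<in> ?A"
    using quadrant_side[OF i z ne R s1] quadrant_side[OF i z ne R' s2] semi_end_in(2)[OF i(2), of t b]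
    by (intro eventually_conj)
  then obtain u where u: "runs_into (\<gamma> j (t + sval b * u)) (normal_vec L j (t + sval b * u) (opp ?e)) R"
      "runs_into (\<gamma> j (t + sval b * u)) (normal_vec L j (t + sval b * u) ?e) R'" "strand L j (t + sval b * u) \<in> ?A"
    using eventually_happens'[OF trivial_limit_at_right_real] by blast
  have A: "?A \<in> semi_arcs L" using semi_end_in(1)[OF i(2)] .
  have "strand L j (t + sval b * u) \<notin> under_points L \<union> over_points L"
    using semi_arc_avoids[OF A] u(3) by blast
  then have "adjacent_at L j (t + sval b * u) (normal_vec L j (t + sval b * u) ?e) R R'"
    using u R(1) R'(1) by (auto simp: adjacent_at_def normal_vec_opp)
  from consistent_regions[OF c i(2) A u(3) this] show ?thesis by simp
qed

lemma N_cmul: "c \<in> N \<Longrightarrow> frag_cmul (sval e) c \<in> N"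
  using N_uminus by (cases e) auto

text \<open>
In canonical form there is exactly one quadrant \<open>(a0, b0)\<close> from which both normals
point, and it yields the oriented weight. A representative in which the over- or the
under-semi-arc has a negative label requires the quadrant on the other side of this strand.
There the label of the region and those of the strands are the ones in the second summand of a
generator of \<open>N\<close>, and the sign of the crossing changes once for each negative label. If both
labels are negative, two generators are used in succession.
\<close>

lemma weight_classes:
  assumes C: "C \<in> colorings ori" and k: "k \<in> crossings L"
  shows "Poly_Mapping.keys (weight_XY L ori C k) \<subseteq> B"
    and "weights_sym L (inv_class (to_assignment ori C)) k \<noteq> {}"
    and "w \<in> weights_sym L (inv_class (to_assignment ori C)) k \<Longrightarrow> w - lift (weight_XY L ori C k) \<in> N"
proof -
  let ?c = "to_assignment ori C"
  obtain i s j t where k': "k = (i, s, j, t)" by (cases k)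
  note kc = k[unfolded k']
  note f = crossing_facts[OF kc]
  have c: "?c \<in> asg" "positive ?c" using to_assignment_oriented[OF C] by (auto simp: oriented_def)
  then have c': "typed ?c" "consistent ?c" using assignments_iff by auto
  define D where "D = det2 (tangent L i s) (tangent L j t)"
  have D: "D \<noteq> 0" using f(7) by (simp add: D_def)
  note sides = quadrant_sides[OF kc, folded D_def]
  \<comment> \<open>By \<open>sides\<close>, both normals point from the quadrant \<open>(a, b)\<close> iff the two products below have these
    signs, and each sign condition singles out one end of a strand.\<close>
  define a0 where "a0 = (if sval (ori j) * D > 0 then Pos else Neg)"
  define b0 where "b0 = (if sval (ori i) * D < 0 then Pos else Neg)"
  have a0: "sval (ori j) * sval a * D > 0 \<longleftrightarrow> a = a0" for a
    using D by (cases a; cases "ori j") (auto simp: a0_def)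
  have b0: "sval (ori i) * sval b * D < 0 \<longleftrightarrow> b = b0" for b
    using D by (cases b; cases "ori i") (auto simp: b0_def)
  have ends: "dir ?c (ends i s a) = ori i" "dir ?c (ends j t b) = ori j"
      "alab C (arc_ends i s a) = lab ?c (ends i s a)" "alab C (arc_through L j t) = lab ?c (ends j t b)" for a b
  proof -
    have "strand L j t \<notin> under_points L" using f(6) under_over_disjoint by blast
    then show "dir ?c (ends i s a) = ori i" "dir ?c (ends j t b) = ori j"
      "alab C (arc_ends i s a) = lab ?c (ends i s a)" "alab C (arc_through L j t) = lab ?c (ends j t b)"
      using semi_end_in(1) f(1,2)
      by (simp_all add: to_assignment_simps arc_of_end[OF f(1)] arc_of_over_end strand_index_end)
  qed
  define \<epsilon> where "\<epsilon> = hand_sign (normal_vec L j t (ori j)) (normal_vec L i s (ori i))"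
  define Q where "Q a b = quadrant_region L (i, s, j, t) a b" for a b
  define r where "r = sreg ?c (Q a0 b0)"
  define x where "x = lab ?c (ends i s a0)"
  define y where "y = lab ?c (ends j t Pos)"
  have Q: "Q a b \<in> regions L" "runs_into (\<gamma> i s) (sval a *\<^sub>R tangent L i s + sval b *\<^sub>R tangent L j t) (Q a b)" for a b
    using quadrant_region_facts[OF kc, of a b] by (simp_all add: Q_def quadrant_def)
  have y: "lab ?c (ends j t b) = y" for b using ends(4)[of b] ends(4)[of Pos] by (simp add: y_def)
  have in_sets: "r \<in> Y" "x \<in> qcarrier X" "y \<in> qcarrier X"
    using typed_reg[OF c'(1)] typed_lab[OF c'(1) semi_end_in(1)] Q f(1,2) by (auto simp: r_def x_def y_def)
  have "(sval a0 *\<^sub>R tangent L i s) \<bullet> normal_vec L j t (dir ?c (ends j t Pos)) < 0"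
    unfolding ends sides using a0[of a0] by simp
  from consistent_under[OF c'(2) kc this]
  have under: "lab ?c (ends i s (opp a0)) = qpow X x y Pos" by (simp add: x_def y_def)
  have across_over: "sreg ?c (Q (opp a0) b) = ra (sreg ?c (Q a0 b)) (y, Pos)" for b
  proof -
    have "(sval a0 *\<^sub>R tangent L i s) \<bullet> normal_vec L j t (dir ?c (ends j t b)) < 0"
      unfolding ends sides using a0[of a0] by simp
    from label_across[OF f(1,2) refl f(3)[symmetric] f(4) c'(2) Q(1) Q(2) Q(1) Q(2) this]
    show ?thesis by (simp add: y)
  qed
  have across_under: "sreg ?c (Q a (opp b0)) = ra (sreg ?c (Q a b0)) (lab ?c (ends i s a), Pos)" for a
  proof -
    have "(sval b0 *\<^sub>R tangent L j t) \<bullet> normal_vec L i s (dir ?c (ends i s a)) < 0"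
      unfolding ends sides using b0[of b0] by simp
    from label_across[OF f(2,1) f(3)[symmetric] refl f(4)[symmetric] c'(2) Q(1) _ Q(1) _ this]
    show ?thesis using Q(2)[of a b0] Q(2)[of a "opp b0"] by (simp add: add.commute)
  qed
  have W: "weight_XY L ori C k = frag_cmul (sval \<epsilon>) (frag_of (r, [x, y]))"
  proof -
    have "weight_XY L ori C k = (THE w. \<exists>a b. a = a0 \<and> b = b0 \<and>
        w = frag_cmul (sval \<epsilon>) (frag_of (areg C (Q a b), [alab C (arc_ends i s a), alab C (arc_through L j t)])))"
      unfolding k' weight_XY_def prod.case Let_def sides(1,2,3) \<epsilon>_def[symmetric] Q_def[symmetric]
      by (rule arg_cong[of _ _ The]) (auto simp: fun_eq_iff a0 b0)
    also have "\<dots> = frag_cmul (sval \<epsilon>) (frag_of (r, [x, y]))"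
      using ends(3)[of a0] ends(4)[of Pos] by (simp add: r_def x_def y_def to_assignment_simps)
    finally show ?thesis .
  qed
  show "Poly_Mapping.keys (weight_XY L ori C k) \<subseteq> B"
    unfolding W using in_sets by (auto simp: keys_frag_of B_iff)
  have slab_eq: "slab c A = (lab ?c A, e)" "snor c A = (if e = Pos then dir ?c A else opp (dir ?c A))" "sreg c = sreg ?c"
    if "c \<in> inv_class ?c" "A \<in> semi_arcs L" "e = snd (slab c A)" for c A e
  proof -
    have "canon c = ?c" using that(1) by (simp add: inv_class_def)
    then have "lab ?c A = lab c A" "dir ?c A = dir c A" "sreg c = sreg ?c"
      using canon_simps(1)[of c] canon_simps(4,5)[OF that(2), of c] by simp_all
    then show "slab c A = (lab ?c A, e)" "snor c A = (if e = Pos then dir ?c A else opp (dir ?c A))" "sreg c = sreg ?c"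
      using that(3) by (simp_all add: lab_def dir_def)
  qed
  define weight where "weight a b e d = frag_cmul (sval \<epsilon> * (sval e * sval d))
      (frag_of (sreg ?c (Q a b), [(lab ?c (ends i s a), e), (y, d)]))" for a b e d
  have sgn: "sval (hand_sign (normal_vec L j t (if d = Pos then ori j else opp (ori j)))
        (normal_vec L i s (if e = Pos then ori i else opp (ori i)))) = (sval \<epsilon> * (sval e * sval d) :: int)" for e d
    using D by (cases e; cases d; cases "ori i"; cases "ori j") (auto simp: sides \<epsilon>_def)
  have char: "weights_sym L (inv_class ?c) k = {w. \<exists>a b. \<exists>c\<in>inv_class ?c.
      a = (if snd (slab c (ends j t b)) = Pos then a0 else opp a0) \<and>
      b = (if snd (slab c (ends i s a)) = Pos then b0 else opp b0) \<and>
      w = weight a b (snd (slab c (ends i s a))) (snd (slab c (ends j t b)))}"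
  proof -
    have A: "ends i s a \<in> semi_arcs L" "ends j t b \<in> semi_arcs L" for a b using semi_end_in(1) f(1,2) by blast+
    have side1: "sval (if e = Pos then ori i else opp (ori i)) * sval b * D < 0 \<longleftrightarrow>
        b = (if e = Pos then b0 else opp b0)" for e b
      using b0[of b] b0[of "opp b"] by (cases e; cases b; cases b0) auto
    have side2: "- (sval (if e = Pos then ori j else opp (ori j)) * sval a * D) < 0 \<longleftrightarrow>
        a = (if e = Pos then a0 else opp a0)" for e a
      using a0[of a] a0[of "opp a"] by (cases e; cases a; cases a0) auto
    have "(let A1 = ends i s a; A2 = ends j t b;
         n1 = normal_vec L i s (snor c A1); n2 = normal_vec L j t (snor c A2);
         v = quadrant L (i, s, j, t) a b in
         v \<bullet> n1 < 0 \<and> v \<bullet> n2 < 0 \<and>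
         w = frag_cmul (sval (hand_sign n2 n1))
           (frag_of (sreg c (quadrant_region L (i, s, j, t) a b), [slab c A1, slab c A2]))) \<longleftrightarrow>
      a = (if snd (slab c (ends j t b)) = Pos then a0 else opp a0) \<and>
      b = (if snd (slab c (ends i s a)) = Pos then b0 else opp b0) \<and>
      w = weight a b (snd (slab c (ends i s a))) (snd (slab c (ends j t b)))"
      if c: "c \<in> inv_class ?c" for a b c w
      unfolding Let_def sides(1,2) slab_eq(2)[OF c A(1) refl] slab_eq(2)[OF c A(2) refl] ends side1 side2 sgn
        slab_eq(3)[OF c A(1) refl] weight_def Q_def
      using slab_eq(1)[OF c A(1) refl, of a] slab_eq(1)[OF c A(2) refl, of b] by (auto simp: y)
    then show ?thesis unfolding k' weights_sym_def prod.case by blast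
  qed
  have cc: "?c \<in> inv_class ?c" using c canon_of_positive by (simp add: inv_class_def)
  show "weights_sym L (inv_class ?c) k \<noteq> {}"
  proof -
    have "snd (slab ?c (ends i s a0)) = Pos" "snd (slab ?c (ends j t b0)) = Pos"
      using c(2) semi_end_in(1) f(1,2) by (auto simp: positive_def)
    then have "weight a0 b0 Pos Pos \<in> weights_sym L (inv_class ?c) k"
      unfolding char using cc by (intro CollectI exI[of _ a0] exI[of _ b0] bexI[of _ ?c]) auto
    then show ?thesis by blast
  qed
  show "w - lift (weight_XY L ori C k) \<in> N" if wk: "w \<in> weights_sym L (inv_class ?c) k"
  proof -
    obtain a b e d where "a = (if d = Pos then a0 else opp a0)" "b = (if e = Pos then b0 else opp b0)"
      "w = weight a b e d"
      using wk unfolding char by blast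
    then have w: "w = weight (if d = Pos then a0 else opp a0) (if e = Pos then b0 else opp b0) e d"
      by simp
    \<comment> \<open>Up to sign, these are the weights of the four types of representatives; \<open>?t2\<close> belongs to the
      one with two negative labels.\<close>
    let ?x' = "qpow X x y Pos"
    let ?t0 = "frag_of (r, [(x, Pos), (y, Pos)])"
    let ?t1 = "frag_of (ra r (y, Pos), [(?x', Pos), (y, Neg)])"
    let ?t2 = "frag_of (ra (ra r (y, Pos)) (?x', Pos), [(?x', Neg), (y, Neg)])"
    let ?t3 = "frag_of (ra r (x, Pos), [(x, Neg), (y, Pos)])"
    have lift_W: "lift (weight_XY L ori C k) = frag_cmul (sval \<epsilon>) ?t0"
      by (simp add: W lift_def frag_extend_cmul)
    have n1: "?t0 + ?t1 \<in> N" using N_flip_last[OF in_sets, of Pos Pos] by simp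
    have n2: "?t1 + ?t2 \<in> N" using N_flip_first[of "ra r (y, Pos)" ?x' y Pos Neg] in_sets by simp
    have n3: "?t0 + ?t3 \<in> N" using N_flip_first[OF in_sets, of Pos Pos] by simp
    have n4: "?t2 - ?t0 \<in> N" using N_diff[OF n2 n1] by (simp add: algebra_simps)
    show ?thesis
    proof (cases d; cases e)
      assume "d = Pos" "e = Pos"
      then show ?thesis using N_0 by (simp add: w lift_W weight_def r_def[symmetric] x_def[symmetric])
    next
      assume "d = Pos" "e = Neg"
      then have "w = frag_cmul (- sval \<epsilon>) ?t3"
        by (simp add: w weight_def across_under r_def[symmetric] x_def[symmetric])
      then have "w - lift (weight_XY L ori C k) = - frag_cmul (sval \<epsilon>) (?t0 + ?t3)"
        by (simp add: lift_W frag_cmul_distrib2 minus_frag_cmul[symmetric] del: minus_frag_cmul)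
      then show ?thesis using N_uminus[OF N_cmul[OF n3]] by simp
    next
      assume "d = Neg" "e = Pos"
      then have "w = frag_cmul (- sval \<epsilon>) ?t1"
        by (simp add: w weight_def across_over r_def[symmetric] under)
      then have "w - lift (weight_XY L ori C k) = - frag_cmul (sval \<epsilon>) (?t0 + ?t1)"
        by (simp add: lift_W frag_cmul_distrib2 minus_frag_cmul[symmetric] del: minus_frag_cmul)
      then show ?thesis using N_uminus[OF N_cmul[OF n1]] by simp
    next
      assume "d = Neg" "e = Neg"
      then have "w = frag_cmul (sval \<epsilon>) ?t2"
        by (simp add: w weight_def across_over across_under r_def[symmetric] under)
      then have "w - lift (weight_XY L ori C k) = frag_cmul (sval \<epsilon>) (?t2 - ?t0)"
        by (cases \<epsilon>) (simp_all add: lift_W)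
      then show ?thesis using N_cmul[OF n4] by simp
    qed
  qed
qed

lemma W_sym_eq:
  assumes C: "C \<in> colorings ori"
  defines "d \<equiv> \<Sum>k\<in>crossings L. weight_XY L ori C k"
  shows "Poly_Mapping.keys d \<subseteq> B"
    and "W_sym (double X) Y ra L (inv_class (to_assignment ori C)) = SQ_class (double X) Y ra 2 (lift d)"
proof -
  let ?w = "\<lambda>k. SOME w. w \<in> weights_sym L (inv_class (to_assignment ori C)) k"
  show "Poly_Mapping.keys d \<subseteq> B"
    using sum_closed_free_Abelian_group[of "crossings L" "weight_XY L ori C" B] weight_classes(1)[OF C]
    by (simp add: d_def)
  have w: "?w k - lift (weight_XY L ori C k) \<in> N" if "k \<in> crossings L" for k
    using weight_classes(2,3)[OF C that] some_in_eq by blast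
  have "(\<Sum>k\<in>K. ?w k - lift (weight_XY L ori C k)) \<in> N" if "finite K" "K \<subseteq> crossings L" for K
    using that
  proof (induction K)
    case empty
    show ?case using N_0 by simp
  next
    case (insert k K)
    then show ?case using N_add w by simp
  qed
  from this[OF finite_crossings subset_refl]
  have "(\<Sum>k\<in>crossings L. ?w k) - lift d \<in> N"
    by (simp add: d_def sum_subtractf lift_def frag_extend_sum[OF finite_crossings] comp_def)
  then show "W_sym (double X) Y ra L (inv_class (to_assignment ori C)) = SQ_class (double X) Y ra 2 (lift d)"
    unfolding W_sym_def by (rule SQ_class_eq)
qed

end

section \<open>Equality of the invariants\<close>

lemma same_multisetI:
  assumes h: "bij_betw h I J" and eq: "\<And>i. i \<in> I \<Longrightarrow> g (h i) = f i"
  shows "(I, f) \<simeq>\<^sub>m (J, g)"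
proof -
  have "{i \<in> I. f i = a} \<approx> {j \<in> J. g j = a}" for a
  proof -
    have "bij_betw h {i \<in> I. f i = a} {j \<in> J. g j = a}"
      using h eq unfolding bij_betw_def inj_on_def by force
    then show ?thesis unfolding eqpoll_def by blast
  qed
  then show ?thesis by (simp add: same_multiset_def)
qed

theorem theorem5p10:
  fixes X :: "'x quandle" and Y :: "'y set" and act :: "'y \<Rightarrow> 'x gword set \<Rightarrow> 'y"
    and A :: "('a, 'k) monoid_scheme"
    and \<theta>Q :: "('y, 'x) chain set \<Rightarrow> 'a"
    and \<theta>SQ :: "('y, 'x \<times> sign) chain set \<Rightarrow> 'a"
    and D :: link and ori :: orientation
    and C :: "('x \<times> sign, 'y) assignment set"
  assumes "quandle X"
    and "quandle_set X Y act"
    and "comm_group A"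
    and "quandle_2_cocycle X Y (gact X act) A \<theta>Q"
    and "sym_quandle_2_cocycle (double X) Y (sym_gact (double X) (double_act X act)) A \<theta>SQ"
    and "\<forall>K \<in> carrier (CSQ (double X) Y (sym_gact (double X) (double_act X act)) 2).
           \<theta>Q (double_chain_map X Y act 2 K) = \<theta>SQ K"
    and "link_diagram D"
    and "C \<in> Col_sym (double X) Y (sym_gact (double X) (double_act X act)) D"
    and "induces_orientation D C ori"
  shows "Phi_Q X Y act \<theta>Q D ori \<simeq>\<^sub>m Phi_SQ X Y act \<theta>SQ D C"
proof -
  interpret colored_diagram D X Y act
    using assms by unfold_locales
  have "bij_betw (inv_class \<circ> to_assignment ori) (colorings ori) (ori_class X Y ra D C)"
    unfolding ori_class_eq[OF assms(8,9)]
    by (rule bij_betw_trans[OF bij_to_assignment bij_betw_imageI[OF inj_inv_class refl]])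
  moreover have "\<theta>SQ (W_sym (double X) Y ra D ((inv_class \<circ> to_assignment ori) C')) = \<theta>Q (W_XY X Y D ori C')"
    if C': "C' \<in> colorings ori" for C'
  proof -
    note W = W_sym_eq[OF C']
    show ?thesis
      using bspec[OF assms(6) SQ_class_carrier[OF keys_lift[OF W(1)]]] double_chain_map_lift[OF W(1)] W(2)
      by (simp add: W_XY_def)
  qed
  ultimately show ?thesis
    unfolding Phi_Q_def Phi_SQ_def Let_def by (rule same_multisetI)
qed

end
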